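(* Let $f_1,\dots,f_m$ be polynomials in $z=(z_1,\dots,z_n)$ with complex coefficients, let $f=f_1\cdots f_m$, and assume that the Newton polytope $\Delta_f$ has dimension $n$. For $\theta\notin\overline{\mathcal{A}'_f}$, the Euler--Mellin integral $$M_f^\theta(s,t)=\int_{\operatorname{Arg}^{-1}(\theta)}\frac{z^s}{f(z)^t}\,\frac{dz}{z}$$ is a locally constant function of $\theta$. Thus it depends only on the connected component $\Theta$ of the complement of $\overline{\mathcal{A}'_f}$ containing $\theta$, and may be written $M_f^\Theta:=M_f^\theta$. Accordingly, $M_f^\Theta$ has a meromorphic continuation to $\mathbb{C}^{n+m}$, of the form $$M_f^\Theta(s,t)=\Phi_f^\Theta(s,t)\prod_{k=1}^N\Gamma\bigl(\langle\mu_k,s\rangle-\langle\nu_k,t\rangle\bigr)$$ with $\Phi_f^\Theta:=\Phi_f^\theta$ entire and depending only on $\Theta$.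
   Context: Coamoeba: $\mathbb{C}_*=\mathbb{C}\setminus\{0\}$, $Z_f=\{z\in(\mathbb{C}_* )^n\mid f(z)=0\}$, $\operatorname{Arg}(z)=(\arg z_1,\dots,\arg z_n)$, and $\mathcal{A}'_f:=\operatorname{Arg}(Z_f)$. The coamoeba may be viewed in the torus $\mathbb{T}^n=(\mathbb{R}/2\pi\mathbb{Z})^n$ or as a $2\pi\mathbb{Z}^n$-periodic subset of $\mathbb{R}^n$. Here $\theta$ and components $\Theta$ are taken in $\mathbb{R}^n$. $\operatorname{Arg}^{-1}(\theta)=\{e^{x+i\theta}\mid x\in\mathbb{R}^n\}\subset(\mathbb{C}_* )^n$. Integral: $z^s=z_1^{s_1}\cdots z_n^{s_n}$, $f(z)^t=f_1(z)^{t_1}\cdots f_m(z)^{t_m}$, $\frac{dz}{z}=\frac{dz_1\wedge\cdots\wedge dz_n}{z_1\cdots z_n}$, so that $$M_f^\theta(s,t)=\int_{\mathbb{R}^n}\frac{e^{\langle s,x+i\theta\rangle}}{f(e^{x+i\theta})^t}\,dx.$$ For $\theta$ in a component $\Theta$, the powers $f_i^{t_i}=\exp(t_i\log f_i)$ are defined with one fixed holomorphic branch of $w\mapsto\log f_i(e^w)$ on $\mathbb{R}^n+i\Theta$. The integral is considered for $(s,t)\in\mathbb{C}^{n+m}$ with $\tau=\operatorname{Re}t\in(0,\infty)^m$ and $\operatorname{Re}s\in\operatorname{int}(\tau\Delta_f)$, where it converges; here $\tau\Delta_f:=\sum_i\tau_i\Delta_{f_i}$ is the weighted Minkowski sum of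 the Newton polytopes $\Delta_{f_i}$. Gamma factors: $\mu_1,\dots,\mu_N\in\mathbb{Z}^n$ are the distinct primitive inward facet normals of $\Delta_f$, and $\nu_k=(\nu_k^1,\dots,\nu_k^m)$ with $\nu_k^i=\min\{\langle\mu_k,\alpha\rangle\mid\alpha\in\Delta_{f_i}\}$, so that $\tau\Delta_f=\bigcap_k\{\sigma\in\mathbb{R}^n\mid\langle\mu_k,\sigma\rangle\ge\langle\nu_k,\tau\rangle\}$ for all $\tau\in(0,\infty)^m$. $\Phi_f^\theta$ denotes the entire factor in the continuation of $M_f^\theta$. *)

theory Defs
  imports "HOL-Analysis.Analysis" "HOL-Library.Poly_Mapping"
begin

section \<open>Polynomials and Newton polytopes\<close>

text \<open>
  A polynomial in the variables indexed by \<open>'n\<close> is a finitely supported map from exponent vectors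
  to coefficients; multiplication of \<open>poly_mapping\<close> is then multiplication of polynomials.
\<close>

type_synonym 'n cpoly = "(nat ^ 'n) \<Rightarrow>\<^sub>0 complex"

definition peval :: "('n::finite) cpoly \<Rightarrow> complex ^ 'n \<Rightarrow> complex" where
  "peval p z = (\<Sum>\<alpha>\<in>Poly_Mapping.keys p. Poly_Mapping.lookup p \<alpha> * (\<Prod>j\<in>UNIV. (z $ j) ^ (\<alpha> $ j)))"

definition newton_polytope :: "('n::finite) cpoly \<Rightarrow> (real ^ 'n) set" where
  "newton_polytope p = convex hull ((\<lambda>\<alpha>. \<chi> j. real (\<alpha> $ j)) ` Poly_Mapping.keys p)"

definition weighted_newton_sum ::
  "('m::finite \<Rightarrow> ('n::finite) cpoly) \<Rightarrow> real ^ 'm \<Rightarrow> (real ^ 'n) set" where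
  "weighted_newton_sum f \<tau> =
     {\<Sum>i\<in>UNIV. (\<tau> $ i) *\<^sub>R a i | a. \<forall>i. a i \<in> newton_polytope (f i)}"


section \<open>The coamoeba\<close>

text \<open>
  The coamoeba as a \<open>2 \<pi>\<close>-periodic subset of real n-space: all choices of arguments of
  the zeros in the complex torus.
\<close>

definition coamoeba :: "('n::finite) cpoly \<Rightarrow> (real ^ 'n) set" where
  "coamoeba p = {\<theta>. \<exists>z. (\<forall>j. z $ j \<noteq> 0) \<and> peval p z = 0 \<and> (\<forall>j. is_Arg (z $ j) (\<theta> $ j))}"


section \<open>Functions of several complex variables\<close>

text \<open>On open sets: Frechet differentiability with a complex-linear derivative.\<close>

definition holomorphic_vec_on ::
  "(complex ^ ('k::finite) \<Rightarrow> complex) \<Rightarrow> (complex ^ 'k) set \<Rightarrow> bool" where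
  "holomorphic_vec_on F U \<longleftrightarrow>
     (\<forall>w\<in>U. \<exists>D. (F has_derivative D) (at w) \<and> (\<forall>c v. D (c *s v) = c * D v))"

text \<open>
  Locally a quotient of holomorphic functions with denominator not identically zero. Since functions
  are total, the value of \<open>F\<close> where the denominator vanishes is irrelevant.
\<close>

definition meromorphic_vec_on ::
  "(complex ^ ('k::finite) \<Rightarrow> complex) \<Rightarrow> (complex ^ 'k) set \<Rightarrow> bool" where
  "meromorphic_vec_on F U \<longleftrightarrow>
     (\<forall>p\<in>U. \<exists>V g h. open V \<and> connected V \<and> p \<in> V \<and> V \<subseteq> U \<and>
        holomorphic_vec_on g V \<and> holomorphic_vec_on h V \<and> (\<exists>w\<in>V. h w \<noteq> 0) \<and>
        (\<forall>w\<in>V. h w \<noteq> 0 \<longrightarrow> F w = g w / h w))"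

definition meromorphic_continuation ::
  "(complex ^ ('k::finite) \<Rightarrow> complex) \<Rightarrow> (complex ^ 'k) set \<Rightarrow> (complex ^ 'k \<Rightarrow> complex) \<Rightarrow> bool" where
  "meromorphic_continuation F D G \<longleftrightarrow> meromorphic_vec_on G UNIV \<and> (\<forall>p\<in>D. G p = F p)"


section \<open>Euler--Mellin integrals\<close>

text \<open>
  A point \<open>p\<close> of complex (n+m)-space is indexed by the sum type \<open>'n + 'm\<close>; its two blocks are
  the parameters s and t.
\<close>

definition spart :: "complex ^ ('n::finite + 'm::finite) \<Rightarrow> complex ^ 'n" where
  "spart p = (\<chi> j. p $ Inl j)"

definition tpart :: "complex ^ ('n::finite + 'm::finite) \<Rightarrow> complex ^ 'm" where
  "tpart p = (\<chi> i. p $ Inr i)"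

definition tube :: "(real ^ 'n::finite) set \<Rightarrow> (complex ^ 'n) set" where
  "tube S = {w. (\<chi> j. Im (w $ j)) \<in> S}"

text \<open>
  When \<open>S\<close> is open with several components, a holomorphic function on \<open>tube S\<close> is an independent
  choice of a holomorphic function on the tube over each component. So this is one fixed
  branch of the logarithm of p(e^w) for each component of \<open>S\<close>.
\<close>

definition log_branch_on ::
  "('n::finite) cpoly \<Rightarrow> (real ^ 'n) set \<Rightarrow> (complex ^ 'n \<Rightarrow> complex) \<Rightarrow> bool" where
  "log_branch_on p S l \<longleftrightarrow> holomorphic_vec_on l (tube S) \<and>
     (\<forall>w\<in>tube S. exp (l w) = peval p (\<chi> j. exp (w $ j)))"

text \<open>
  In logarithmic coordinates \<open>w = x + \<i> \<theta>\<close>; the function \<open>l i\<close> stands for the logarithm of the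
  i-th polynomial at e^w.
\<close>

definition euler_mellin_integrand ::
  "('m::finite \<Rightarrow> complex ^ ('n::finite) \<Rightarrow> complex) \<Rightarrow> complex ^ ('n + 'm) \<Rightarrow> complex ^ 'n \<Rightarrow> complex" where
  "euler_mellin_integrand l p w =
     exp (\<Sum>j\<in>UNIV. spart p $ j * w $ j) / (\<Prod>i\<in>UNIV. exp (tpart p $ i * l i w))"

definition cvec :: "real ^ ('n::finite) \<Rightarrow> real ^ 'n \<Rightarrow> complex ^ 'n" where
  "cvec x \<theta> = (\<chi> j. Complex (x $ j) (\<theta> $ j))"

definition euler_mellin ::
  "('m::finite \<Rightarrow> complex ^ ('n::finite) \<Rightarrow> complex) \<Rightarrow> real ^ 'n \<Rightarrow> complex ^ ('n + 'm) \<Rightarrow> complex" where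
  "euler_mellin l \<theta> p = (LINT x|lborel. euler_mellin_integrand l p (cvec x \<theta>))"

definition convergence_domain ::
  "('m::finite \<Rightarrow> ('n::finite) cpoly) \<Rightarrow> (complex ^ ('n + 'm)) set" where
  "convergence_domain f = {p. (\<forall>i. Re (tpart p $ i) > 0) \<and>
     (\<chi> j. Re (spart p $ j)) \<in> interior (weighted_newton_sum f (\<chi> i. Re (tpart p $ i)))}"


section \<open>Gamma factors\<close>

definition ipair :: "int ^ ('n::finite) \<Rightarrow> ('a::comm_ring_1) ^ 'n \<Rightarrow> 'a" where
  "ipair \<mu> v = (\<Sum>j\<in>UNIV. of_int (\<mu> $ j) * v $ j)"

definition primitive_facet_normals :: "(real ^ ('n::finite)) set \<Rightarrow> (int ^ 'n) set" where
  "primitive_facet_normals P = {\<mu>. Gcd (range (\<lambda>j. \<mu> $ j)) = 1 \<and>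
     {\<sigma>\<in>P. \<forall>\<rho>\<in>P. ipair \<mu> \<sigma> \<le> ipair \<mu> \<rho>} facet_of P}"

text \<open>The infimum is a minimum, since the polytope of a nonzero polynomial is compact and nonempty.\<close>

definition support_min :: "('n::finite) cpoly \<Rightarrow> int ^ 'n \<Rightarrow> real" where
  "support_min p \<mu> = (INF \<alpha>\<in>newton_polytope p. ipair \<mu> \<alpha>)"

definition gamma_factor ::
  "('m::finite \<Rightarrow> ('n::finite) cpoly) \<Rightarrow> complex ^ ('n + 'm) \<Rightarrow> complex" where
  "gamma_factor f p = (\<Prod>\<mu>\<in>primitive_facet_normals (newton_polytope (\<Prod>i\<in>UNIV. f i)).
     Gamma (ipair \<mu> (spart p) - (\<Sum>i\<in>UNIV. complex_of_real (support_min (f i) \<mu>) * tpart p $ i)))"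

definition entire_factor ::
  "('m::finite \<Rightarrow> ('n::finite) cpoly) \<Rightarrow> ('m \<Rightarrow> complex ^ 'n \<Rightarrow> complex) \<Rightarrow> real ^ 'n \<Rightarrow>
     (complex ^ ('n + 'm) \<Rightarrow> complex) \<Rightarrow> bool" where
  "entire_factor f l \<theta> \<Phi> \<longleftrightarrow> holomorphic_vec_on \<Phi> UNIV \<and>
     meromorphic_continuation (euler_mellin l \<theta>) (convergence_domain f)
       (\<lambda>p. \<Phi> p * gamma_factor f p)"

end

theory Submission
  imports Defs "HOL-Complex_Analysis.Complex_Analysis"
begin

text \<open>
  In the coordinates \<open>z = e^w\<close>, \<open>w = x + \<i> \<theta>\<close>, the integrand is \<open>exp (B(w) \<cdot> p)\<close>, where \<open>p = (s, t)\<close> and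
  \<open>B(w)\<close> consists of the coordinates of \<open>w\<close> and of the functions \<open>- log f\<^sub>i(e^w)\<close>. Everything rests on a
  bound \<open>C e^{- \<epsilon> |x|}\<close> for it, uniform for \<open>p\<close> near a point of the domain of convergence and \<open>\<theta>\<close> near a
  point outside the closed coamoeba (\<open>mellin_integrand_bound\<close>). Three facts enter.
  The modulus \<open>|f\<^sub>i(e^w)|\<close> is at least a constant times \<open>e^{max \<langle>\<alpha>, x\<rangle>}\<close>, the maximum being over the exponents
  of \<open>f\<^sub>i\<close>, because the exponential sums \<open>f\<^sub>i(e^{x + w})\<close>, divided by this maximum, form a relatively compact
  family of functions of \<open>w\<close> whose limits have no zeros either, by Hurwitz's theorem
  (\<open>expsum_lower_bound\<close>). The argument of \<open>f\<^sub>i(e^{x + \<i> \<theta>})\<close> is bounded in \<open>x\<close>, because along a line every half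
  turn produces a zero of a real exponential sum, and unless it vanishes identically such a sum has
  fewer zeros than terms (\<open>arg_increase_bound\<close>). Finally \<open>Re s\<close> is an interior point of the polytope \<open>\<tau>\<Delta>\<^sub>f\<close>, which leaves room
  for the decay.

  The bound and Cauchy's estimates permit differentiation under the integral sign, with respect to \<open>p\<close>
  and with respect to a complex number \<open>\<zeta>\<close> in a translation \<open>w \<mapsto> w + \<zeta> v\<close> by a multiple of a real vector \<open>v\<close>.
  Lebesgue measure is translation invariant, so the integral does not change for real \<open>\<zeta>\<close>, and therefore
  its complex derivative at \<open>\<zeta> = 0\<close> vanishes (\<open>euler_mellin_line\<close>). Imaginary \<open>\<zeta>\<close> move \<open>\<theta>\<close>: the integral is
  locally constant in \<open>\<theta>\<close>. Written out for a facet normal \<open>v = \<mu>\<^sub>k\<close>, with \<open>\<ell>\<^sub>k(s, t) = \<langle>\<mu>\<^sub>k, s\<rangle> - \<langle>\<nu>\<^sub>k, t\<rangle>\<close>, the vanishing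
  of the derivative is the recursion
  \<open>\<ell>\<^sub>k(s, t) M(s, t) = \<Sum> t\<^sub>i c\<^sub>i\<^sub>,\<^sub>\<alpha> (\<langle>\<mu>\<^sub>k, \<alpha>\<rangle> - \<nu>\<^sub>k\<^sup>i) M(s + \<alpha>, t + e\<^sub>i)\<close>, the sum being over the monomials \<open>c\<^sub>i\<^sub>,\<^sub>\<alpha> z^\<alpha>\<close>
  of the \<open>f\<^sub>i\<close>. The monomials on the facet drop out, so that \<open>\<ell>\<^sub>k\<close> increases by at least \<open>1\<close> in
  every remaining term, while no \<open>\<ell>\<^sub>j\<close> decreases. In the relation \<open>M(s, t) = \<Sum> c\<^sub>i\<^sub>,\<^sub>\<alpha> M(s + \<alpha>, t + e\<^sub>i)\<close>, for
  one \<open>i\<close>, it is \<open>t\<^sub>i\<close> that increases. After multiplication by \<open>\<Prod> 1 / \<Gamma>(\<ell>\<^sub>k)\<close> both relations have polynomial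
  coefficients, and each of them extends the product over a further strip
  (\<open>entire_continuation_by_recurrences\<close>).

  For this the domain of convergence has to be described by \<open>\<ell>\<^sub>k > 0\<close> and \<open>t\<^sub>i > 0\<close> (real parts), that is,
  the facet normals of \<open>\<tau>\<Delta>\<^sub>f\<close> must be those of \<open>\<Delta>\<^sub>f\<close> for all positive \<open>\<tau>\<close>. This holds since faces of a weighted
  Minkowski sum are sums of faces, and the dimension of such a sum does not depend on the weights
  (\<open>interior_weighted_newton_sum_if\<close>).
\<close>

(* Formal power series use the same symbol for their coefficients as vectors for their components. *)
no_notation fps_nth (infixl "$" 75)

section \<open>Exponential sums without zeros over a tube\<close>

abbreviation support :: "('n::finite) cpoly \<Rightarrow> (nat ^ 'n) set" where
  "support \<equiv> Poly_Mapping.keys"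

abbreviation coeff_of :: "('n::finite) cpoly \<Rightarrow> nat ^ 'n \<Rightarrow> complex" where
  "coeff_of \<equiv> Poly_Mapping.lookup"

definition cplx :: "real ^ 'n::finite \<Rightarrow> complex ^ 'n" where
  "cplx x = (\<chi> j. complex_of_real (x $ j))"

definition cpair :: "complex ^ 'n::finite \<Rightarrow> complex ^ 'n \<Rightarrow> complex" where
  "cpair a w = (\<Sum>j\<in>UNIV. a $ j * w $ j)"

lemma scaleR_eq_scalar_mult: "r *\<^sub>R v = complex_of_real r *s (v :: complex ^ 'k::finite)"
  by (simp add: vec_eq_iff, simp add: scaleR_conv_of_real)

lemma cpair_add_right: "cpair a (v + w) = cpair a v + cpair a w"
  by (simp add: cpair_def algebra_simps sum.distrib)

lemma cpair_scale_right: "cpair a (c *s w) = c * cpair a w"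
  by (simp add: cpair_def sum_distrib_left mult_ac)

lemma cpair_cplx: "cpair (cplx a) (cplx b) = of_real (a \<bullet> b)"
  by (simp add: cpair_def cplx_def inner_vec_def)

lemma cvec_eq: "cvec x \<theta> = cplx x + \<i> *s cplx \<theta>"
  by (simp add: cvec_def cplx_def vec_eq_iff complex_eq_iff)

lemma continuous_on_cplx [continuous_intros]:
  "continuous_on S g \<Longrightarrow> continuous_on S (\<lambda>x. cplx (g x))"
  unfolding cplx_def
  by (intro continuous_on_vec_lambda continuous_intros continuous_on_component)

lemma continuous_on_cpair [continuous_intros]:
  "continuous_on S g \<Longrightarrow> continuous_on S h \<Longrightarrow> continuous_on S (\<lambda>x. cpair (g x) (h x))"
  unfolding cpair_def
  by (intro continuous_intros continuous_on_component)

lemma continuous_on_cvec [continuous_intros]: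
  "continuous_on S g \<Longrightarrow> continuous_on S h \<Longrightarrow> continuous_on S (\<lambda>x. cvec (g x) (h x))"
  unfolding cvec_def Complex_eq
  by (intro continuous_on_vec_lambda continuous_intros continuous_on_component)

lemma tendsto_cpair [tendsto_intros]:
  "(g \<longlongrightarrow> a) F \<Longrightarrow> (h \<longlongrightarrow> b) F \<Longrightarrow> ((\<lambda>x. cpair (g x) (h x)) \<longlongrightarrow> cpair a b) F"
  unfolding cpair_def by (intro tendsto_intros)

lemma tendsto_cplx [tendsto_intros]:
  "(g \<longlongrightarrow> a) F \<Longrightarrow> ((\<lambda>x. cplx (g x)) \<longlongrightarrow> cplx a) F"
  unfolding cplx_def by (intro tendsto_intros)

definition expsum :: "'a set \<Rightarrow> ('a \<Rightarrow> complex) \<Rightarrow> ('a \<Rightarrow> real ^ 'n::finite) \<Rightarrow> complex ^ 'n \<Rightarrow> complex" where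
  "expsum A c e w = (\<Sum>i\<in>A. c i * exp (cpair (cplx (e i)) w))"

lemma common_convergent_subsequence:
  fixes u :: "nat \<Rightarrow> 'a \<Rightarrow> real"
  assumes "finite A" "\<And>i. i \<in> A \<Longrightarrow> bounded (range (\<lambda>k. u k i))"
  shows "\<exists>r l. strict_mono r \<and> (\<forall>i\<in>A. (\<lambda>k. u (r k) i) \<longlonglongrightarrow> l i)"
  using assms
proof (induction A rule: finite_induct)
  case empty
  show ?case by (intro exI[of _ id]) (simp add: strict_mono_def)
next
  case (insert a A)
  then obtain r l where r: "strict_mono (r :: nat \<Rightarrow> nat)" and l: "\<And>i. i \<in> A \<Longrightarrow> (\<lambda>k. u (r k) i) \<longlonglongrightarrow> l i"
    by auto
  have "bounded (range (\<lambda>k. u k a))" using insert by blast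
  then have "bounded (range (\<lambda>k. u (r k) a))"
    by (rule bounded_subset) auto
  then obtain l' r' where r': "strict_mono (r' :: nat \<Rightarrow> nat)" and l': "((\<lambda>k. u (r k) a) \<circ> r') \<longlonglongrightarrow> l'"
    using bounded_imp_convergent_subsequence by blast
  have "strict_mono (r \<circ> r')" using r r' by (simp add: strict_mono_o)
  moreover have "(\<lambda>k. u ((r \<circ> r') k) i) \<longlonglongrightarrow> (l(a := l')) i" if "i \<in> insert a A" for i
  proof (cases "i = a")
    case True
    then show ?thesis using l' by (simp add: o_def)
  next
    case False
    then show ?thesis using LIMSEQ_subseq_LIMSEQ[OF l r', of i] that by (simp add: o_def)
  qed
  ultimately show ?case by blast
qed

lemma uniform_limit_sum:
  fixes f :: "'a \<Rightarrow> 'i \<Rightarrow> 'b \<Rightarrow> 'c::real_normed_vector"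
  assumes "\<And>i. i \<in> A \<Longrightarrow> uniform_limit K (f i) (l i) F"
  shows "uniform_limit K (\<lambda>k x. \<Sum>i\<in>A. f i k x) (\<lambda>x. \<Sum>i\<in>A. l i x) F"
  using assms
  by (induction A rule: infinite_finite_induct) (auto intro!: uniform_limit_intros)

text \<open>
  An exponent of maximal norm dominates in its own direction: by the Cauchy--Schwarz inequality its
  inner product with itself exceeds the inner products with the others.
\<close>

lemma expsum_line_nonzero:
  assumes "finite A" "i0 \<in> A" "c i0 \<noteq> (0::complex)" "inj_on e A"
    and max: "\<And>i. i \<in> A \<Longrightarrow> norm (e i) \<le> norm (e i0)"
  shows "\<exists>T::real. (\<Sum>i\<in>A. c i * exp (of_real T * of_real (e i \<bullet> e i0))) \<noteq> 0"
proof -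
  have lim: "((\<lambda>T::real. \<Sum>i\<in>A. c i * of_real (exp (T * (e i \<bullet> e i0 - e i0 \<bullet> e i0)))) \<longlongrightarrow>
     (\<Sum>i\<in>A. if i = i0 then c i0 else 0)) at_top"
  proof (intro tendsto_sum)
    fix i assume i: "i \<in> A"
    show "((\<lambda>T::real. c i * of_real (exp (T * (e i \<bullet> e i0 - e i0 \<bullet> e i0)))) \<longlongrightarrow>
        (if i = i0 then c i0 else 0)) at_top"
    proof (cases "i = i0")
      case False
      then have "e i \<noteq> e i0" using assms i by (auto simp: inj_on_def)
      have "e i \<bullet> e i0 < e i0 \<bullet> e i0"
      proof -
        have "(e i - e i0) \<bullet> (e i - e i0) > 0" using \<open>e i \<noteq> e i0\<close> by simp
        moreover have "e i \<bullet> e i \<le> e i0 \<bullet> e i0" using max[OF i] by (simp add: norm_le)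
        ultimately show ?thesis by (simp add: inner_diff inner_commute)
      qed
      then have "filterlim (\<lambda>T::real. T * (e i \<bullet> e i0 - e i0 \<bullet> e i0)) at_bot at_top"
        using filterlim_tendsto_neg_mult_at_bot[OF tendsto_const _ filterlim_ident, of "e i \<bullet> e i0 - e i0 \<bullet> e i0"] by (simp add: mult.commute)
      then have "((\<lambda>T::real. exp (T * (e i \<bullet> e i0 - e i0 \<bullet> e i0))) \<longlongrightarrow> 0) at_top"
        by (rule filterlim_compose[OF exp_at_bot])
      then have "((\<lambda>T::real. c i * of_real (exp (T * (e i \<bullet> e i0 - e i0 \<bullet> e i0)))) \<longlongrightarrow> c i * of_real 0) at_top"
        by (intro tendsto_intros)
      then show ?thesis using False by simp
    qed simp
  qed
  have "(\<Sum>i\<in>A. if i = i0 then c i0 else 0) \<noteq> 0" using assms by simp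
  then have "\<forall>\<^sub>F T in at_top. (\<Sum>i\<in>A. c i * of_real (exp (T * (e i \<bullet> e i0 - e i0 \<bullet> e i0)))) \<noteq> 0"
    using lim tendsto_imp_eventually_ne by blast
  then obtain T :: real where T: "(\<Sum>i\<in>A. c i * of_real (exp (T * (e i \<bullet> e i0 - e i0 \<bullet> e i0)))) \<noteq> 0"
    by (meson eventually_at_top_linorder order_refl)
  have "(\<Sum>i\<in>A. c i * exp (of_real T * of_real (e i \<bullet> e i0))) =
     of_real (exp (T * (e i0 \<bullet> e i0))) * (\<Sum>i\<in>A. c i * of_real (exp (T * (e i \<bullet> e i0 - e i0 \<bullet> e i0))))"
    unfolding sum_distrib_left
  proof (intro sum.cong refl)
    fix i
    have "exp (T * (e i \<bullet> e i0)) = exp (T * (e i0 \<bullet> e i0)) * exp (T * (e i \<bullet> e i0 - e i0 \<bullet> e i0))"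
      by (simp add: algebra_simps flip: exp_add)
    then show "c i * exp (of_real T * of_real (e i \<bullet> e i0)) =
        of_real (exp (T * (e i0 \<bullet> e i0))) * (c i * of_real (exp (T * (e i \<bullet> e i0 - e i0 \<bullet> e i0))))"
      by (simp add: exp_of_real flip: of_real_mult)
  qed
  also have "\<dots> \<noteq> 0" using T by simp
  finally show ?thesis by blast
qed

lemma expsum_cvec_add:
  "expsum A c e (w + \<zeta> *s v) = (\<Sum>i\<in>A. c i * exp (cpair (cplx (e i)) w) * exp (\<zeta> * cpair (cplx (e i)) v))"
  by (simp add: expsum_def cpair_add_right cpair_scale_right exp_add mult_ac)

text \<open>
  Divided by \<open>e^{m\<^sub>k}\<close>, the sums on the tubes through \<open>x\<^sub>k + \<i> \<theta>\<^sub>k\<close> converge locally uniformly on a strip in a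
  complex line with real direction, so Hurwitz's theorem applies as soon as the limit is not constant there.
  The direction provided by \<open>expsum_line_nonzero\<close> for the surviving exponents achieves this.
\<close>

lemma expsum_limit_nonzero:
  fixes e :: "'a \<Rightarrow> real ^ 'n::finite"
  assumes A: "finite A" "inj_on e A" and c: "\<And>i. i \<in> A \<Longrightarrow> c i \<noteq> 0"
    and U: "open U" and nz: "\<And>w. (\<chi> j. Im (w $ j)) \<in> U \<Longrightarrow> expsum A c e w \<noteq> 0"
    and \<theta>: "\<theta> \<longlonglongrightarrow> \<theta>'" "\<theta>' \<in> U"
    and u: "\<And>i. i \<in> A \<Longrightarrow> (\<lambda>k. exp (e i \<bullet> x k - m k)) \<longlonglongrightarrow> u i"
    and \<beta>: "\<beta> \<in> A" "u \<beta> \<noteq> 0"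
  shows "expsum A (\<lambda>i. c i * of_real (u i)) e (\<i> *s cplx \<theta>') \<noteq> 0"
proof -
  define B where "B = {i\<in>A. u i \<noteq> 0}"
  have B: "finite B" "B \<noteq> {}" "B \<subseteq> A" using A \<beta> by (auto simp: B_def)
  obtain i0 where i0: "i0 \<in> B" "\<And>i. i \<in> B \<Longrightarrow> norm (e i) \<le> norm (e i0)"
  proof -
    have "Max ((norm \<circ> e) ` B) \<in> (norm \<circ> e) ` B" using B by (intro Max_in) auto
    then obtain i0 where "i0 \<in> B" "Max ((norm \<circ> e) ` B) = norm (e i0)" by auto
    moreover have "norm (e i) \<le> Max ((norm \<circ> e) ` B)" if "i \<in> B" for i
      using B that by (intro Max_ge) auto
    ultimately show ?thesis using that by metis
  qed
  define v where "v = e i0"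
  define d where "d = (\<lambda>k i. c i * of_real (exp (e i \<bullet> x k - m k)) * exp (cpair (cplx (e i)) (\<i> *s cplx (\<theta> k))))"
  define d' where "d' = (\<lambda>i. c i * of_real (u i) * exp (cpair (cplx (e i)) (\<i> *s cplx \<theta>')))"
  define h where "h = (\<lambda>k \<zeta>. \<Sum>i\<in>A. d k i * exp (\<zeta> * of_real (e i \<bullet> v)))"
  define h' where "h' = (\<lambda>\<zeta>. \<Sum>i\<in>A. d' i * exp (\<zeta> * of_real (e i \<bullet> v)))"
  \<comment> \<open>half of the radius is for the convergence of \<open>\<theta>\<close>, half for the imaginary part of the line parameter\<close>
  obtain r where r: "r > 0" "ball \<theta>' (2 * r) \<subseteq> U"
  proof -
    obtain s where "s > 0" "ball \<theta>' s \<subseteq> U" using U \<theta>(2) openE by blast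
    then show ?thesis using that[of "s/2"] by auto
  qed
  obtain N where N: "\<And>k. k \<ge> N \<Longrightarrow> dist (\<theta> k) \<theta>' < r"
    using \<theta>(1) r(1) unfolding lim_sequentially by blast
  define S where "S = {\<zeta>. norm v * \<bar>Im \<zeta>\<bar> < r}"
  have S: "open S" "connected S"
  proof -
    have "norm v * \<bar>y\<bar> = \<bar>norm v * y\<bar>" for y :: real by (simp add: abs_mult)
    then have *: "S = {\<zeta>. (norm v *\<^sub>R \<i>) \<bullet> \<zeta> < r} \<inter> {\<zeta>. (norm v *\<^sub>R \<i>) \<bullet> \<zeta> > -r}"
      by (auto simp: S_def inner_complex_def)
    show "open S" unfolding * by (intro open_Int open_halfspace_lt open_halfspace_gt)
    show "connected S" unfolding *
      by (intro convex_connected convex_Int convex_halfspace_lt convex_halfspace_gt)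
  qed
  have "h' 0 \<noteq> 0"
  proof
    assume h0: "h' 0 = 0"
    have "h' 0 \<noteq> 0"
    proof (rule Hurwitz_no_zeros[OF S, of "\<lambda>k. h (k + N)" h'])
      show "h (k + N) holomorphic_on S" for k unfolding h_def by (intro holomorphic_intros)
      show "h' holomorphic_on S" unfolding h'_def by (intro holomorphic_intros)
      show "0 \<in> S" using r by (simp add: S_def)
      show "h (k + N) \<zeta> \<noteq> 0" if "\<zeta> \<in> S" for k \<zeta>
      proof -
        have "h (k + N) \<zeta> = exp (- of_real (m (k + N))) * expsum A c e (cvec (x (k + N)) (\<theta> (k + N)) + \<zeta> *s cplx v)"
          unfolding h_def d_def expsum_cvec_add cvec_eq cpair_add_right exp_add cpair_scale_right cpair_cplx
            sum_distrib_left
          by (intro sum.cong refl) (simp add: exp_diff exp_minus divide_simps flip: exp_of_real)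
        moreover have "(\<chi> j. Im ((cvec (x (k + N)) (\<theta> (k + N)) + \<zeta> *s cplx v) $ j)) = \<theta> (k + N) + Im \<zeta> *\<^sub>R v"
          by (simp add: vec_eq_iff cvec_def cplx_def)
        moreover have "\<theta> (k + N) + Im \<zeta> *\<^sub>R v \<in> U"
        proof -
          have "dist (\<theta> (k + N)) \<theta>' < r" by (intro N) simp
          moreover have "norm (Im \<zeta> *\<^sub>R v) < r" using that by (simp add: S_def mult.commute)
          moreover have "dist \<theta>' (\<theta> (k + N) + Im \<zeta> *\<^sub>R v) \<le> dist \<theta>' (\<theta> (k + N)) + norm (Im \<zeta> *\<^sub>R v)"
            using dist_triangle[of \<theta>' "\<theta> (k + N) + Im \<zeta> *\<^sub>R v" "\<theta> (k + N)"] by (simp add: dist_norm)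
          ultimately have "dist \<theta>' (\<theta> (k + N) + Im \<zeta> *\<^sub>R v) < 2 * r"
            by (simp add: dist_commute)
          then show ?thesis using r by auto
        qed
        ultimately show ?thesis using nz by simp
      qed
      have dlim: "(\<lambda>k. d k i) \<longlonglongrightarrow> d' i" if "i \<in> A" for i
        unfolding d_def d'_def cpair_scale_right
        by (intro tendsto_intros u \<theta> that)
      show "uniform_limit K (\<lambda>k. h (k + N)) h' sequentially" if "compact K" for K
        unfolding h_def h'_def
      proof (intro uniform_limit_sum uniform_lim_mult)
        fix i assume i: "i \<in> A"
        have "(\<lambda>k. d (k + N) i) \<longlonglongrightarrow> d' i" by (rule LIMSEQ_ignore_initial_segment[OF dlim[OF i]])
        then show "uniform_limit K (\<lambda>k x. d (k + N) i) (\<lambda>x. d' i) sequentially"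
          by (intro uniform_limitI) (auto dest!: tendstoD elim: eventually_mono)
        have "compact ((\<lambda>\<zeta>. exp (\<zeta> * complex_of_real (e i \<bullet> v))) ` K)"
          by (intro compact_continuous_image continuous_intros that)
        then show "bounded ((\<lambda>\<zeta>. exp (\<zeta> * complex_of_real (e i \<bullet> v))) ` K)"
          by (rule compact_imp_bounded)
        show "bounded ((\<lambda>\<zeta>. d' i) ` K)" by (rule bounded_subset[of "{d' i}"]) auto
      qed (rule uniform_limit_const)
      show "\<not> h' constant_on S"
      proof
        assume "h' constant_on S"
        moreover have "of_real T \<in> S" for T using r by (simp add: S_def)
        ultimately have *: "h' (of_real T) = 0" for T
          using h0 of_real_0 unfolding constant_on_def by metis
        have "d' i0 \<noteq> 0" using c i0 by (auto simp: d'_def B_def)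
        then obtain T :: real where "(\<Sum>i\<in>B. d' i * exp (of_real T * of_real (e i \<bullet> v))) \<noteq> 0"
          using expsum_line_nonzero[OF B(1) i0(1), of d' e] i0(2) inj_on_subset[OF A(2) B(3)] unfolding v_def by blast
        moreover have "(\<Sum>i\<in>B. d' i * exp (of_real T * of_real (e i \<bullet> v))) = h' (of_real T)"
          unfolding h'_def using A(1) B(3) by (intro sum.mono_neutral_left) (auto simp: B_def d'_def)
        ultimately show False using * by simp
      qed
    qed
    then show False using h0 by simp
  qed
  then show ?thesis unfolding h'_def d'_def expsum_def by simp
qed

text \<open>
  If there were no such constant, there would be a sequence along which the sum, divided by its largest
  exponential, tends to zero. The normalised exponentials lie in \<open>[0, 1]\<close> and one of them is \<open>1\<close>, so a
  subsequence has a nonzero limit; this limit has a zero, contrary to \<open>expsum_limit_nonzero\<close>.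
\<close>

lemma expsum_lower_bound:
  fixes e :: "'a \<Rightarrow> real ^ 'n::finite"
  assumes A: "finite A" "inj_on e A" and c: "\<And>i. i \<in> A \<Longrightarrow> c i \<noteq> 0"
    and U: "open U" and nz: "\<And>w. (\<chi> j. Im (w $ j)) \<in> U \<Longrightarrow> expsum A c e w \<noteq> 0"
    and K: "compact K" "K \<subseteq> U"
  shows "\<exists>\<epsilon>>0. \<forall>x. \<forall>\<theta>\<in>K. \<forall>i\<in>A. \<epsilon> * exp (e i \<bullet> x) \<le> norm (expsum A c e (cvec x \<theta>))"
proof (rule ccontr)
  assume "\<not> ?thesis"
  then have "\<forall>k::nat. \<exists>x \<theta> \<beta>. \<theta> \<in> K \<and> \<beta> \<in> A \<and>
      norm (expsum A c e (cvec x \<theta>)) < inverse (real (Suc k)) * exp (e \<beta> \<bullet> x)"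
    by (metis inverse_positive_iff_positive not_le of_nat_0_less_iff zero_less_Suc)
  then obtain x \<theta> \<beta> where x: "\<And>k. \<theta> k \<in> K" "\<And>k. \<beta> k \<in> A"
      "\<And>k::nat. norm (expsum A c e (cvec (x k) (\<theta> k))) < inverse (real (Suc k)) * exp (e (\<beta> k) \<bullet> x k)"
    by metis
  define m where "m k = Max ((\<lambda>i. e i \<bullet> x k) ` A)" for k
  have m: "e i \<bullet> x k \<le> m k" if "i \<in> A" for i k
    unfolding m_def using A that by (intro Max_ge) auto
  have m': "\<exists>i\<in>A. e i \<bullet> x k = m k" for k
    using Max_in[of "(\<lambda>i. e i \<bullet> x k) ` A"] A x(2) unfolding m_def by fastforce
  obtain r1 \<theta>' where r1: "strict_mono (r1 :: nat \<Rightarrow> nat)" "(\<theta> \<circ> r1) \<longlonglongrightarrow> \<theta>'" "\<theta>' \<in> K"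
    using K(1) x(1) unfolding compact_def by metis
  have "\<exists>r u. strict_mono r \<and> (\<forall>i\<in>A. (\<lambda>k. exp (e i \<bullet> x (r1 (r k)) - m (r1 (r k)))) \<longlonglongrightarrow> u i)"
  proof (rule common_convergent_subsequence[OF A(1)])
    fix i assume "i \<in> A"
    then show "bounded (range (\<lambda>k. exp (e i \<bullet> x (r1 k) - m (r1 k))))"
      using m by (intro boundedI[of _ 1]) auto
  qed
  then obtain r2 u where r2: "strict_mono (r2 :: nat \<Rightarrow> nat)"
    and u: "\<And>i. i \<in> A \<Longrightarrow> (\<lambda>k. exp (e i \<bullet> x (r1 (r2 k)) - m (r1 (r2 k)))) \<longlonglongrightarrow> u i"
    by blast
  define r where "r = (\<lambda>k. r1 (r2 k))"
  have r: "strict_mono r" using strict_mono_o[OF r1(1) r2] unfolding r_def by (simp add: o_def)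
  have \<theta>r: "(\<lambda>k. \<theta> (r k)) \<longlonglongrightarrow> \<theta>'"
    using LIMSEQ_subseq_LIMSEQ[OF r1(2) r2] by (simp add: r_def o_def)
  \<comment> \<open>the sum of the normalised exponentials is at least \<open>1\<close>, which survives in the limit\<close>
  have "(\<lambda>k. \<Sum>i\<in>A. exp (e i \<bullet> x (r k) - m (r k))) \<longlonglongrightarrow> (\<Sum>i\<in>A. u i)"
    using u by (intro tendsto_sum) (simp add: r_def)
  moreover have "(\<Sum>i\<in>A. exp (e i \<bullet> x (r k) - m (r k))) \<ge> 1" for k
  proof -
    obtain i where i: "i \<in> A" "e i \<bullet> x (r k) = m (r k)" using m' by blast
    then have "1 = exp (e i \<bullet> x (r k) - m (r k))" by simp
    also have "\<dots> \<le> (\<Sum>i\<in>A. exp (e i \<bullet> x (r k) - m (r k)))"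
      using A i by (intro member_le_sum) auto
    finally show ?thesis .
  qed
  ultimately have "(\<Sum>i\<in>A. u i) \<ge> 1" by (intro LIMSEQ_le_const) auto
  then obtain i1 where "i1 \<in> A" "u i1 \<noteq> 0" using sum.neutral[of A u] by (metis not_one_le_zero)
  then have nz: "expsum A (\<lambda>i. c i * of_real (u i)) e (\<i> *s cplx \<theta>') \<noteq> 0"
    using expsum_limit_nonzero[OF A c U nz \<theta>r, of "\<lambda>k. x (r k)" "\<lambda>k. m (r k)" u] r1(3) K(2) u
    unfolding r_def by blast
  have eq: "(\<Sum>i\<in>A. c i * of_real (exp (e i \<bullet> x k - m k)) * exp (cpair (cplx (e i)) (\<i> *s cplx (\<theta> k))))
      = exp (- of_real (m k)) * expsum A c e (cvec (x k) (\<theta> k))" for k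
    unfolding expsum_def cvec_eq cpair_add_right exp_add cpair_scale_right cpair_cplx sum_distrib_left
    by (intro sum.cong refl) (simp add: exp_diff exp_minus divide_simps flip: exp_of_real)
  have "(\<lambda>k. \<Sum>i\<in>A. c i * of_real (exp (e i \<bullet> x (r k) - m (r k))) * exp (cpair (cplx (e i)) (\<i> *s cplx (\<theta> (r k)))))
     \<longlonglongrightarrow> expsum A (\<lambda>i. c i * of_real (u i)) e (\<i> *s cplx \<theta>')"
    unfolding expsum_def cpair_scale_right using u
    by (intro tendsto_intros \<theta>r) (simp add: r_def)
  moreover have "(\<lambda>k. \<Sum>i\<in>A. c i * of_real (exp (e i \<bullet> x (r k) - m (r k))) * exp (cpair (cplx (e i)) (\<i> *s cplx (\<theta> (r k)))))
     \<longlonglongrightarrow> 0"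
  proof (rule Lim_null_comparison)
    have "(\<lambda>k. inverse (real (Suc k))) \<longlonglongrightarrow> 0" by (rule LIMSEQ_inverse_real_of_nat)
    from LIMSEQ_subseq_LIMSEQ[OF this r] show "(\<lambda>k. inverse (real (Suc (r k)))) \<longlonglongrightarrow> 0" by (simp add: o_def)
    show "\<forall>\<^sub>F k in sequentially. norm (\<Sum>i\<in>A. c i * of_real (exp (e i \<bullet> x (r k) - m (r k))) *
        exp (cpair (cplx (e i)) (\<i> *s cplx (\<theta> (r k))))) \<le> inverse (real (Suc (r k)))"
    proof (rule always_eventually, rule allI)
      fix k
      have "norm (exp (- of_real (m (r k))) * expsum A c e (cvec (x (r k)) (\<theta> (r k))))
          \<le> exp (- m (r k)) * (inverse (real (Suc (r k))) * exp (e (\<beta> (r k)) \<bullet> x (r k)))"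
        unfolding norm_mult using x(3)[of "r k"]
        by (intro mult_mono) (auto simp: norm_exp_eq_Re)
      also have "\<dots> = inverse (real (Suc (r k))) * exp (e (\<beta> (r k)) \<bullet> x (r k) - m (r k))"
        by (simp add: exp_diff exp_minus divide_simps)
      also have "\<dots> \<le> inverse (real (Suc (r k))) * 1"
        using m[OF x(2)] by (intro mult_left_mono) auto
      finally show "norm (\<Sum>i\<in>A. c i * of_real (exp (e i \<bullet> x (r k) - m (r k))) *
        exp (cpair (cplx (e i)) (\<i> *s cplx (\<theta> (r k))))) \<le> inverse (real (Suc (r k)))"
        unfolding eq by simp
    qed
  qed
  ultimately show False using nz LIMSEQ_unique by blast
qed

section \<open>The argument of an exponential sum\<close>

text \<open>
  Descartes' bound for the number of zeros with real exponents: dividing by one exponential and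
  differentiating removes one term and, by Rolle's theorem, at most one zero.
\<close>

lemma exp_sum_zeros_imp_zero:
  fixes c \<kappa> :: "'a \<Rightarrow> real"
  assumes "finite A" "\<And>i. i < card A \<Longrightarrow> (\<Sum>\<alpha>\<in>A. c \<alpha> * exp (\<kappa> \<alpha> * z i)) = 0"
    and "\<And>i. Suc i < card A \<Longrightarrow> z i < z (Suc i)"
  shows "(\<Sum>\<alpha>\<in>A. c \<alpha> * exp (\<kappa> \<alpha> * r)) = 0"
  using assms
proof (induction A arbitrary: c \<kappa> z r rule: finite_induct)
  case empty
  then show ?case by simp
next
  case (insert a A)
  define g where "g r = c a + (\<Sum>\<alpha>\<in>A. c \<alpha> * exp ((\<kappa> \<alpha> - \<kappa> a) * r))" for r
  define g' where "g' r = (\<Sum>\<alpha>\<in>A. (c \<alpha> * (\<kappa> \<alpha> - \<kappa> a)) * exp ((\<kappa> \<alpha> - \<kappa> a) * r))" for r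
  have g: "(\<Sum>\<alpha>\<in>insert a A. c \<alpha> * exp (\<kappa> \<alpha> * r)) = exp (\<kappa> a * r) * g r" for r
  proof -
    have "exp (\<kappa> a * r) * exp ((\<kappa> \<alpha> - \<kappa> a) * r) = exp (\<kappa> \<alpha> * r)" for \<alpha>
      by (simp add: algebra_simps flip: exp_add)
    then show ?thesis using insert.hyps
      by (simp add: g_def sum_distrib_left distrib_left mult_ac)
  qed
  have dg: "(g has_real_derivative g' r) (at r)" for r
    unfolding g_def g'_def by (auto intro!: derivative_eq_intros sum.cong simp: sum_distrib_left mult_ac)
  have zg: "g (z i) = 0" if "i \<le> card A" for i
    using insert.prems(1)[of i] that insert.hyps by (simp only: g) simp
  have zlt: "z i < z (Suc i)" if "i < card A" for i
    using insert.prems(2)[of i] that insert.hyps by simp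
  have "\<exists>y. z i < y \<and> y < z (Suc i) \<and> g' y = 0" if i: "i < card A" for i
  proof -
    have "continuous_on {z i..z (Suc i)} g"
      using dg by (meson DERIV_isCont continuous_at_imp_continuous_on)
    moreover have "g (z i) = g (z (Suc i))" using zg i by simp
    ultimately obtain y where "z i < y" "y < z (Suc i)" "(*) (g' y) = (\<lambda>v. 0)"
      using Rolle_deriv[of "z i" "z (Suc i)" g "\<lambda>y. (*) (g' y)"] zlt[OF i] dg
      by (metis has_field_derivative_def)
    then show ?thesis by (metis mult.right_neutral)
  qed
  then obtain y where y: "\<And>i. i < card A \<Longrightarrow> z i < y i \<and> y i < z (Suc i) \<and> g' (y i) = 0"
    by metis
  have "g' r = 0" for r
    unfolding g'_def
  proof (rule insert.IH[of _ _ y])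
    show "(\<Sum>\<alpha>\<in>A. c \<alpha> * (\<kappa> \<alpha> - \<kappa> a) * exp ((\<kappa> \<alpha> - \<kappa> a) * y i)) = 0" if "i < card A" for i
      using y[OF that] by (simp add: g'_def)
    show "y i < y (Suc i)" if "Suc i < card A" for i
      using y[of i] y[of "Suc i"] that by fastforce
  qed
  then have "g r = g (z 0)"
    using dg DERIV_isconst_all by metis
  then show ?case using zg[of 0] g by simp
qed

lemma increasing_preimages:
  fixes g :: "real \<Rightarrow> real"
  assumes g: "continuous_on {0..1} g" and "d > 0" "g 0 + real k * d \<le> g 1"
  shows "\<exists>z. (\<forall>i\<le>k. z i \<in> {0..1} \<and> g (z i) = g 0 + real i * d) \<and> (\<forall>i<k. z i < z (Suc i))"
  using assms(3)
proof (induction k)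
  case 0
  show ?case by (intro exI[of _ "\<lambda>_. 0"]) simp
next
  case (Suc k)
  then have "g 0 + real k * d \<le> g 1" using \<open>d > 0\<close> by (simp add: algebra_simps)
  then obtain z where z: "\<And>i. i \<le> k \<Longrightarrow> z i \<in> {0..1} \<and> g (z i) = g 0 + real i * d"
      "\<And>i. i < k \<Longrightarrow> z i < z (Suc i)"
    using Suc.IH by blast
  have "\<exists>y. z k \<le> y \<and> y \<le> 1 \<and> g y = g 0 + real (Suc k) * d"
    using z(1)[of k] \<open>d > 0\<close> Suc.prems
    by (intro IVT') (auto simp: algebra_simps intro: continuous_on_subset[OF g])
  then obtain y where y: "z k \<le> y" "y \<le> 1" "g y = g 0 + real (Suc k) * d" by blast
  have "z k \<noteq> y" using y(3) z(1)[of k] \<open>d > 0\<close> by auto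
  then have zy: "z k < y" using y(1) by simp
  show ?case
  proof (intro exI[of _ "z(Suc k := y)"] conjI allI impI)
    fix i assume i: "i \<le> Suc k"
    have "(z(Suc k := y)) i \<in> {0..1} \<and> g ((z(Suc k := y)) i) = g 0 + real i * d"
    proof (cases "i = Suc k")
      case True
      then show ?thesis using y z(1)[of k] by (simp add: fun_upd_def)
    next
      case False
      then show ?thesis using z(1)[of i] i by (simp add: fun_upd_def)
    qed
    then show "(z(Suc k := y)) i \<in> {0..1}" "g ((z(Suc k := y)) i) = g 0 + real i * d" by blast+
  next
    fix i assume "i < Suc k"
    then show "(z(Suc k := y)) i < (z(Suc k := y)) (Suc i)"
      using z(2) zy by (cases "i = k") auto
  qed
qed

text \<open>
  Every half turn of the argument, counted from its initial value \<open>g 0\<close>, is a zero of the imaginary part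
  of the sum rotated by \<open>- g 0\<close>. This is a real exponential sum with \<open>card A\<close> terms. With \<open>card A\<close>
  zeros it vanishes identically, and then the argument cannot turn at all.
\<close>

lemma arg_increase_bound:
  fixes c :: "'a \<Rightarrow> complex" and \<kappa> :: "'a \<Rightarrow> real"
  assumes A: "finite A" and g: "continuous_on {0..1} g"
    and h: "\<And>r. r \<in> {0..1} \<Longrightarrow> \<exists>\<rho>>0. (\<Sum>\<alpha>\<in>A. c \<alpha> * of_real (exp (\<kappa> \<alpha> * r))) = of_real \<rho> * cis (g r)"
  shows "g 1 - g 0 \<le> real (card A) * pi"
proof (rule ccontr)
  assume "\<not> ?thesis"
  then have big: "g 0 + real (card A) * pi \<le> g 1" by simp
  have "A \<noteq> {}" using h[of 0] by auto
  then have n: "card A > 0" using A by (simp add: card_gt_0_iff)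
  obtain z where z: "\<And>i. i \<le> card A \<Longrightarrow> z i \<in> {0..1} \<and> g (z i) = g 0 + real i * pi"
      "\<And>i. i < card A \<Longrightarrow> z i < z (Suc i)"
    using increasing_preimages[OF g pi_gt_zero big] by blast
  have sin: "\<exists>\<rho>>0. (\<Sum>\<alpha>\<in>A. Im (cis (- g 0) * c \<alpha>) * exp (\<kappa> \<alpha> * r)) = \<rho> * sin (g r - g 0)" if "r \<in> {0..1}" for r
  proof -
    obtain \<rho> where \<rho>: "\<rho> > 0" "(\<Sum>\<alpha>\<in>A. c \<alpha> * of_real (exp (\<kappa> \<alpha> * r))) = of_real \<rho> * cis (g r)"
      using h[OF \<open>r \<in> {0..1}\<close>] by blast
    have "(\<Sum>\<alpha>\<in>A. Im (cis (- g 0) * c \<alpha>) * exp (\<kappa> \<alpha> * r)) =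
        Im (cis (- g 0) * (\<Sum>\<alpha>\<in>A. c \<alpha> * of_real (exp (\<kappa> \<alpha> * r))))"
      by (simp add: sum_distrib_left mult.assoc[symmetric] del: cis.sel)
    also have "\<dots> = Im (of_real \<rho> * cis (g r - g 0))" by (simp add: \<rho>(2) cis_mult mult.left_commute del: cis.sel)
    finally show ?thesis using \<rho>(1) by auto
  qed
  have zero: "(\<Sum>\<alpha>\<in>A. Im (cis (- g 0) * c \<alpha>) * exp (\<kappa> \<alpha> * r)) = 0" for r
  proof (rule exp_sum_zeros_imp_zero[OF A, of _ _ z])
    fix i assume i: "i < card A"
    then obtain \<rho> where "(\<Sum>\<alpha>\<in>A. Im (cis (- g 0) * c \<alpha>) * exp (\<kappa> \<alpha> * z i)) = \<rho> * sin (real i * pi)"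
      using sin[of "z i"] z(1)[of i] by auto
    then show "(\<Sum>\<alpha>\<in>A. Im (cis (- g 0) * c \<alpha>) * exp (\<kappa> \<alpha> * z i)) = 0" by simp
  qed (use z in auto)
  \<comment> \<open>at a quarter turn the imaginary part is not zero\<close>
  have "1 * pi \<le> real (card A) * pi" using n by (intro mult_right_mono) auto
  then have "g 0 + pi / 2 \<le> g 1" using big pi_gt_zero by linarith
  then have "\<exists>r\<ge>0. r \<le> 1 \<and> g r = g 0 + pi / 2"
    using g pi_ge_zero by (intro IVT') auto
  then obtain r where "r \<in> {0..1}" "g r = g 0 + pi / 2" by auto
  then show False using sin[of r] zero[of r] by auto
qed

text \<open>
  Conjugation of the sum reverses its argument.
\<close>

lemma arg_variation_bound:
  fixes c :: "'a \<Rightarrow> complex" and \<kappa> :: "'a \<Rightarrow> real"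
  assumes A: "finite A" and g: "continuous_on {0..1} g"
    and h: "\<And>r. r \<in> {0..1} \<Longrightarrow> \<exists>\<rho>>0. (\<Sum>\<alpha>\<in>A. c \<alpha> * of_real (exp (\<kappa> \<alpha> * r))) = of_real \<rho> * cis (g r)"
  shows "\<bar>g 1 - g 0\<bar> \<le> real (card A) * pi"
proof -
  have "\<exists>\<rho>>0. (\<Sum>\<alpha>\<in>A. cnj (c \<alpha>) * of_real (exp (\<kappa> \<alpha> * r))) = of_real \<rho> * cis (- g r)" if "r \<in> {0..1}" for r
  proof -
    obtain \<rho> where \<rho>: "\<rho> > 0" "(\<Sum>\<alpha>\<in>A. c \<alpha> * of_real (exp (\<kappa> \<alpha> * r))) = of_real \<rho> * cis (g r)"
      using h[OF \<open>r \<in> {0..1}\<close>] by blast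
    then have "cnj (\<Sum>\<alpha>\<in>A. c \<alpha> * of_real (exp (\<kappa> \<alpha> * r))) = cnj (of_real \<rho> * cis (g r))" by simp
    then show ?thesis using \<rho>(1) by (auto simp: cis_cnj)
  qed
  then have "- g 1 - (- g 0) \<le> real (card A) * pi"
    by (intro arg_increase_bound[OF A, of "\<lambda>r. - g r" "\<lambda>\<alpha>. cnj (c \<alpha>)" \<kappa>]) (auto intro: continuous_intros g)
  moreover have "g 1 - g 0 \<le> real (card A) * pi"
    by (rule arg_increase_bound[OF A g h])
  ultimately show ?thesis by linarith
qed

definition real_exponent :: "nat ^ 'n::finite \<Rightarrow> real ^ 'n" where
  "real_exponent \<alpha> = (\<chi> j. real (\<alpha> $ j))"

lemma inj_real_exponent: "inj real_exponent"
  by (auto simp: inj_def real_exponent_def vec_eq_iff)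

lemma newton_polytope_real_exponent:
  "newton_polytope p = convex hull (real_exponent ` support p)"
  by (simp add: newton_polytope_def real_exponent_def[abs_def])

lemma peval_exp:
  "peval p (\<chi> j. exp (w $ j)) = expsum (support p) (coeff_of p) real_exponent w"
  unfolding peval_def expsum_def
  by (intro sum.cong refl) (simp add: cpair_def cplx_def real_exponent_def exp_sum exp_of_nat_mult)

lemma holomorphic_vec_on_imp_continuous_on:
  "holomorphic_vec_on F U \<Longrightarrow> continuous_on U F"
  unfolding holomorphic_vec_on_def
  by (meson continuous_at_imp_continuous_on has_derivative_continuous)

lemma cvec_in_tube [simp]: "cvec x \<theta> \<in> tube S \<longleftrightarrow> \<theta> \<in> S"
  by (simp add: tube_def cvec_def)

text \<open>
  The real part of a branch is the logarithm of the modulus, the imaginary part is a continuous argument.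
  The latter is compared with its values at \<open>x = 0\<close>, which are bounded by compactness, along the segment
  from \<open>0\<close> to \<open>x\<close>.
\<close>

lemma log_branch_bounds:
  assumes l: "log_branch_on p U l" and U: "open U" and K: "compact K" "K \<subseteq> U"
  shows "\<exists>a B. \<forall>x. \<forall>\<theta>\<in>K. \<bar>Im (l (cvec x \<theta>))\<bar> \<le> B \<and>
     (\<forall>\<sigma>\<in>newton_polytope p. a + \<sigma> \<bullet> x \<le> Re (l (cvec x \<theta>)))"
proof -
  let ?A = "support p" and ?c = "coeff_of p"
  have expl: "exp (l w) = expsum ?A ?c real_exponent w" if "w \<in> tube U" for w
    using l that by (simp add: log_branch_on_def peval_exp)
  have cont: "continuous_on (tube U) l"
    using l by (simp add: log_branch_on_def holomorphic_vec_on_imp_continuous_on)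
  obtain \<epsilon> where \<epsilon>: "\<epsilon> > 0" "\<And>x \<theta> \<alpha>. \<theta> \<in> K \<Longrightarrow> \<alpha> \<in> ?A \<Longrightarrow>
      \<epsilon> * exp (real_exponent \<alpha> \<bullet> x) \<le> norm (expsum ?A ?c real_exponent (cvec x \<theta>))"
  proof -
    have "expsum ?A ?c real_exponent w \<noteq> 0" if "(\<chi> j. Im (w $ j)) \<in> U" for w
    proof -
      have "w \<in> tube U" using that by (simp add: tube_def)
      then show ?thesis using expl[of w] exp_not_eq_zero[of "l w"] by simp
    qed
    then have "\<exists>\<epsilon>>0. \<forall>x. \<forall>\<theta>\<in>K. \<forall>\<alpha>\<in>?A.
        \<epsilon> * exp (real_exponent \<alpha> \<bullet> x) \<le> norm (expsum ?A ?c real_exponent (cvec x \<theta>))"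
      using U K by (intro expsum_lower_bound) (auto simp: in_keys_iff intro: inj_on_subset[OF inj_real_exponent])
    then show ?thesis using that by blast
  qed
  have Re: "ln \<epsilon> + \<sigma> \<bullet> x \<le> Re (l (cvec x \<theta>))" if "\<theta> \<in> K" "\<sigma> \<in> newton_polytope p" for x \<theta> \<sigma>
  proof -
    have "ln \<epsilon> + real_exponent \<alpha> \<bullet> x \<le> Re (l (cvec x \<theta>))" if "\<alpha> \<in> ?A" for \<alpha>
    proof -
      have "exp (ln \<epsilon> + real_exponent \<alpha> \<bullet> x) \<le> norm (exp (l (cvec x \<theta>)))"
        using \<epsilon> that \<open>\<theta> \<in> K\<close> K(2) by (subst expl) (auto simp: exp_add)
      then show ?thesis by (simp add: norm_exp_eq_Re)
    qed
    then have "real_exponent ` ?A \<subseteq> {\<sigma>. x \<bullet> \<sigma> \<le> Re (l (cvec x \<theta>)) - ln \<epsilon>}"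
      by (auto simp: inner_commute algebra_simps)
    then have "newton_polytope p \<subseteq> {\<sigma>. x \<bullet> \<sigma> \<le> Re (l (cvec x \<theta>)) - ln \<epsilon>}"
      unfolding newton_polytope_real_exponent by (intro hull_minimal convex_halfspace_le)
    then show ?thesis using that by (auto simp: inner_commute algebra_simps)
  qed
  have "continuous_on K (\<lambda>\<theta>. Im (l (cvec 0 \<theta>)))"
    using K(2) by (intro continuous_intros continuous_on_compose2[OF cont]) auto
  then have "bounded ((\<lambda>\<theta>. Im (l (cvec 0 \<theta>))) ` K)"
    using K(1) compact_continuous_image compact_imp_bounded by blast
  then obtain B0 where B0: "\<And>\<theta>. \<theta> \<in> K \<Longrightarrow> \<bar>Im (l (cvec 0 \<theta>))\<bar> \<le> B0"
    unfolding bounded_iff by auto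
  have Im: "\<bar>Im (l (cvec x \<theta>))\<bar> \<le> B0 + real (card ?A) * pi" if \<theta>: "\<theta> \<in> K" for x \<theta>
  proof -
    define g where "g r = Im (l (cvec (r *\<^sub>R x) \<theta>))" for r
    have \<theta>': "\<theta> \<in> U" using \<theta> K by auto
    have "\<bar>g 1 - g 0\<bar> \<le> real (card ?A) * pi"
    proof (rule arg_variation_bound[where c = "\<lambda>\<alpha>. ?c \<alpha> * exp (\<i> * of_real (real_exponent \<alpha> \<bullet> \<theta>))" and \<kappa> = "\<lambda>\<alpha>. real_exponent \<alpha> \<bullet> x"])
      show "continuous_on {0..1} g"
        unfolding g_def using \<theta>' by (intro continuous_intros continuous_on_compose2[OF cont]) auto
      fix r :: real
      have "(\<Sum>\<alpha>\<in>?A. ?c \<alpha> * exp (\<i> * of_real (real_exponent \<alpha> \<bullet> \<theta>)) * of_real (exp ((real_exponent \<alpha> \<bullet> x) * r)))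
         = expsum ?A ?c real_exponent (cvec (r *\<^sub>R x) \<theta>)"
        unfolding expsum_def cvec_eq cpair_add_right cpair_scale_right cpair_cplx exp_add
        by (intro sum.cong refl) (simp add: exp_of_real mult_ac flip: of_real_mult)
      also have "\<dots> = exp (l (cvec (r *\<^sub>R x) \<theta>))" using expl \<theta>' by simp
      also have "\<dots> = of_real (exp (Re (l (cvec (r *\<^sub>R x) \<theta>)))) * cis (g r)"
        by (simp add: exp_eq_polar g_def)
      finally show "\<exists>\<rho>>0. (\<Sum>\<alpha>\<in>?A. ?c \<alpha> * exp (\<i> * of_real (real_exponent \<alpha> \<bullet> \<theta>)) * of_real (exp ((real_exponent \<alpha> \<bullet> x) * r)))
         = of_real \<rho> * cis (g r)"
        by (intro exI[of _ "exp (Re (l (cvec (r *\<^sub>R x) \<theta>)))"]) auto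
    qed simp
    then show ?thesis using B0[OF \<theta>] by (simp add: g_def)
  qed
  show ?thesis using Re Im by blast
qed

section \<open>Differentiation under the integral sign\<close>

lemma nn_integral_exp_abs_finite:
  assumes "a > (0::real)"
  shows "(\<integral>\<^sup>+x. ennreal (exp (- a * \<bar>x\<bar>)) \<partial>lborel) < \<infinity>"
proof -
  let ?g = "\<lambda>x. ennreal (exp (- a * x)) * indicator {0..} x"
  have F: "(\<integral>\<^sup>+x. ?g x \<partial>lborel) = ennreal (0 - (- exp (- a * 0) / a))"
  proof (rule nn_integral_FTC_atLeast)
    show "((\<lambda>x. - exp (- a * x) / a) has_real_derivative exp (- a * x)) (at x)" for x
      using assms by (auto intro!: derivative_eq_intros)
    have "filterlim (\<lambda>x. (- a) * x) at_bot at_top"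
      using assms filterlim_tendsto_neg_mult_at_bot[OF tendsto_const _ filterlim_ident, of "- a"] by simp
    then have "((\<lambda>x. exp (- a * x)) \<longlongrightarrow> 0) at_top"
      by (rule filterlim_compose[OF exp_at_bot])
    then have "((\<lambda>x. - exp (- a * x) / a) \<longlongrightarrow> - 0 / a) at_top"
      using assms by (intro tendsto_intros) auto
    then show "((\<lambda>x. - exp (- a * x) / a) \<longlongrightarrow> 0) at_top" by simp
  qed auto
  have "(\<integral>\<^sup>+x. ennreal (exp (- a * \<bar>x\<bar>)) \<partial>lborel) \<le> (\<integral>\<^sup>+x. ?g x + ?g (- x) \<partial>lborel)"
    by (intro nn_integral_mono) (auto simp: indicator_def abs_if)
  also have "\<dots> = (\<integral>\<^sup>+x. ?g x \<partial>lborel) + (\<integral>\<^sup>+x. ?g (- x) \<partial>lborel)"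
    by (intro nn_integral_add) auto
  also have "(\<integral>\<^sup>+x. ?g (- x) \<partial>lborel) = (\<integral>\<^sup>+x. ?g x \<partial>lborel)"
    by (subst nn_integral_real_affine[of ?g "-1" 0]) auto
  also have "(\<integral>\<^sup>+x. ?g x \<partial>lborel) + (\<integral>\<^sup>+x. ?g x \<partial>lborel) < \<infinity>"
    unfolding F by simp
  finally show ?thesis .
qed

lemma integrable_exp_neg_norm:
  assumes "\<epsilon> > 0"
  shows "integrable lborel (\<lambda>x::'a::euclidean_space. exp (- \<epsilon> * norm x))"
proof (rule integrableI_nonneg)
  define a where "a = \<epsilon> / real DIM('a)"
  have a: "a > 0" using assms by (simp add: a_def)
  have le: "exp (- \<epsilon> * norm x) \<le> (\<Prod>b\<in>Basis. exp (- a * \<bar>x \<bullet> b\<bar>))" for x :: 'a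
  proof -
    have "(\<Sum>b\<in>Basis. \<bar>x \<bullet> b\<bar>) \<le> (\<Sum>b\<in>(Basis::'a set). norm x)"
      by (intro sum_mono Basis_le_norm)
    then have "a * (\<Sum>b\<in>Basis. \<bar>x \<bullet> b\<bar>) \<le> a * (real DIM('a) * norm x)"
      using a by (intro mult_left_mono) auto
    then have "a * (\<Sum>b\<in>Basis. \<bar>x \<bullet> b\<bar>) \<le> \<epsilon> * norm x" by (simp add: a_def)
    moreover have "(\<Prod>b\<in>Basis. exp (- a * \<bar>x \<bullet> b\<bar>)) = exp (- (a * (\<Sum>b\<in>Basis. \<bar>x \<bullet> b\<bar>)))"
      by (simp add: exp_sum sum_distrib_left flip: sum_negf)
    ultimately show ?thesis by simp
  qed
  have "(\<integral>\<^sup>+x. ennreal (exp (- \<epsilon> * norm (x::'a))) \<partial>lborel) \<le>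
      (\<integral>\<^sup>+x. (\<Prod>b\<in>Basis. ennreal (exp (- a * \<bar>(x::'a) \<bullet> b\<bar>))) \<partial>lborel)"
    using le by (intro nn_integral_mono) (simp add: prod_ennreal ennreal_leI)
  also have "\<dots> = (\<Prod>b\<in>(Basis::'a set). (\<integral>\<^sup>+y. ennreal (exp (- a * \<bar>y\<bar>)) \<partial>lborel))"
    by (rule nn_integral_lborel_prod) auto
  also have "\<dots> < \<infinity>"
    using nn_integral_exp_abs_finite[OF a] by (simp add: power_less_top_ennreal)
  finally show "(\<integral>\<^sup>+x. ennreal (exp (- \<epsilon> * norm (x::'a))) \<partial>lborel) < \<infinity>" .
qed auto

text \<open>
  Taylor's formula with Cauchy's bound for the second derivative on discs of radius \<open>\<delta> / 4\<close>. The error is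
  linear in the bound \<open>B\<close> for the function, so it can be integrated over a parameter.
\<close>

lemma holomorphic_quadratic_error:
  assumes hol: "\<phi> holomorphic_on ball 0 \<delta>" and B: "\<And>\<zeta>. \<zeta> \<in> ball 0 \<delta> \<Longrightarrow> norm (\<phi> \<zeta>) \<le> B"
    and \<zeta>: "norm \<zeta> \<le> \<delta> / 4" and \<delta>: "\<delta> > 0"
    and d: "(\<phi> has_field_derivative \<phi>') (at 0)"
  shows "norm (\<phi> \<zeta> - \<phi> 0 - \<zeta> * \<phi>') \<le> 32 * B / \<delta>\<^sup>2 * (norm \<zeta>)\<^sup>2"
proof -
  have "norm ((deriv ^^ 0) \<phi> \<zeta> - (\<Sum>i\<le>1. (deriv ^^ i) \<phi> 0 * (\<zeta> - 0) ^ i / (fact i)))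
          \<le> (32 * B / \<delta>\<^sup>2) * norm (\<zeta> - 0) ^ (Suc 1) / fact 1"
  proof (rule field_Taylor[of "cball 0 (\<delta> / 4)"])
    show "convex (cball 0 (\<delta> / 4) :: complex set)" by simp
    fix i x assume x: "x \<in> cball (0::complex) (\<delta> / 4)"
    then have x': "x \<in> ball 0 \<delta>" using \<delta> by auto
    have "(deriv ^^ i) \<phi> holomorphic_on ball 0 \<delta>"
      by (intro holomorphic_higher_deriv hol) auto
    then have "((deriv ^^ i) \<phi> has_field_derivative deriv ((deriv ^^ i) \<phi>) x) (at x)"
      using x' by (intro holomorphic_derivI[of _ "ball 0 \<delta>"]) auto
    then show "((deriv ^^ i) \<phi> has_field_derivative (deriv ^^ Suc i) \<phi> x) (at x within cball 0 (\<delta> / 4))"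
      by (auto intro: has_field_derivative_at_within)
  next
    fix x assume x: "x \<in> cball (0::complex) (\<delta> / 4)"
    have sub: "cball x (\<delta> / 4) \<subseteq> ball 0 \<delta>"
    proof
      fix y assume "y \<in> cball x (\<delta> / 4)"
      then show "y \<in> ball 0 \<delta>" using x \<delta> dist_triangle[of 0 y x] by simp
    qed
    have "norm ((deriv ^^ 2) \<phi> x) \<le> fact 2 * B / (\<delta> / 4) ^ 2"
    proof (rule Cauchy_inequality)
      show "\<phi> holomorphic_on ball x (\<delta> / 4)"
        using holomorphic_on_subset[OF hol] sub ball_subset_cball by blast
      show "continuous_on (cball x (\<delta> / 4)) \<phi>"
        using hol holomorphic_on_imp_continuous_on continuous_on_subset sub by blast
      show "norm (\<phi> y) \<le> B" if "norm (x - y) = \<delta> / 4" for y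
        using that sub by (intro B) (auto simp: dist_norm)
    qed (use \<delta> in auto)
    also have "fact 2 * B / (\<delta> / 4) ^ 2 = 32 * B / \<delta>\<^sup>2" by (simp add: power_divide)
    finally show "norm ((deriv ^^ Suc 1) \<phi> x) \<le> 32 * B / \<delta>\<^sup>2" by (simp add: numeral_2_eq_2)
  qed (use \<zeta> \<delta> in auto)
  moreover have "deriv \<phi> 0 = \<phi>'" using d by (rule DERIV_imp_deriv)
  ultimately show ?thesis by (simp add: power2_eq_square algebra_simps)
qed

lemma has_derivative_of_quadratic_error:
  fixes f :: "'a::real_normed_vector \<Rightarrow> 'b::real_normed_vector"
  assumes D: "bounded_linear D" and r: "r > 0"
    and le: "\<And>h. norm h \<le> r \<Longrightarrow> norm (f (x + h) - f x - D h) \<le> K * (norm h)\<^sup>2"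
  shows "(f has_derivative D) (at x)"
  unfolding has_derivative_at
proof (intro conjI D)
  have lim: "((\<lambda>h::'a. K * norm h) \<longlongrightarrow> 0) (at 0)"
    by (intro tendsto_mult_right_zero tendsto_norm_zero tendsto_ident_at)
  show "((\<lambda>h. norm (f (x + h) - f x - D h) / norm h) \<longlongrightarrow> 0) (at 0)"
  proof (rule Lim_null_comparison[OF _ lim])
    have "\<forall>\<^sub>F h in at 0. h \<in> ball (0::'a) r - {0}"
      using r by (intro eventually_at_in_open) auto
    then show "\<forall>\<^sub>F h in at 0. norm (norm (f (x + h) - f x - D h) / norm h) \<le> K * norm h"
    proof eventually_elim
      case (elim h)
      then show ?case using le[of h] by (simp add: divide_le_eq power2_eq_square mult_ac)
    qed
  qed
qed

text \<open>
  For a family of holomorphic functions with an integrable bound, the quadratic error is integrable. This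
  makes the derivative of the integral explicit, and it bounds the error uniformly in the family, as is
  needed for derivatives in several variables.
\<close>

context
  fixes M :: "'a measure" and \<phi> :: "'a \<Rightarrow> complex \<Rightarrow> complex" and \<phi>' :: "'a \<Rightarrow> complex" and g \<delta>
  assumes hol: "\<And>x. \<phi> x holomorphic_on ball 0 \<delta>" and \<delta>: "\<delta> > 0"
    and bound: "\<And>x \<zeta>. \<zeta> \<in> ball 0 \<delta> \<Longrightarrow> norm (\<phi> x \<zeta>) \<le> g x"
    and g: "integrable M g"
    and meas: "\<And>\<zeta>. \<zeta> \<in> ball 0 \<delta> \<Longrightarrow> (\<lambda>x. \<phi> x \<zeta>) \<in> borel_measurable M"
    and meas': "\<phi>' \<in> borel_measurable M"
    and d: "\<And>x. (\<phi> x has_field_derivative \<phi>' x) (at 0)"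
begin

lemma integrable_holomorphic_family: "\<zeta> \<in> ball 0 \<delta> \<Longrightarrow> integrable M (\<lambda>x. \<phi> x \<zeta>)"
  using meas order_trans[OF bound abs_ge_self] by (intro Bochner_Integration.integrable_bound[OF g]) auto

lemma integrable_holomorphic_family_deriv: "integrable M \<phi>'"
proof (rule Bochner_Integration.integrable_bound[of M "\<lambda>x. 16 / \<delta> * g x"])
  show "AE x in M. norm (\<phi>' x) \<le> norm (16 / \<delta> * g x)"
  proof (rule AE_I2)
    fix x
    have gx: "g x \<ge> 0" using bound[of 0 x] \<delta> norm_ge_zero order_trans by (metis centre_in_ball)
    define \<zeta> where "\<zeta> = complex_of_real (\<delta> / 4)"
    have \<zeta>: "norm \<zeta> = \<delta> / 4" using \<delta> by (simp add: \<zeta>_def)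
    have "norm (\<phi> x \<zeta> - \<phi> x 0 - \<zeta> * \<phi>' x) \<le> 32 * g x / \<delta>\<^sup>2 * (norm \<zeta>)\<^sup>2"
      using \<zeta> by (intro holomorphic_quadratic_error[OF hol bound _ \<delta> d]) auto
    also have "\<dots> = 2 * g x" using \<delta> by (simp add: \<zeta> power2_eq_square)
    finally have 1: "norm (\<phi> x \<zeta> - \<phi> x 0 - \<zeta> * \<phi>' x) \<le> 2 * g x" .
    have 2: "norm (\<phi> x \<zeta>) \<le> g x" "norm (\<phi> x 0) \<le> g x"
      using \<zeta> \<delta> by (auto intro!: bound)
    have "norm (\<zeta> * \<phi>' x) \<le> norm (\<phi> x \<zeta> - \<phi> x 0 - \<zeta> * \<phi>' x) + norm (\<phi> x \<zeta>) + norm (\<phi> x 0)"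
      by norm
    then have "\<delta> / 4 * norm (\<phi>' x) \<le> 4 * g x"
      using 1 2 by (simp add: norm_mult \<zeta>)
    then have "norm (\<phi>' x) \<le> 16 / \<delta> * g x" using \<delta> by (simp add: field_simps)
    then show "norm (\<phi>' x) \<le> norm (16 / \<delta> * g x)" using abs_ge_self[of "16 / \<delta> * g x"] by (simp only: real_norm_def)
  qed
qed (use g meas' in auto)

lemma integral_holomorphic_family_quadratic_error:
  assumes "norm \<zeta> \<le> \<delta> / 4"
  shows "norm ((\<integral>x. \<phi> x \<zeta> \<partial>M) - (\<integral>x. \<phi> x 0 \<partial>M) - \<zeta> * (\<integral>x. \<phi>' x \<partial>M)) \<le> 32 * (\<integral>x. g x \<partial>M) / \<delta>\<^sup>2 * (norm \<zeta>)\<^sup>2"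
proof -
  have \<zeta>: "\<zeta> \<in> ball 0 \<delta>" using assms \<delta> by simp
  note int = integrable_holomorphic_family[OF \<zeta>] integrable_holomorphic_family[of 0] integrable_holomorphic_family_deriv
  have "(\<integral>x. \<phi> x \<zeta> \<partial>M) - (\<integral>x. \<phi> x 0 \<partial>M) - \<zeta> * (\<integral>x. \<phi>' x \<partial>M) = (\<integral>x. \<phi> x \<zeta> - \<phi> x 0 - \<zeta> * \<phi>' x \<partial>M)"
    using int \<delta> by simp
  also have "norm \<dots> \<le> (\<integral>x. norm (\<phi> x \<zeta> - \<phi> x 0 - \<zeta> * \<phi>' x) \<partial>M)"
    by (rule integral_norm_bound)
  also have "\<dots> \<le> (\<integral>x. 32 / \<delta>\<^sup>2 * (norm \<zeta>)\<^sup>2 * g x \<partial>M)"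
  proof (rule integral_mono)
    show "integrable M (\<lambda>x. norm (\<phi> x \<zeta> - \<phi> x 0 - \<zeta> * \<phi>' x))"
      using int \<delta> by (intro integrable_norm Bochner_Integration.integrable_diff integrable_mult_right) auto
    show "norm (\<phi> x \<zeta> - \<phi> x 0 - \<zeta> * \<phi>' x) \<le> 32 / \<delta>\<^sup>2 * (norm \<zeta>)\<^sup>2 * g x" for x
      using holomorphic_quadratic_error[OF hol bound assms \<delta> d, of x] by (simp add: mult_ac)
  qed (use g in auto)
  also have "\<dots> = 32 * (\<integral>x. g x \<partial>M) / \<delta>\<^sup>2 * (norm \<zeta>)\<^sup>2" by simp
  finally show ?thesis .
qed

lemma has_field_derivative_integral_holomorphic_family:
  "((\<lambda>\<zeta>. \<integral>x. \<phi> x \<zeta> \<partial>M) has_field_derivative (\<integral>x. \<phi>' x \<partial>M)) (at 0)"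
  unfolding has_field_derivative_def
proof (rule has_derivative_of_quadratic_error)
  show "\<delta> / 4 > 0" using \<delta> by simp
  show "bounded_linear ((*) (\<integral>x. \<phi>' x \<partial>M))" by (rule bounded_linear_mult_right)
  fix h :: complex assume "norm h \<le> \<delta> / 4"
  then show "norm ((\<integral>x. \<phi> x (0 + h) \<partial>M) - (\<integral>x. \<phi> x 0 \<partial>M) - (\<integral>x. \<phi>' x \<partial>M) * h) \<le> 32 * (\<integral>x. g x \<partial>M) / \<delta>\<^sup>2 * (norm h)\<^sup>2"
    using integral_holomorphic_family_quadratic_error[of h] by (simp add: mult.commute)
qed

end

lemma norm_vector_scalar_mult: "norm (c *s v) = norm c * norm (v :: complex ^ 'k::finite)"
  by (simp add: norm_vec_def norm_mult L2_set_right_distrib)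

text \<open>
  On every complex line through \<open>p\<close> the integral has a quadratic error whose constant does not depend on
  the direction. Since the derivatives along the lines are linear in the direction, they form a total
  derivative.
\<close>

lemma has_derivative_integral_exp_cpair:
  fixes b :: "'a \<Rightarrow> complex ^ 'k::finite"
  assumes \<delta>: "\<delta> > 0" and g: "integrable M g"
    and bound: "\<And>x q. q \<in> ball p \<delta> \<Longrightarrow> norm (exp (cpair (b x) q)) \<le> g x"
    and meas: "\<And>j. (\<lambda>x. b x $ j) \<in> borel_measurable M"
  shows "\<exists>D. ((\<lambda>q. \<integral>x. exp (cpair (b x) q) \<partial>M) has_derivative D) (at p) \<and> (\<forall>c v. D (c *s v) = c * D v)"
proof -
  have m: "(\<lambda>x. exp (cpair (b x) q)) \<in> borel_measurable M"
    "(\<lambda>x. cpair (b x) q * exp (cpair (b x) q')) \<in> borel_measurable M" for q q'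
    unfolding cpair_def using meas by measurable
  have line: "(\<lambda>\<zeta>. exp (cpair (b x) (p + \<zeta> *s u))) holomorphic_on ball 0 \<delta>"
      "((\<lambda>\<zeta>. exp (cpair (b x) (p + \<zeta> *s u))) has_field_derivative cpair (b x) u * exp (cpair (b x) p)) (at 0)"
      "\<zeta> \<in> ball 0 \<delta> \<Longrightarrow> norm (exp (cpair (b x) (p + \<zeta> *s u))) \<le> g x"
    if "norm u = 1" for u x \<zeta>
  proof -
    show "(\<lambda>\<zeta>. exp (cpair (b x) (p + \<zeta> *s u))) holomorphic_on ball 0 \<delta>"
      unfolding cpair_add_right cpair_scale_right by (intro holomorphic_intros)
    show "((\<lambda>\<zeta>. exp (cpair (b x) (p + \<zeta> *s u))) has_field_derivative cpair (b x) u * exp (cpair (b x) p)) (at 0)"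
      unfolding cpair_add_right cpair_scale_right by (auto intro!: derivative_eq_intros)
    show "norm (exp (cpair (b x) (p + \<zeta> *s u))) \<le> g x" if "\<zeta> \<in> ball 0 \<delta>"
      using that \<open>norm u = 1\<close> by (intro bound) (simp add: dist_norm norm_vector_scalar_mult)
  qed
  define I where "I u = (\<integral>x. cpair (b x) u * exp (cpair (b x) p) \<partial>M)" for u
  have int: "integrable M (\<lambda>x. cpair (b x) u * exp (cpair (b x) p))" for u
  proof -
    have "integrable M (\<lambda>x. \<Sum>j\<in>UNIV. u $ j * (cpair (b x) (axis j 1) * exp (cpair (b x) p)))"
    proof (intro Bochner_Integration.integrable_sum integrable_mult_right)
      fix j :: 'k
      have "norm (axis j 1 :: complex ^ 'k) = 1" by (simp add: norm_vec_def L2_set_def axis_def if_distrib[of norm] if_distrib[of "\<lambda>x. x\<^sup>2"] cong: if_cong)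
      from integrable_holomorphic_family_deriv[OF line(1)[OF this] \<delta> line(3)[OF this] g m line(2)[OF this]]
      show "integrable M (\<lambda>x. cpair (b x) (axis j 1) * exp (cpair (b x) p))" by simp
    qed
    moreover have "(\<Sum>j\<in>UNIV. u $ j * (cpair (b x) (axis j 1) * exp (cpair (b x) p))) = cpair (b x) u * exp (cpair (b x) p)" for x
      by (simp add: cpair_def axis_def sum_distrib_right mult_ac if_distrib cong: if_cong)
    ultimately show ?thesis by simp
  qed
  have I: "I (u + v) = I u + I v" "I (c *s u) = c * I u" for u v c
    using int by (simp_all add: I_def cpair_add_right cpair_scale_right distrib_right mult.assoc)
  have "linear I"
  proof
    show "I (u + v) = I u + I v" for u v by (rule I)
    show "I (r *\<^sub>R u) = r *\<^sub>R I u" for r u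
      unfolding scaleR_eq_scalar_mult[of r u] I(2) by (simp add: scaleR_conv_of_real)
  qed
  then have "bounded_linear I" by (rule linear_conv_bounded_linear[THEN iffD1])
  then have "((\<lambda>q. \<integral>x. exp (cpair (b x) q) \<partial>M) has_derivative I) (at p)"
  proof (rule has_derivative_of_quadratic_error)
    show "\<delta> / 4 > 0" using \<delta> by simp
    fix h :: "complex ^ 'k" assume h: "norm h \<le> \<delta> / 4"
    show "norm ((\<integral>x. exp (cpair (b x) (p + h)) \<partial>M) - (\<integral>x. exp (cpair (b x) p) \<partial>M) - I h)
        \<le> 32 * (\<integral>x. g x \<partial>M) / \<delta>\<^sup>2 * (norm h)\<^sup>2"
    proof (cases "h = 0")
      case True
      then show ?thesis using I(2)[of 0 0] by simp
    next
      case False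
      define u where "u = complex_of_real (inverse (norm h)) *s h"
      have u: "norm u = 1" "complex_of_real (norm h) *s u = h"
        using False by (simp add: u_def norm_vector_scalar_mult norm_inverse del: of_real_inverse)
          (use False in \<open>simp add: u_def vec_eq_iff\<close>)
      have "norm (complex_of_real (norm h)) \<le> \<delta> / 4" using h by simp
      from integral_holomorphic_family_quadratic_error[OF line(1)[OF u(1)] \<delta> line(3)[OF u(1)] g m line(2)[OF u(1)] this]
      show ?thesis using u(2) I(2)[of "complex_of_real (norm h)" u] by (simp add: I_def)
    qed
  qed
  then show ?thesis using I(2) by blast
qed

section \<open>Newton polytopes of products\<close>

lemma real_exponent_add: "real_exponent (\<alpha> + \<beta>) = real_exponent \<alpha> + real_exponent \<beta>"
  by (simp add: real_exponent_def vec_eq_iff)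

lemma lookup_mult_unique:
  fixes f g :: "'a::monoid_add \<Rightarrow>\<^sub>0 'b::semiring_0"
  assumes "\<And>\<alpha>' \<beta>'. \<alpha>' \<in> Poly_Mapping.keys f \<Longrightarrow> \<beta>' \<in> Poly_Mapping.keys g \<Longrightarrow>
    \<alpha> + \<beta> = \<alpha>' + \<beta>' \<Longrightarrow> \<alpha>' = \<alpha> \<and> \<beta>' = \<beta>"
  shows "Poly_Mapping.lookup (f * g) (\<alpha> + \<beta>) = Poly_Mapping.lookup f \<alpha> * Poly_Mapping.lookup g \<beta>"
proof -
  have in1: "{l. (\<Sum>q. Poly_Mapping.lookup g q when \<alpha> + \<beta> = l + q) \<noteq> 0 \<and> Poly_Mapping.lookup f l \<noteq> 0} \<subseteq> {\<alpha>}"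
  proof safe
    fix l assume nz: "(\<Sum>q. Poly_Mapping.lookup g q when \<alpha> + \<beta> = l + q) \<noteq> 0" and l: "Poly_Mapping.lookup f l \<noteq> 0"
    from nz obtain q where "(Poly_Mapping.lookup g q when \<alpha> + \<beta> = l + q) \<noteq> 0"
      by (rule Sum_any.not_neutral_obtains_not_neutral)
    then have "Poly_Mapping.lookup g q \<noteq> 0" "\<alpha> + \<beta> = l + q" by simp_all
    then show "l = \<alpha>" using assms[of l q] l by (simp add: in_keys_iff)
  qed
  have "Poly_Mapping.lookup (f * g) (\<alpha> + \<beta>) =
      (\<Sum>l\<in>{\<alpha>}. Poly_Mapping.lookup f l * (\<Sum>q. Poly_Mapping.lookup g q when \<alpha> + \<beta> = l + q))"
    unfolding lookup_mult
    by (intro Sum_any.expand_superset subset_trans[OF _ in1]) auto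
  also have "\<dots> = Poly_Mapping.lookup f \<alpha> * (\<Sum>q. Poly_Mapping.lookup g q when \<alpha> + \<beta> = \<alpha> + q)" by simp
  also have "\<dots> = Poly_Mapping.lookup f \<alpha> * Poly_Mapping.lookup g \<beta>"
  proof (cases "Poly_Mapping.lookup f \<alpha> = 0")
    case False
    have "(\<Sum>q. Poly_Mapping.lookup g q when \<alpha> + \<beta> = \<alpha> + q) = (\<Sum>q\<in>{\<beta>}. Poly_Mapping.lookup g q when \<alpha> + \<beta> = \<alpha> + q)"
    proof (intro Sum_any.expand_superset)
      show "{q. (Poly_Mapping.lookup g q when \<alpha> + \<beta> = \<alpha> + q) \<noteq> 0} \<subseteq> {\<beta>}"
        using assms[of \<alpha>] False by (auto simp: in_keys_iff)
    qed simp
    then show ?thesis by simp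
  qed simp
  finally show ?thesis .
qed

text \<open>
  There is no cancellation at an extreme point of the Minkowski sum, because it is a sum of exponents
  in only one way.
\<close>

lemma newton_polytope_mult: "newton_polytope (f * g) = newton_polytope f + newton_polytope g"
proof -
  let ?X = "real_exponent ` support f" and ?Y = "real_exponent ` support g"
  have "convex hull (?X + ?Y) \<subseteq> newton_polytope (f * g)"
  proof -
    have "e \<in> real_exponent ` support (f * g)" if e: "e extreme_point_of (convex hull (?X + ?Y))" for e
    proof -
      have "e \<in> ?X + ?Y" using e extreme_point_of_convex_hull by blast
      then obtain \<alpha> \<beta> where \<alpha>: "\<alpha> \<in> support f" and \<beta>: "\<beta> \<in> support g"
        and eq: "e = real_exponent \<alpha> + real_exponent \<beta>" by (auto simp: set_plus_def)
      have "coeff_of (f * g) (\<alpha> + \<beta>) = coeff_of f \<alpha> * coeff_of g \<beta>"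
      proof (rule lookup_mult_unique)
        fix \<alpha>' \<beta>'
        assume \<alpha>': "\<alpha>' \<in> support f" and \<beta>': "\<beta>' \<in> support g" and "\<alpha> + \<beta> = \<alpha>' + \<beta>'"
        then have eq': "real_exponent \<alpha> + real_exponent \<beta> = real_exponent \<alpha>' + real_exponent \<beta>'"
          by (metis real_exponent_add)
        \<comment> \<open>exchanging the summands of two decompositions of \<open>e\<close> gives two points with midpoint \<open>e\<close>\<close>
        define u v where "u = real_exponent \<alpha> + real_exponent \<beta>'" and "v = real_exponent \<alpha>' + real_exponent \<beta>"
        have uv: "u \<in> convex hull (?X + ?Y)" "v \<in> convex hull (?X + ?Y)"
          using \<alpha> \<beta> \<alpha>' \<beta>' by (auto simp: u_def v_def intro!: hull_inc)
        have mid: "midpoint u v = e"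
        proof -
          have "u + v = (real_exponent \<alpha> + real_exponent \<beta>) + (real_exponent \<alpha>' + real_exponent \<beta>')"
            by (simp add: u_def v_def)
          also have "\<dots> = e + e" by (simp add: eq flip: eq')
          finally show ?thesis by (simp add: midpoint_def flip: scaleR_2)
        qed
        have "u = v"
        proof (rule ccontr)
          assume "u \<noteq> v"
          then have "e \<in> open_segment u v" using mid by (metis midpoint_in_open_segment)
          then show False using e uv by (auto simp: extreme_point_of_def)
        qed
        then have "u = e" using mid by simp
        then have "real_exponent \<beta>' = real_exponent \<beta>" by (simp add: u_def eq)
        moreover from this eq' have "real_exponent \<alpha>' = real_exponent \<alpha>" by simp
        ultimately show "\<alpha>' = \<alpha> \<and> \<beta>' = \<beta>" using inj_real_exponent by (auto dest: injD)
      qed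
      then have "\<alpha> + \<beta> \<in> support (f * g)" using \<alpha> \<beta> by (simp add: in_keys_iff)
      then show ?thesis using eq real_exponent_add by (metis imageI)
    qed
    then have "convex hull {e. e extreme_point_of (convex hull (?X + ?Y))} \<subseteq> newton_polytope (f * g)"
      unfolding newton_polytope_real_exponent by (intro hull_mono) auto
    then show ?thesis
      using Krein_Milman_polytope[of "?X + ?Y"] by (simp add: finite_set_plus)
  qed
  moreover have "newton_polytope (f * g) \<subseteq> convex hull (?X + ?Y)"
    unfolding newton_polytope_real_exponent using keys_mult[of f g]
    by (intro hull_mono) (force simp: real_exponent_add set_plus_def)
  ultimately show ?thesis by (simp add: convex_hull_set_plus newton_polytope_real_exponent)
qed

lemma newton_polytope_prod:
  "newton_polytope (\<Prod>i\<in>I. f i) = (\<Sum>i\<in>I. newton_polytope (f i))"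
proof (induction I rule: infinite_finite_induct)
  case (insert i I)
  then show ?case by (simp add: newton_polytope_mult)
qed (simp_all add: newton_polytope_real_exponent real_exponent_def vec_eq_iff zero_vec_def)

text \<open>
  The weighted Minkowski sum is needed not only for Newton polytopes, but also for their faces.
\<close>

definition wsum :: "('m::finite \<Rightarrow> 'a::real_vector set) \<Rightarrow> ('m \<Rightarrow> real) \<Rightarrow> 'a set" where
  "wsum F \<tau> = {\<Sum>i\<in>UNIV. \<tau> i *\<^sub>R a i | a. \<forall>i. a i \<in> F i}"

lemma weighted_newton_sum_eq: "weighted_newton_sum f \<tau> = wsum (\<lambda>i. newton_polytope (f i)) (\<lambda>i. \<tau> $ i)"
  by (simp add: weighted_newton_sum_def wsum_def)

lemma newton_polytope_prod_wsum:
  "newton_polytope (\<Prod>i\<in>UNIV. f i) = wsum (\<lambda>i. newton_polytope (f i)) (\<lambda>i. 1)"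
  unfolding newton_polytope_prod wsum_def by (subst set_sum_alt) auto

lemma polytope_wsum:
  assumes "\<And>i. polytope (F i)"
  shows "polytope (wsum F \<tau>)"
proof -
  have "\<forall>i. \<exists>S. finite S \<and> F i = convex hull S" using assms by (simp add: polytope_def)
  then obtain S where S: "\<And>i. finite (S i)" "\<And>i. F i = convex hull (S i)" by metis
  have "wsum F \<tau> = (\<Sum>i\<in>UNIV. (\<lambda>x. \<tau> i *\<^sub>R x) ` F i)"
  proof -
    have "(\<Sum>i\<in>UNIV. (\<lambda>x. \<tau> i *\<^sub>R x) ` F i) = {\<Sum>i\<in>UNIV. s i | s. \<forall>i\<in>UNIV. s i \<in> (\<lambda>x. \<tau> i *\<^sub>R x) ` F i}"
      by (rule set_sum_alt) simp
    also have "\<dots> = wsum F \<tau>"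
    proof (intro equalityI subsetI)
      fix x assume "x \<in> {\<Sum>i\<in>UNIV. s i | s. \<forall>i\<in>UNIV. s i \<in> (\<lambda>x. \<tau> i *\<^sub>R x) ` F i}"
      then obtain s where x: "x = (\<Sum>i\<in>UNIV. s i)" and "\<forall>i. s i \<in> (\<lambda>x. \<tau> i *\<^sub>R x) ` F i" by blast
      then have "\<forall>i. \<exists>a. a \<in> F i \<and> s i = \<tau> i *\<^sub>R a" by blast
      then obtain a where "\<forall>i. a i \<in> F i \<and> s i = \<tau> i *\<^sub>R a i" by metis
      then show "x \<in> wsum F \<tau>" using x by (auto simp: wsum_def)
    qed (auto simp: wsum_def)
    finally show ?thesis by simp
  qed
  also have "\<dots> = (\<Sum>i\<in>UNIV. convex hull ((\<lambda>x. \<tau> i *\<^sub>R x) ` S i))"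
    by (simp add: S convex_hull_scaling)
  also have "\<dots> = convex hull (\<Sum>i\<in>UNIV. (\<lambda>x. \<tau> i *\<^sub>R x) ` S i)"
    by (rule convex_hull_set_sum[symmetric])
  finally have "wsum F \<tau> = convex hull (\<Sum>i\<in>UNIV. (\<lambda>x. \<tau> i *\<^sub>R x) ` S i)" .
  moreover have "finite (\<Sum>i\<in>UNIV. (\<lambda>x. \<tau> i *\<^sub>R x) ` S i)"
    using S(1) by (intro finite_set_sum ballI finite_imageI)
  ultimately show ?thesis unfolding polytope_def by blast
qed

text \<open>
  Subtracting a point of the sum leaves combinations of differences \<open>a - a\<^sub>0\<close> of points of one \<open>F i\<close>. For
  nonzero weights, each such difference is a multiple of a difference of two points of the sum.
\<close>

lemma aff_dim_wsum_le:
  fixes F :: "'m::finite \<Rightarrow> 'a::euclidean_space set"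
  assumes ne: "\<And>i. F i \<noteq> {}" and \<tau>: "\<And>i. \<tau> i \<noteq> 0"
  shows "aff_dim (wsum F \<rho>) \<le> aff_dim (wsum F \<tau>)"
proof -
  define a0 where "a0 i = (SOME a. a \<in> F i)" for i
  have a0: "a0 i \<in> F i" for i using ne by (simp add: a0_def some_in_eq)
  define p q where "p = (\<Sum>i\<in>UNIV. \<rho> i *\<^sub>R a0 i)" and "q = (\<Sum>i\<in>UNIV. \<tau> i *\<^sub>R a0 i)"
  have pq: "p \<in> wsum F \<rho>" "q \<in> wsum F \<tau>" using a0 by (auto simp: p_def q_def wsum_def)
  let ?S = "span ((+) (- q) ` wsum F \<tau>)"
  have diff: "a - a0 i \<in> ?S" if "a \<in> F i" for a i
  proof -
    define a' where "a' = a0(i := a)"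
    have "(\<Sum>j\<in>UNIV. \<tau> j *\<^sub>R a' j) \<in> wsum F \<tau>"
      unfolding wsum_def using a0 that by (intro CollectI exI[of _ a']) (auto simp: a'_def)
    then have "- q + (\<Sum>j\<in>UNIV. \<tau> j *\<^sub>R a' j) \<in> ?S" by (intro span_base imageI)
    moreover have "- q + (\<Sum>j\<in>UNIV. \<tau> j *\<^sub>R a' j) = \<tau> i *\<^sub>R (a - a0 i)"
    proof -
      have "(\<Sum>j\<in>UNIV. \<tau> j *\<^sub>R a' j) - q = (\<Sum>j\<in>UNIV. if j = i then \<tau> i *\<^sub>R (a - a0 i) else 0)"
        unfolding q_def sum_subtractf[symmetric]
        by (intro sum.cong) (auto simp: a'_def scaleR_diff_right)
      then show ?thesis by simp
    qed
    ultimately have "\<tau> i *\<^sub>R (a - a0 i) \<in> ?S" by (simp only:)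
    then have "inverse (\<tau> i) *\<^sub>R (\<tau> i *\<^sub>R (a - a0 i)) \<in> ?S" by (rule span_scale)
    then show ?thesis using \<tau>[of i] by simp
  qed
  have "(+) (- p) ` wsum F \<rho> \<subseteq> ?S"
  proof
    fix x assume "x \<in> (+) (- p) ` wsum F \<rho>"
    then obtain a where a: "\<And>i. a i \<in> F i" "x = - p + (\<Sum>i\<in>UNIV. \<rho> i *\<^sub>R a i)" by (auto simp: wsum_def)
    then have "x = (\<Sum>i\<in>UNIV. \<rho> i *\<^sub>R (a i - a0 i))"
      by (simp add: p_def scaleR_diff_right sum_subtractf)
    also have "\<dots> \<in> ?S" using a diff by (intro span_sum span_scale) auto
    finally show "x \<in> ?S" .
  qed
  then have "dim ((+) (- p) ` wsum F \<rho>) \<le> dim ?S" by (rule dim_subset)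
  then have "int (dim ((+) (- p) ` wsum F \<rho>)) \<le> int (dim ((+) (- q) ` wsum F \<tau>))"
    unfolding dim_span by (rule of_nat_mono)
  then show ?thesis
    using aff_dim_eq_dim[OF hull_inc[OF pq(1)]] aff_dim_eq_dim[OF hull_inc[OF pq(2)]] by (simp only:)
qed

definition min_face :: "'a::real_inner \<Rightarrow> 'a set \<Rightarrow> 'a set" where
  "min_face y P = {a\<in>P. \<forall>b\<in>P. y \<bullet> a \<le> y \<bullet> b}"

text \<open>
  A linear form is minimal on a sum with positive weights if and only if it is minimal on each summand.
\<close>

lemma wsum_min_faces:
  assumes \<tau>: "\<And>i. \<tau> i > 0"
  shows "min_face y (wsum P \<tau>) = wsum (\<lambda>i. min_face y (P i)) \<tau>"
proof (intro equalityI subsetI)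
  fix x assume x: "x \<in> min_face y (wsum P \<tau>)"
  then obtain a where a: "\<And>i. a i \<in> P i" "x = (\<Sum>i\<in>UNIV. \<tau> i *\<^sub>R a i)" by (auto simp: min_face_def wsum_def)
  have "a i \<in> min_face y (P i)" for i
  proof -
    have "y \<bullet> a i \<le> y \<bullet> b" if b: "b \<in> P i" for b
    proof -
      define a' where "a' = a(i := b)"
      have "(\<Sum>j\<in>UNIV. \<tau> j *\<^sub>R a' j) \<in> wsum P \<tau>"
        unfolding wsum_def using a b by (intro CollectI exI[of _ a']) (auto simp: a'_def)
      then have "y \<bullet> x \<le> y \<bullet> (\<Sum>j\<in>UNIV. \<tau> j *\<^sub>R a' j)" using x by (simp add: min_face_def)
      moreover have "y \<bullet> (\<Sum>j\<in>UNIV. \<tau> j *\<^sub>R a' j) - y \<bullet> x = (\<Sum>j\<in>UNIV. if j = i then \<tau> i * (y \<bullet> b - y \<bullet> a i) else 0)"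
        unfolding a(2) inner_sum_right sum_subtractf[symmetric]
        by (intro sum.cong) (auto simp: a'_def algebra_simps)
      ultimately have "\<tau> i * (y \<bullet> b - y \<bullet> a i) \<ge> 0" by simp
      then show ?thesis using \<tau>[of i] by (simp add: zero_le_mult_iff)
    qed
    then show ?thesis using a by (simp add: min_face_def)
  qed
  then show "x \<in> wsum (\<lambda>i. min_face y (P i)) \<tau>" using a(2) by (auto simp: wsum_def)
next
  fix x assume "x \<in> wsum (\<lambda>i. min_face y (P i)) \<tau>"
  then obtain a where a: "\<And>i. a i \<in> min_face y (P i)" "x = (\<Sum>i\<in>UNIV. \<tau> i *\<^sub>R a i)" by (auto simp: wsum_def)
  have "y \<bullet> x \<le> y \<bullet> x'" if x': "x' \<in> wsum P \<tau>" for x'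
  proof -
    obtain b where b: "\<And>i. b i \<in> P i" "x' = (\<Sum>i\<in>UNIV. \<tau> i *\<^sub>R b i)" using x' unfolding wsum_def by blast
    show ?thesis unfolding a(2) b(2) inner_sum_right inner_scaleR_right
      using a(1) b(1) \<tau> by (intro sum_mono mult_left_mono) (auto simp: min_face_def less_imp_le)
  qed
  then show "x \<in> min_face y (wsum P \<tau>)" using a by (auto simp: min_face_def wsum_def)
qed

lemma normal_unique:
  fixes y z :: "'a::euclidean_space"
  assumes "dim T + 1 = DIM('a)" "y \<noteq> 0" "\<And>t. t \<in> T \<Longrightarrow> y \<bullet> t = 0" "\<And>t. t \<in> T \<Longrightarrow> z \<bullet> t = 0"
  shows "z = ((z \<bullet> y) / (y \<bullet> y)) *\<^sub>R y"
proof -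
  have "y \<notin> span T"
  proof
    assume "y \<in> span T"
    then have "y \<bullet> y = 0" using orthogonal_to_span[of y T y] assms(3) by (auto simp: orthogonal_def inner_commute)
    then show False using \<open>y \<noteq> 0\<close> by simp
  qed
  then have span: "span (insert y T) = UNIV" using assms(1) by (simp add: dim_insert flip: dim_eq_full)
  define u where "u = z - ((z \<bullet> y) / (y \<bullet> y)) *\<^sub>R y"
  have "orthogonal u t" if "t \<in> insert y T" for t
    using that assms by (auto simp: u_def orthogonal_def inner_diff_left)
  then have "orthogonal u u" using orthogonal_to_span[of u "insert y T" u] span by auto
  then have "u = 0" by (simp add: orthogonal_self)
  then show ?thesis unfolding u_def by (rule eq_iff_diff_eq_0[THEN iffD2])
qed

lemma det_Ints:
  assumes "\<And>i j. A $ i $ j \<in> \<int>"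
  shows "det A \<in> (\<int> :: real set)"
  unfolding det_def using assms by (auto intro!: Ints_sum Ints_mult Ints_prod)

text \<open>
  A determinant with one free row and with a basis of the span of \<open>T\<close> in the other rows is a linear form
  in the free row. It has integer coefficients and vanishes on \<open>T\<close>.
\<close>

lemma integer_normal_exists:
  fixes T :: "(real ^ 'n::finite) set"
  assumes int: "\<And>t j. t \<in> T \<Longrightarrow> t $ j \<in> \<int>" and dim: "dim T + 1 = CARD('n)"
    and y: "y \<noteq> 0" "\<And>t. t \<in> T \<Longrightarrow> y \<bullet> t = 0"
  shows "\<exists>c m. c \<noteq> 0 \<and> (\<forall>j. m $ j \<in> \<int>) \<and> m = c *\<^sub>R y"
proof -
  obtain B where B: "B \<subseteq> T" "independent B" "T \<subseteq> span B" "card B = dim T"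
    by (rule basis_exists)
  fix k0 :: 'n
  have fB: "finite B" using B(2) independent_imp_finite by blast
  have "card (UNIV - {k0}) = card B" using B(4) dim by (simp add: card_Diff_singleton)
  then obtain g where g: "bij_betw g (UNIV - {k0}) B"
    using fB finite_same_card_bij[of "UNIV - {k0}" B] by auto
  define r where "r v = (\<chi> i. if i = k0 then v else g i)" for v
  define m :: "real ^ 'n" where "m = (\<chi> j. det (r (axis j 1)))"
  have lin: "linear (\<lambda>v. det (r v))"
  proof
    show "det (r (u + v)) = det (r u) + det (r v)" for u v
      unfolding r_def by (rule det_row_add)
    show "det (r (c *\<^sub>R v)) = c *\<^sub>R det (r v)" for c v
      unfolding r_def using det_row_mul[of k0 c "\<lambda>_. v" g, unfolded scalar_mult_eq_scaleR] by simp
  qed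
  have m: "m \<bullet> v = det (r v)" for v
  proof -
    have "det (r v) = det (r (\<Sum>j\<in>UNIV. (v $ j) *s axis j 1))" by (simp add: basis_expansion)
    also have "\<dots> = (\<Sum>j\<in>UNIV. v $ j * det (r (axis j 1)))"
      by (simp add: linear_sum[OF lin] scalar_mult_eq_scaleR linear_scale[OF lin])
    finally show ?thesis by (simp add: m_def inner_vec_def mult.commute)
  qed
  have gB: "g i \<in> B" if "i \<noteq> k0" for i using g that by (auto simp: bij_betw_def)
  have mB: "m \<bullet> b = 0" if b: "b \<in> B" for b
  proof -
    have "b \<in> g ` (UNIV - {k0})" using g b by (simp add: bij_betw_def)
    then obtain i where "i \<noteq> k0" "b = g i" by auto
    then have "row i (r b) = row k0 (r b)" by (simp add: r_def row_def vec_eq_iff)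
    then show ?thesis using det_identical_rows[OF \<open>i \<noteq> k0\<close>, of "r b"] m[of b] by simp
  qed
  have mT: "m \<bullet> t = 0" if "t \<in> T" for t
  proof -
    have "orthogonal m t" using that B(3) mB by (intro orthogonal_to_span[of t B m]) (auto simp: orthogonal_def)
    then show ?thesis by (simp add: orthogonal_def)
  qed
  have "det (r y) \<noteq> 0"
  proof -
    have "\<forall>i. c i = 0" if c: "(\<Sum>i\<in>UNIV. c i *s row i (r y)) = 0" for c
    proof -
      have row: "row i (r y) = (if i = k0 then y else g i)" for i by (simp add: r_def row_def vec_eq_iff)
      have sum: "(\<Sum>i\<in>UNIV. c i *\<^sub>R (if i = k0 then y else g i)) = 0" using c by (simp add: row scalar_mult_eq_scaleR)
      \<comment> \<open>\<open>y\<close> is orthogonal to the other rows, so only the term of its own row remains\<close>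
      have "0 = y \<bullet> (\<Sum>i\<in>UNIV. c i *\<^sub>R (if i = k0 then y else g i))" using sum by simp
      also have "\<dots> = (\<Sum>i\<in>UNIV. if i = k0 then c k0 * (y \<bullet> y) else 0)"
        unfolding inner_sum_right
        by (intro sum.cong) (use y(2) gB B(1) in \<open>simp_all add: subset_iff\<close>)
      finally have ck0: "c k0 = 0" using y(1) by simp
      define d where "d b = c (the_inv_into (UNIV - {k0}) g b)" for b
      have dg: "d (g i) = c i" if "i \<noteq> k0" for i
        using bij_betw_imp_inj_on[OF g] that by (simp add: d_def the_inv_into_f_f)
      have "(\<Sum>b\<in>B. d b *\<^sub>R b) = (\<Sum>i\<in>UNIV - {k0}. d (g i) *\<^sub>R g i)"
        by (rule sum.reindex_bij_betw[OF g, symmetric])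
      also have "\<dots> = (\<Sum>i\<in>UNIV - {k0}. c i *\<^sub>R g i)"
        by (intro sum.cong refl) (simp add: dg)
      also have "\<dots> = (\<Sum>i\<in>UNIV. c i *\<^sub>R (if i = k0 then y else g i))"
        by (subst (2) sum.remove[of _ k0]) (auto simp: ck0 intro!: sum.cong)
      also note sum
      finally have sum0: "(\<Sum>b\<in>B. d b *\<^sub>R b) = 0" .
      have "\<forall>d. (\<Sum>b\<in>B. d b *\<^sub>R b) = 0 \<longrightarrow> (\<forall>b\<in>B. d b = 0)"
        using B(2) by (simp add: independent_explicit)
      then have "(\<Sum>b\<in>B. d b *\<^sub>R b) = 0 \<longrightarrow> (\<forall>b\<in>B. d b = 0)" ..
      with sum0 have zero: "\<forall>b\<in>B. d b = 0" by simp
      have "c i = 0" for i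
      proof (cases "i = k0")
        case False
        have "d (g i) = 0" using zero gB[OF False] by blast
        then show ?thesis using dg[OF False] by simp
      qed (use ck0 in simp)
      then show ?thesis ..
    qed
    then have "\<forall>c. (\<Sum>i\<in>UNIV. c i *s row i (r y)) = 0 \<longrightarrow> (\<forall>i. c i = 0)" by iprover
    then show ?thesis
      unfolding invertible_det_nz[symmetric] invertible_right_inverse matrix_right_invertible_independent_rows .
  qed
  then have my: "(m \<bullet> y) / (y \<bullet> y) \<noteq> 0" using y(1) by (simp add: m)
  have eq: "m = ((m \<bullet> y) / (y \<bullet> y)) *\<^sub>R y"
    using dim y mT by (intro normal_unique[of T]) auto
  have "m $ j \<in> \<int>" for j
  proof -
    have "r (axis j 1) $ i $ k \<in> \<int>" for i k
      using int[of "g i" k] gB[of i] B(1) by (auto simp: r_def axis_def)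
    then show ?thesis by (simp add: m_def det_Ints)
  qed
  then show ?thesis using my eq by blast
qed

section \<open>Primitive facet normals and the domain of convergence\<close>

definition real_int :: "int ^ 'n::finite \<Rightarrow> real ^ 'n" where
  "real_int \<mu> = (\<chi> j. real_of_int (\<mu> $ j))"

lemma ipair_real: "ipair \<mu> x = real_int \<mu> \<bullet> x" for x :: "real ^ 'n::finite"
  by (simp add: ipair_def real_int_def inner_vec_def)

lemma Re_ipair: "Re (ipair \<mu> v) = real_int \<mu> \<bullet> (\<chi> j. Re (v $ j))"
  by (simp add: ipair_def real_int_def inner_vec_def)

lemma min_face_eq_hyperplane:
  assumes "x0 \<in> min_face y P"
  shows "min_face y P = P \<inter> {x. y \<bullet> x = y \<bullet> x0}"
  using assms by (auto simp: min_face_def intro: antisym)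

lemma min_face_face_of: "convex P \<Longrightarrow> min_face y P face_of P"
proof (cases "min_face y P = {}")
  case False
  assume "convex P"
  obtain x0 where x0: "x0 \<in> min_face y P" using False by blast
  show ?thesis
    unfolding min_face_eq_hyperplane[OF x0] using x0 \<open>convex P\<close>
    by (intro face_of_Int_supporting_hyperplane_ge) (auto simp: min_face_def)
qed simp

lemma primitive_multiple_unique:
  assumes \<mu>: "Gcd (range (\<lambda>j. \<mu> $ j)) = 1" and \<mu>': "Gcd (range (\<lambda>j. \<mu>' $ j)) = 1"
    and k: "real_int \<mu>' = k *\<^sub>R real_int \<mu>"
  shows "\<mu>' = \<mu> \<or> \<mu>' = - \<mu>"
proof -
  have "\<exists>j. \<mu> $ j \<noteq> 0"
  proof (rule ccontr)
    assume "\<not> ?thesis"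
    then have "range (\<lambda>j. \<mu> $ j) = {0}" by auto
    then show False using \<mu> by simp
  qed
  then obtain j0 where j0: "\<mu> $ j0 \<noteq> 0" by blast
  define p q where "p = \<mu>' $ j0" and "q = \<mu> $ j0"
  have kj: "real_of_int (\<mu>' $ j) = k * real_of_int (\<mu> $ j)" for j
    using k by (simp add: real_int_def vec_eq_iff)
  have eq: "q * \<mu>' $ j = p * \<mu> $ j" for j
  proof -
    have "real_of_int (q * \<mu>' $ j) = real_of_int (p * \<mu> $ j)"
      by (simp add: p_def q_def kj)
    then show ?thesis by (simp only: of_int_eq_iff)
  qed
  have "Gcd ((*) q ` range (\<lambda>j. \<mu>' $ j)) = Gcd ((*) p ` range (\<lambda>j. \<mu> $ j))"
    by (simp add: image_image eq)
  then have "\<bar>q\<bar> = \<bar>p\<bar>" by (simp add: Gcd_mult \<mu> \<mu>')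
  then consider "p = q" | "p = - q" by linarith
  then show ?thesis
  proof cases
    case 1
    then show ?thesis using eq j0 by (auto simp: q_def vec_eq_iff)
  next
    case 2
    have "\<mu>' $ j = - \<mu> $ j" for j
    proof -
      have "q * \<mu>' $ j = q * - \<mu> $ j" using eq[of j] 2 by simp
      then show ?thesis using j0 by (simp only: q_def mult_cancel_left) simp
    qed
    then have "\<mu>' = - \<mu>" by (simp add: vec_eq_iff)
    then show ?thesis ..
  qed
qed

lemma aff_dim_eq_dim_translate:
  fixes S :: "'a::euclidean_space set"
  shows "s0 \<in> S \<Longrightarrow> aff_dim S = int (dim ((+) (- s0) ` S))"
  by (intro aff_dim_eq_dim hull_inc)

text \<open>
  The face is the convex hull of lattice points, so its directions have an integer normal. Dividing by the
  greatest common divisor makes it primitive, and the sign makes it point inward.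
\<close>

lemma facet_primitive_normal:
  fixes A :: "(nat ^ 'n::finite) set"
  assumes A: "finite A" and y: "y \<noteq> 0"
    and dim: "aff_dim (min_face y (convex hull (real_exponent ` A))) = int CARD('n) - 1"
  shows "\<exists>\<mu> c. c > 0 \<and> Gcd (range (\<lambda>j. \<mu> $ j)) = 1 \<and> real_int \<mu> = c *\<^sub>R y"
proof -
  let ?P = "convex hull (real_exponent ` A)"
  let ?F = "min_face y ?P"
  have "?F face_of ?P" by (intro min_face_face_of) simp
  then obtain S where S: "S \<subseteq> real_exponent ` A" "?F = convex hull S"
    by (rule face_of_convex_hull_subset[rotated]) (use A in \<open>auto intro: finite_imp_compact\<close>)
  have "0 < CARD('n)" by simp
  then have "aff_dim S \<ge> 0" using dim unfolding S(2) aff_dim_convex_hull by linarith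
  then have "S \<noteq> {}" by auto
  then obtain s0 where s0: "s0 \<in> S" by blast
  define T where "T = (+) (- s0) ` S"
  have "int (dim T) = int CARD('n) - 1"
    using dim unfolding S(2) aff_dim_convex_hull aff_dim_eq_dim_translate[OF s0] T_def .
  then have dimT: "dim T + 1 = CARD('n)" by simp
  have SF: "s \<in> ?F" if "s \<in> S" for s unfolding S(2) using that by (rule hull_inc)
  have yT: "y \<bullet> t = 0" if t: "t \<in> T" for t
  proof -
    obtain s where s: "s \<in> S" "t = s - s0" using t by (auto simp: T_def)
    have "y \<bullet> s = y \<bullet> s0" using SF[OF s(1)] SF[OF s0] by (auto simp: min_face_def intro: antisym)
    then show ?thesis by (simp add: s(2) inner_diff_right)
  qed
  have intT: "t $ j \<in> \<int>" if tT: "t \<in> T" for t j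
  proof -
    obtain s where s: "s \<in> S" "t = s - s0" using tT by (auto simp: T_def)
    obtain \<alpha> \<beta> where "s = real_exponent \<alpha>" "s0 = real_exponent \<beta>" using S(1) s(1) s0 by blast
    then show ?thesis by (simp add: s(2) real_exponent_def)
  qed
  obtain c m where m: "c \<noteq> 0" "\<And>j. m $ j \<in> \<int>" "m = c *\<^sub>R y"
    using integer_normal_exists[OF intT dimT y yT] by blast
  define u :: "int ^ 'n" where "u = (\<chi> j. \<lfloor>m $ j\<rfloor>)"
  have mu: "m = real_int u" using m(2) by (simp add: real_int_def u_def vec_eq_iff)
  define g where "g = Gcd (range (\<lambda>j. u $ j))"
  have "g \<noteq> 0"
  proof
    assume "g = 0"
    then have "u $ j = 0" for j by (auto simp: g_def)
    then have "m = 0" by (simp add: mu real_int_def vec_eq_iff)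
    then show False using m y by simp
  qed
  moreover have "g \<ge> 0" by (simp add: g_def)
  ultimately have g: "g > 0" by simp
  have dvd: "g dvd u $ j" for j unfolding g_def by (intro Gcd_dvd) simp
  \<comment> \<open>a primitive multiple of \<open>y\<close>, up to the sign\<close>
  define v :: "int ^ 'n" where "v = (\<chi> j. u $ j div g)"
  have uv: "u $ j = g * v $ j" for j using dvd[of j] by (simp add: v_def)
  have gcdv: "Gcd (range (\<lambda>j. v $ j)) = 1"
  proof -
    have "range (\<lambda>j. u $ j) = (*) g ` range (\<lambda>j. v $ j)" by (simp only: uv image_image)
    then have "g = Gcd ((*) g ` range (\<lambda>j. v $ j))" by (simp only: g_def)
    also have "\<dots> = normalize (g * Gcd (range (\<lambda>j. v $ j)))" by (rule Gcd_mult)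
    also have "\<dots> = g * Gcd (range (\<lambda>j. v $ j))" using g by (simp add: abs_mult)
    finally show ?thesis using g by simp
  qed
  have rv: "real_int v = (c / real_of_int g) *\<^sub>R y"
  proof -
    have "real_of_int g *\<^sub>R real_int v = c *\<^sub>R y"
      using mu m(3) by (simp add: real_int_def vec_eq_iff uv)
    then have "inverse (real_of_int g) *\<^sub>R (real_of_int g *\<^sub>R real_int v) = inverse (real_of_int g) *\<^sub>R (c *\<^sub>R y)" by simp
    then show ?thesis using g by (simp add: divide_inverse mult.commute)
  qed
  show ?thesis
  proof (cases "c > 0")
    case True
    then show ?thesis using g gcdv rv by (intro exI[of _ v] exI[of _ "c / real_of_int g"]) simp
  next
    case False
    have "real_int (- v) = (- c / real_of_int g) *\<^sub>R y"
      using rv by (simp add: real_int_def vec_eq_iff)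
    moreover have "Gcd (range (\<lambda>j. (- v) $ j)) = 1"
    proof -
      have "Gcd ((*) (-1) ` range (\<lambda>j. v $ j)) = 1" by (simp only: Gcd_mult gcdv) simp
      then show ?thesis by (simp add: image_image)
    qed
    moreover have "- c / real_of_int g > 0" using False m(1) g by (simp add: divide_less_0_iff)
    ultimately show ?thesis by blast
  qed
qed

lemma primitive_facet_normals_eq:
  "primitive_facet_normals P = {\<mu>. Gcd (range (\<lambda>j. \<mu> $ j)) = 1 \<and> min_face (real_int \<mu>) P facet_of P}"
  by (simp add: primitive_facet_normals_def min_face_def ipair_real)

text \<open>
  A facet determines a primitive normal up to its sign, and there are finitely many facets.
\<close>

lemma finite_primitive_facet_normals:
  fixes P :: "(real ^ 'n::finite) set"
  assumes P: "polytope P" and dim: "aff_dim P = int CARD('n)"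
  shows "finite (primitive_facet_normals P)"
proof -
  have fin: "finite {\<mu>. Gcd (range (\<lambda>j. \<mu> $ j)) = 1 \<and> min_face (real_int \<mu>) P = F}" if F: "F facet_of P" for F
  proof (cases "{\<mu>. Gcd (range (\<lambda>j. \<mu> $ j)) = 1 \<and> min_face (real_int \<mu>) P = F} = {}")
    case False
    then obtain \<mu> where \<mu>: "Gcd (range (\<lambda>j. \<mu> $ j)) = 1" "min_face (real_int \<mu>) P = F" by blast
    have "F \<noteq> {}" and dimF: "aff_dim F = int CARD('n) - 1" using F dim by (auto simp: facet_of_def)
    then obtain s0 where s0: "s0 \<in> F" by blast
    define T where "T = (+) (- s0) ` F"
    have "int (dim T) = int CARD('n) - 1"
      using dimF unfolding aff_dim_eq_dim_translate[OF s0] T_def .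
    then have dimT: "dim T + 1 = DIM(real ^ 'n)" by simp
    have orth: "real_int \<mu>' \<bullet> t = 0" if \<mu>': "min_face (real_int \<mu>') P = F" and t: "t \<in> T" for \<mu>' t
    proof -
      obtain s where s: "s \<in> F" "t = s - s0" using t by (auto simp: T_def)
      have "real_int \<mu>' \<bullet> s = real_int \<mu>' \<bullet> s0" using s(1) s0 unfolding \<mu>'[symmetric]
        by (auto simp: min_face_def intro: antisym)
      then show ?thesis by (simp add: s(2) inner_diff_right)
    qed
    have nz: "real_int \<mu> \<noteq> 0"
    proof
      assume "real_int \<mu> = 0"
      then have "range (\<lambda>j. \<mu> $ j) = {0}" by (auto simp: real_int_def vec_eq_iff)
      then show False using \<mu>(1) by simp
    qed
    have "\<mu>' = \<mu> \<or> \<mu>' = - \<mu>" if "Gcd (range (\<lambda>j. \<mu>' $ j)) = 1" "min_face (real_int \<mu>') P = F" for \<mu>'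
      using primitive_multiple_unique[OF \<mu>(1) that(1)]
        normal_unique[OF dimT nz orth[OF \<mu>(2)] orth[OF that(2)]] by blast
    then have "{\<mu>. Gcd (range (\<lambda>j. \<mu> $ j)) = 1 \<and> min_face (real_int \<mu>) P = F} \<subseteq> {\<mu>, - \<mu>}" by blast
    then show ?thesis by (rule finite_subset) simp
  next
    case True
    then show ?thesis by (simp only: finite.emptyI)
  qed
  have "primitive_facet_normals P \<subseteq>
      (\<Union>F\<in>{F. F facet_of P}. {\<mu>. Gcd (range (\<lambda>j. \<mu> $ j)) = 1 \<and> min_face (real_int \<mu>) P = F})"
    by (auto simp: primitive_facet_normals_eq)
  moreover have "finite \<dots>" using fin by (intro finite_UN_I finite_polytope_facets P) auto
  ultimately show ?thesis by (rule finite_subset)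
qed

lemma polytope_newton_polytope: "polytope (newton_polytope p)"
  unfolding newton_polytope_real_exponent polytope_def
  by (intro exI[of _ "real_exponent ` support p"]) simp

lemma support_min_le:
  assumes "a \<in> newton_polytope p"
  shows "support_min p \<mu> \<le> real_int \<mu> \<bullet> a"
proof -
  have "compact ((\<lambda>\<alpha>. real_int \<mu> \<bullet> \<alpha>) ` newton_polytope p)"
    by (intro compact_continuous_image continuous_intros polytope_imp_compact polytope_newton_polytope)
  then have "bdd_below ((\<lambda>\<alpha>. real_int \<mu> \<bullet> \<alpha>) ` newton_polytope p)"
    by (intro bounded_imp_bdd_below compact_imp_bounded)
  from cINF_lower[OF this assms] show ?thesis by (simp only: support_min_def ipair_real)
qed

lemma support_min_min_face:
  assumes "a \<in> min_face (real_int \<mu>) (newton_polytope p)"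
  shows "support_min p \<mu> = real_int \<mu> \<bullet> a"
  unfolding support_min_def ipair_real
proof (rule cInf_eq_minimum)
  show "real_int \<mu> \<bullet> a \<in> (\<lambda>\<alpha>. real_int \<mu> \<bullet> \<alpha>) ` newton_polytope p"
    using assms by (intro imageI) (simp add: min_face_def)
  fix x assume "x \<in> (\<lambda>\<alpha>. real_int \<mu> \<bullet> \<alpha>) ` newton_polytope p"
  then show "real_int \<mu> \<bullet> a \<le> x" using assms by (auto simp: min_face_def)
qed

lemma support_min_attained:
  assumes "p \<noteq> 0"
  shows "\<exists>\<alpha>\<in>support p. support_min p \<mu> = real_int \<mu> \<bullet> real_exponent \<alpha>"
proof -
  let ?S = "(\<lambda>\<alpha>. real_int \<mu> \<bullet> real_exponent \<alpha>) ` support p"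
  have S: "finite ?S" "?S \<noteq> {}" using keys_eq_empty assms by simp_all
  from Min_in[OF this] obtain \<alpha> where \<alpha>: "\<alpha> \<in> support p" "Min ?S = real_int \<mu> \<bullet> real_exponent \<alpha>" by auto
  have "real_exponent ` support p \<subseteq> {x. real_int \<mu> \<bullet> x \<ge> Min ?S}" using S by auto
  then have "newton_polytope p \<subseteq> {x. real_int \<mu> \<bullet> x \<ge> Min ?S}"
    unfolding newton_polytope_real_exponent by (intro hull_minimal convex_halfspace_ge)
  then have "real_exponent \<alpha> \<in> min_face (real_int \<mu>) (newton_polytope p)"
    using \<alpha> by (auto simp: min_face_def newton_polytope_real_exponent intro: hull_inc)
  then show ?thesis using \<alpha>(1) support_min_min_face by blast
qed

definition gamma_arg :: "('m::finite \<Rightarrow> ('n::finite) cpoly) \<Rightarrow> int ^ 'n \<Rightarrow> complex ^ ('n + 'm) \<Rightarrow> complex" where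
  "gamma_arg f \<mu> p = ipair \<mu> (spart p) - (\<Sum>i\<in>UNIV. complex_of_real (support_min (f i) \<mu>) * tpart p $ i)"

lemma gamma_arg_add: "gamma_arg f \<mu> (p + q) = gamma_arg f \<mu> p + gamma_arg f \<mu> q"
  by (simp add: gamma_arg_def ipair_def spart_def tpart_def sum.distrib distrib_left)

lemma gamma_arg_scale: "gamma_arg f \<mu> (c *s p) = c * gamma_arg f \<mu> p"
  by (simp add: gamma_arg_def ipair_def spart_def tpart_def sum_distrib_left right_diff_distrib mult_ac)

lemma linear_Re_gamma_arg: "linear (\<lambda>p. Re (gamma_arg f \<mu> p))"
  by (rule linearI) (simp_all add: gamma_arg_add scaleR_eq_scalar_mult gamma_arg_scale)

context
  fixes f :: "'m::finite \<Rightarrow> ('n::finite) cpoly"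
  assumes full_dim: "aff_dim (newton_polytope (\<Prod>i\<in>UNIV. f i)) = int CARD('n)"
begin

lemma factor_nonzero: "f i \<noteq> 0"
proof
  assume "f i = 0"
  then have "newton_polytope (f i) = {}" by (simp add: newton_polytope_def)
  then have "newton_polytope (\<Prod>i\<in>UNIV. f i) = {}" unfolding newton_polytope_prod_wsum wsum_def by auto
  then show False using full_dim by simp
qed

lemma newton_polytope_factor_nonempty: "newton_polytope (f i) \<noteq> {}"
  using factor_nonzero[of i] by (simp add: newton_polytope_real_exponent)

lemma aff_dim_weighted_newton_sum:
  assumes "\<And>i. \<tau> i > 0"
  shows "aff_dim (wsum (\<lambda>i. newton_polytope (f i)) \<tau>) = int CARD('n)"
proof (rule antisym)
  show "aff_dim (wsum (\<lambda>i. newton_polytope (f i)) \<tau>) \<le> int CARD('n)"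
    using aff_dim_le_DIM[of "wsum (\<lambda>i. newton_polytope (f i)) \<tau>"] by simp
  show "int CARD('n) \<le> aff_dim (wsum (\<lambda>i. newton_polytope (f i)) \<tau>)"
    using aff_dim_wsum_le[of "\<lambda>i. newton_polytope (f i)" \<tau> "\<lambda>_. 1"] assms newton_polytope_factor_nonempty
    by (simp add: less_imp_neq[symmetric] flip: full_dim newton_polytope_prod_wsum)
qed

lemma primitive_normal_gt:
  assumes \<mu>: "\<mu> \<in> primitive_facet_normals (newton_polytope (\<Prod>i\<in>UNIV. f i))" and \<tau>: "\<And>i. \<tau> i > 0"
    and \<sigma>: "\<sigma> \<in> interior (wsum (\<lambda>i. newton_polytope (f i)) \<tau>)"
  shows "(\<Sum>i\<in>UNIV. \<tau> i * support_min (f i) \<mu>) < real_int \<mu> \<bullet> \<sigma>"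
proof -
  let ?W = "wsum (\<lambda>i. newton_polytope (f i)) \<tau>"
  have nz: "real_int \<mu> \<noteq> 0"
  proof
    assume "real_int \<mu> = 0"
    then have "range (\<lambda>j. \<mu> $ j) = {0}" by (auto simp: real_int_def vec_eq_iff)
    then show False using \<mu> by (simp add: primitive_facet_normals_eq)
  qed
  have "?W \<subseteq> {x. real_int \<mu> \<bullet> x \<ge> (\<Sum>i\<in>UNIV. \<tau> i * support_min (f i) \<mu>)}"
    unfolding wsum_def using \<tau>
    by (auto simp: inner_sum_right less_imp_le intro!: sum_mono mult_left_mono support_min_le)
  then have "interior ?W \<subseteq> interior {x. real_int \<mu> \<bullet> x \<ge> (\<Sum>i\<in>UNIV. \<tau> i * support_min (f i) \<mu>)}"
    by (rule interior_mono)
  then show ?thesis using \<sigma> nz by auto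
qed

lemma interior_weighted_newton_sum_nonempty:
  assumes \<tau>: "\<And>i. \<tau> i > 0"
  shows "interior (wsum (\<lambda>i. newton_polytope (f i)) \<tau>) \<noteq> {}"
    "rel_interior (wsum (\<lambda>i. newton_polytope (f i)) \<tau>) = interior (wsum (\<lambda>i. newton_polytope (f i)) \<tau>)"
proof -
  let ?W = "wsum (\<lambda>i. newton_polytope (f i)) \<tau>"
  have dimW: "aff_dim ?W = int CARD('n)" by (rule aff_dim_weighted_newton_sum[OF \<tau>])
  have "polytope ?W" by (intro polytope_wsum polytope_newton_polytope)
  then have W: "convex ?W" by (simp add: polytope_imp_convex)
  have "affine hull ?W = UNIV" using dimW aff_dim_eq_full[of ?W] by simp
  then show eq: "rel_interior ?W = interior ?W" by (rule rel_interior_interior)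
  have "?W \<noteq> {}" using dimW by auto
  then show "interior ?W \<noteq> {}" using rel_interior_eq_empty[OF W] eq by simp
qed

text \<open>
  A segment from an interior point to a point outside leaves the polytope through a facet. The normal of
  this facet is the normal of a facet of \<open>\<Delta>\<^sub>f\<close> too, because the corresponding face of \<open>\<Delta>\<^sub>f\<close> has the same
  dimension, by \<open>wsum_min_faces\<close> and \<open>aff_dim_wsum_le\<close>. But both ends of the segment lie strictly on
  the inner side of the supporting hyperplane.
\<close>

lemma interior_weighted_newton_sum_if:
  assumes \<tau>: "\<And>i. \<tau> i > 0"
    and \<sigma>: "\<And>\<mu>. \<mu> \<in> primitive_facet_normals (newton_polytope (\<Prod>i\<in>UNIV. f i)) \<Longrightarrow>
      (\<Sum>i\<in>UNIV. \<tau> i * support_min (f i) \<mu>) < real_int \<mu> \<bullet> \<sigma>"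
  shows "\<sigma> \<in> interior (wsum (\<lambda>i. newton_polytope (f i)) \<tau>)"
proof (rule ccontr)
  let ?P = "\<lambda>i. newton_polytope (f i)"
  let ?W = "wsum ?P \<tau>" and ?\<Delta> = "newton_polytope (\<Prod>i\<in>UNIV. f i)"
  assume out: "\<sigma> \<notin> interior ?W"
  have polyW: "polytope ?W" by (intro polytope_wsum polytope_newton_polytope)
  obtain p0 where p0: "p0 \<in> interior ?W" using interior_weighted_newton_sum_nonempty(1)[of \<tau>, OF \<tau>] by blast
  have "closed_segment p0 \<sigma> \<inter> frontier (interior ?W) \<noteq> {}"
    using p0 out by (intro connected_Int_frontier) auto
  then obtain b where b: "b \<in> closed_segment p0 \<sigma>" "b \<in> frontier ?W"
    using frontier_interior_subset by blast
  have "closed ?W" using polyW by (simp add: polytope_imp_closed)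
  then have "b \<in> ?W - rel_interior ?W"
    using b(2) unfolding interior_weighted_newton_sum_nonempty(2)[OF \<tau>] by (simp add: frontier_def)
  then obtain G where G: "b \<in> G" "G facet_of ?W"
    unfolding rel_boundary_of_polyhedron[OF polytope_imp_polyhedron[OF polyW]] by blast
  obtain a h where a: "a \<noteq> 0" "?W \<subseteq> {x. a \<bullet> x \<le> h}" "G = ?W \<inter> {x. a \<bullet> x = h}"
    using facet_of_polyhedron[OF polytope_imp_polyhedron[OF polyW] G(2)] by blast
  define y where "y = - a"
  have y: "y \<noteq> 0" using a by (simp add: y_def)
  have Gy: "G = min_face y ?W"
  proof -
    have "b \<in> min_face y ?W" using G(1) a by (auto simp: min_face_def y_def)
    from min_face_eq_hyperplane[OF this] show ?thesis using a(3) G(1) by (auto simp: y_def)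
  qed
  have Gw: "G = wsum (\<lambda>i. min_face y (?P i)) \<tau>"
    unfolding Gy by (rule wsum_min_faces[OF \<tau>])
  have ne: "min_face y (?P i) \<noteq> {}" for i using G(1) unfolding Gw wsum_def by auto
  have face\<Delta>: "min_face y ?\<Delta> = wsum (\<lambda>i. min_face y (?P i)) (\<lambda>_. 1)"
    unfolding newton_polytope_prod_wsum by (rule wsum_min_faces) simp
  have "aff_dim G = int CARD('n) - 1"
    using G(2) aff_dim_weighted_newton_sum[OF \<tau>] by (simp add: facet_of_def)
  then have ge: "int CARD('n) - 1 \<le> aff_dim (min_face y ?\<Delta>)"
    unfolding face\<Delta> Gw using aff_dim_wsum_le[of "\<lambda>i. min_face y (?P i)" "\<lambda>_. 1" \<tau>] ne by simp
  have ne\<Delta>: "min_face y ?\<Delta> \<noteq> {}"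
  proof -
    have "\<exists>d. \<forall>i. d i \<in> min_face y (?P i)"
      by (intro choice) (use ne in \<open>simp add: ex_in_conv\<close>)
    then show ?thesis unfolding face\<Delta> wsum_def by blast
  qed
  then obtain x0 where x0: "x0 \<in> min_face y ?\<Delta>" by blast
  have "aff_dim (min_face y ?\<Delta>) \<le> aff_dim {x. y \<bullet> x = y \<bullet> x0}"
    unfolding min_face_eq_hyperplane[OF x0] by (intro aff_dim_subset) auto
  then have dim\<Delta>: "aff_dim (min_face y ?\<Delta>) = int CARD('n) - 1"
    using ge y by simp
  obtain \<mu> c where \<mu>: "c > 0" "Gcd (range (\<lambda>j. \<mu> $ j)) = 1" "real_int \<mu> = c *\<^sub>R y"
    using facet_primitive_normal[OF _ y] dim\<Delta> unfolding newton_polytope_real_exponent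
    using finite_keys by blast
  have mf: "min_face (real_int \<mu>) S = min_face y S" for S using \<mu> by (simp add: min_face_def)
  have "min_face y ?\<Delta> facet_of ?\<Delta>"
    unfolding facet_of_def using min_face_face_of[of ?\<Delta> y] ne\<Delta> dim\<Delta> full_dim
    by (simp add: polytope_imp_convex polytope_newton_polytope)
  then have \<mu>K: "\<mu> \<in> primitive_facet_normals ?\<Delta>"
    using \<mu>(2) by (simp add: primitive_facet_normals_eq mf)
  let ?N = "\<Sum>i\<in>UNIV. \<tau> i * support_min (f i) \<mu>"
  have "real_int \<mu> \<bullet> b = ?N"
  proof -
    obtain d where d: "\<And>i. d i \<in> min_face y (?P i)" "b = (\<Sum>i\<in>UNIV. \<tau> i *\<^sub>R d i)"
      using G(1) unfolding Gw wsum_def by blast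
    have "support_min (f i) \<mu> = real_int \<mu> \<bullet> d i" for i
      using d(1) by (intro support_min_min_face) (simp add: mf)
    then show ?thesis by (simp add: d(2) inner_sum_right)
  qed
  moreover have "p0 \<in> {x. real_int \<mu> \<bullet> x > ?N}" "\<sigma> \<in> {x. real_int \<mu> \<bullet> x > ?N}"
    using primitive_normal_gt[OF \<mu>K \<tau> p0] \<sigma>[OF \<mu>K] by simp_all
  then have "closed_segment p0 \<sigma> \<subseteq> {x. real_int \<mu> \<bullet> x > ?N}"
    by (intro closed_segment_subset convex_halfspace_gt)
  ultimately show False using b(1) by auto
qed

text \<open>
  In terms of linear inequalities, the effect of a shift of \<open>(s, t)\<close> on membership can be read off.
\<close>

lemma convergence_domain_eq:
  "convergence_domain f = {p. (\<forall>i. Re (tpart p $ i) > 0) \<and>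
     (\<forall>\<mu>\<in>primitive_facet_normals (newton_polytope (\<Prod>i\<in>UNIV. f i)). Re (gamma_arg f \<mu> p) > 0)}"
proof -
  have eq: "(Re (gamma_arg f \<mu> p) > 0) \<longleftrightarrow>
      (\<Sum>i\<in>UNIV. Re (tpart p $ i) * support_min (f i) \<mu>) < real_int \<mu> \<bullet> (\<chi> j. Re (spart p $ j))" for \<mu> p
    by (simp add: gamma_arg_def Re_ipair mult.commute)
  have "(\<chi> j. Re (spart p $ j)) \<in> interior (weighted_newton_sum f (\<chi> i. Re (tpart p $ i))) \<longleftrightarrow>
      (\<forall>\<mu>\<in>primitive_facet_normals (newton_polytope (\<Prod>i\<in>UNIV. f i)).
        (\<Sum>i\<in>UNIV. Re (tpart p $ i) * support_min (f i) \<mu>) < real_int \<mu> \<bullet> (\<chi> j. Re (spart p $ j)))"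
    if "\<forall>i. Re (tpart p $ i) > 0" for p
  proof -
    have pos: "\<And>i. Re (tpart p $ i) > 0" using that by blast
    show ?thesis
      unfolding weighted_newton_sum_eq vec_lambda_beta
      using primitive_normal_gt[of _ "\<lambda>i. Re (tpart p $ i)", OF _ pos]
        interior_weighted_newton_sum_if[of "\<lambda>i. Re (tpart p $ i)", OF pos] by blast
  qed
  then show ?thesis unfolding convergence_domain_def eq by blast
qed

end

section \<open>Convergence and holomorphy of the integral\<close>

text \<open>
  The vector \<open>B(w)\<close> for which the integrand is \<open>exp (B(w) \<cdot> p)\<close>.
\<close>

definition mellin_exponent :: "('m::finite \<Rightarrow> complex ^ 'n::finite \<Rightarrow> complex) \<Rightarrow> complex ^ 'n \<Rightarrow> complex ^ ('n + 'm)" where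
  "mellin_exponent l w = (\<chi> k. case k of Inl j \<Rightarrow> w $ j | Inr i \<Rightarrow> - l i w)"

text \<open>
  The step from \<open>(s, t)\<close> to \<open>(s + \<alpha>, t + e\<^sub>i)\<close>, which multiplies the integrand by \<open>z^\<alpha> / f\<^sub>i(z)\<close>.
\<close>

definition mellin_shift :: "'m::finite \<Rightarrow> nat ^ 'n::finite \<Rightarrow> complex ^ ('n + 'm)" where
  "mellin_shift i \<alpha> = (\<chi> k. case k of Inl j \<Rightarrow> of_nat (\<alpha> $ j) | Inr i' \<Rightarrow> if i' = i then 1 else 0)"

lemma sum_UNIV_Plus: "(\<Sum>k\<in>UNIV. h k) = (\<Sum>j\<in>UNIV. h (Inl j)) + (\<Sum>i\<in>UNIV. h (Inr i))"
  for h :: "'n::finite + 'm::finite \<Rightarrow> 'a::comm_monoid_add"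
  by (simp add: UNIV_Plus_UNIV[symmetric] sum.Plus del: UNIV_Plus_UNIV)

lemma euler_mellin_integrand_eq_exp:
  "euler_mellin_integrand l p w = exp (cpair (mellin_exponent l w) p)"
proof -
  have "cpair (mellin_exponent l w) p = (\<Sum>j\<in>UNIV. spart p $ j * w $ j) - (\<Sum>i\<in>UNIV. tpart p $ i * l i w)"
    by (simp add: cpair_def mellin_exponent_def sum_UNIV_Plus spart_def tpart_def sum_negf mult.commute)
  then show ?thesis
    by (simp add: euler_mellin_integrand_def exp_diff exp_sum)
qed

lemma euler_mellin_integrand_shift:
  "euler_mellin_integrand l (p + mellin_shift i \<alpha>) w =
     exp (cpair (cplx (real_exponent \<alpha>)) w) / exp (l i w) * euler_mellin_integrand l p w"
proof -
  have "cpair (mellin_exponent l w) (mellin_shift i \<alpha>) = cpair (cplx (real_exponent \<alpha>)) w - l i w"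
    by (simp add: cpair_def mellin_exponent_def sum_UNIV_Plus mellin_shift_def cplx_def real_exponent_def
        mult.commute if_distrib cong: if_cong)
  then show ?thesis
    by (simp add: euler_mellin_integrand_eq_exp cpair_add_right exp_add exp_diff)
qed

lemma holomorphic_vec_on_line:
  assumes F: "holomorphic_vec_on F V" and V: "\<And>\<zeta>. \<zeta> \<in> S \<Longrightarrow> w + \<zeta> *s u \<in> V" and S: "open S"
  shows "(\<lambda>\<zeta>. F (w + \<zeta> *s u)) holomorphic_on S"
  unfolding holomorphic_on_open[OF S]
proof
  fix \<zeta> assume "\<zeta> \<in> S"
  then obtain D where D: "(F has_derivative D) (at (w + \<zeta> *s u))" "\<And>c v. D (c *s v) = c * D v"
    using F V unfolding holomorphic_vec_on_def by blast
  have "bounded_linear (\<lambda>h. h *s u)"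
  proof -
    have "linear (\<lambda>h. h *s u)"
      by (rule linearI) (simp_all add: vec_eq_iff algebra_simps)
    then show ?thesis by (simp add: linear_conv_bounded_linear)
  qed
  then have "((\<lambda>\<zeta>. w + \<zeta> *s u) has_derivative (\<lambda>h. h *s u)) (at \<zeta>)"
    by (auto intro!: derivative_eq_intros bounded_linear_imp_has_derivative)
  then have "((\<lambda>\<zeta>. F (w + \<zeta> *s u)) has_derivative (\<lambda>h. D (h *s u))) (at \<zeta>)"
    using has_derivative_compose[of "\<lambda>\<zeta>. w + \<zeta> *s u" "\<lambda>h. h *s u" \<zeta> UNIV F D] D(1) by simp
  moreover have "(\<lambda>h. D (h *s u)) = (*) (D u)" by (simp add: fun_eq_iff D(2))
  ultimately show "\<exists>f'. ((\<lambda>\<zeta>. F (w + \<zeta> *s u)) has_field_derivative f') (at \<zeta>)"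
    by (auto simp: has_field_derivative_def)
qed

lemma integral_lborel_translation:
  fixes f :: "'a::euclidean_space \<Rightarrow> 'b::{banach, second_countable_topology}"
  assumes "f \<in> borel_measurable borel"
  shows "(\<integral>x. f (x + c) \<partial>lborel) = (\<integral>x. f x \<partial>lborel)"
proof -
  have "(\<integral>x. f x \<partial>lborel) = (\<integral>x. f x \<partial>distr lborel borel ((+) c))" by (simp only: lborel_distr_plus)
  also have "\<dots> = (\<integral>x. f (c + x) \<partial>lborel)" using assms by (intro integral_distr) auto
  finally show ?thesis by (simp add: add.commute)
qed

lemma field_derivative_eq_0:
  fixes H :: "complex \<Rightarrow> complex"
  assumes "(H has_field_derivative d) (at 0)" "\<And>r::real. H (of_real r) = H 0"
  shows "d = 0"
proof -
  have "((\<lambda>r::real. H (of_real r)) has_derivative (\<lambda>h. d * of_real h)) (at 0)"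
  proof (rule has_derivative_compose[of of_real of_real 0 UNIV H "(*) d"])
    show "(complex_of_real has_derivative complex_of_real) (at 0)"
      by (rule bounded_linear_imp_has_derivative[OF bounded_linear_of_real])
    show "(H has_derivative (*) d) (at (of_real 0))"
      using assms(1) by (simp add: has_field_derivative_def)
  qed
  moreover have "((\<lambda>r::real. H (of_real r)) has_derivative (\<lambda>h. 0)) (at 0)"
    unfolding assms(2) by (rule has_derivative_const)
  ultimately have "(\<lambda>h. d * of_real h) = (\<lambda>h::real. 0)" by (rule has_derivative_unique)
  then show ?thesis by (metis mult_cancel_left1 of_real_1 mult.right_neutral)
qed

text \<open>
  The lattice distance of \<open>\<alpha>\<close> from the supporting hyperplane of the \<open>i\<close>-th Newton polytope with normal \<open>\<mu>\<close>.
\<close>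

definition facet_height :: "('m::finite \<Rightarrow> ('n::finite) cpoly) \<Rightarrow> int ^ 'n \<Rightarrow> 'm \<Rightarrow> nat ^ 'n \<Rightarrow> nat" where
  "facet_height f \<mu> i \<alpha> = nat \<lfloor>real_int \<mu> \<bullet> real_exponent \<alpha> - support_min (f i) \<mu>\<rfloor>"

text \<open>
  Logarithms of the \<open>f\<^sub>i(e^w)\<close> exist only where these have no zeros. This is how \<open>U\<close>, later the
  complement of the closed coamoeba, enters.
\<close>

locale log_branches =
  fixes f :: "'m::finite \<Rightarrow> ('n::finite) cpoly" and l :: "'m \<Rightarrow> complex ^ 'n \<Rightarrow> complex" and U
  assumes full_dim: "aff_dim (newton_polytope (\<Prod>i\<in>UNIV. f i)) = int CARD('n)"
    and U: "open U" and branch: "\<And>i. log_branch_on (f i) U (l i)"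
begin

abbreviation integrand :: "complex ^ ('n + 'm) \<Rightarrow> complex ^ 'n \<Rightarrow> complex" where
  "integrand \<equiv> euler_mellin_integrand l"

abbreviation normals :: "(int ^ 'n) set" where
  "normals \<equiv> primitive_facet_normals (newton_polytope (\<Prod>i\<in>UNIV. f i))"

lemma finite_normals: "finite normals"
  by (intro finite_primitive_facet_normals polytope_newton_polytope full_dim)

lemma convergence_domain_iff:
  "p \<in> convergence_domain f \<longleftrightarrow> (\<forall>i. Re (tpart p $ i) > 0) \<and> (\<forall>\<mu>\<in>normals. Re (gamma_arg f \<mu> p) > 0)"
  unfolding convergence_domain_eq[OF full_dim] by simp

text \<open>
  The minimum over the polytope is attained at a lattice point, so the difference is a natural number.
\<close>

lemma facet_height:
  assumes "\<alpha> \<in> support (f i)"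
  shows "real (facet_height f \<mu> i \<alpha>) = real_int \<mu> \<bullet> real_exponent \<alpha> - support_min (f i) \<mu>"
proof -
  have int: "real_int \<mu> \<bullet> real_exponent \<beta> \<in> \<int>" for \<beta>
    by (auto simp: inner_vec_def real_int_def real_exponent_def)
  obtain \<beta> where "support_min (f i) \<mu> = real_int \<mu> \<bullet> real_exponent \<beta>"
    using support_min_attained[OF factor_nonzero[OF full_dim]] by blast
  then have "real_int \<mu> \<bullet> real_exponent \<alpha> - support_min (f i) \<mu> \<in> \<int>" using int by simp
  moreover have "real_int \<mu> \<bullet> real_exponent \<alpha> - support_min (f i) \<mu> \<ge> 0"
    using support_min_le[of "real_exponent \<alpha>" "f i" \<mu>] assms
    by (simp add: newton_polytope_real_exponent hull_inc)
  ultimately obtain k where "real_int \<mu> \<bullet> real_exponent \<alpha> - support_min (f i) \<mu> = of_int k" "k \<ge> 0"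
    by (auto elim!: Ints_cases)
  then show ?thesis unfolding facet_height_def by simp
qed

lemma gamma_arg_shift:
  assumes "\<alpha> \<in> support (f i)"
  shows "gamma_arg f \<mu> (mellin_shift i \<alpha>) = of_nat (facet_height f \<mu> i \<alpha>)"
proof -
  have "gamma_arg f \<mu> (mellin_shift i \<alpha>) = of_real (real_int \<mu> \<bullet> real_exponent \<alpha> - support_min (f i) \<mu>)"
    by (simp add: gamma_arg_def ipair_def spart_def tpart_def mellin_shift_def real_int_def real_exponent_def
        inner_vec_def if_distrib cong: if_cong)
  then show ?thesis by (simp flip: facet_height[OF assms])
qed

lemma open_convergence_domain: "open (convergence_domain f)"
proof -
  have "convergence_domain f = (\<Inter>i. {p. 0 < Re (tpart p $ i)}) \<inter> (\<Inter>\<mu>\<in>normals. {p. 0 < Re (gamma_arg f \<mu> p)})"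
    by (auto simp: convergence_domain_iff)
  also have "open \<dots>"
  proof (intro open_Int open_INT ballI finite_normals finite)
    show "open {p. 0 < Re (tpart p $ i)}" for i
      unfolding tpart_def by (intro open_Collect_less) (auto intro!: continuous_intros)
    show "open {p. 0 < Re (gamma_arg f \<mu> p)}" for \<mu>
      using linear_Re_gamma_arg[of f \<mu>] by (intro open_Collect_less linear_continuous_on continuous_on_const)
        (simp add: linear_conv_bounded_linear)
  qed
  finally show ?thesis .
qed

lemma continuous_on_mellin_integrand:
  assumes "\<theta> \<in> U"
  shows "continuous_on UNIV (\<lambda>x. integrand q (cvec x \<theta>))"
    "continuous_on UNIV (\<lambda>x. mellin_exponent l (cvec x \<theta>) $ k)"
proof -
  have l: "continuous_on UNIV (\<lambda>x. l i (cvec x \<theta>))" for i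
  proof (rule continuous_on_compose2[of "tube U" "l i"])
    show "continuous_on (tube U) (l i)"
      using branch[of i] by (simp add: log_branch_on_def holomorphic_vec_on_imp_continuous_on)
  qed (use assms in \<open>auto intro!: continuous_intros\<close>)
  show *: "continuous_on UNIV (\<lambda>x. mellin_exponent l (cvec x \<theta>) $ k)" for k
  proof (cases k)
    case (Inl j)
    then show ?thesis by (auto simp: mellin_exponent_def intro!: continuous_intros)
  next
    case (Inr i)
    then show ?thesis using l by (auto simp: mellin_exponent_def intro!: continuous_intros)
  qed
  show "continuous_on UNIV (\<lambda>x. integrand q (cvec x \<theta>))"
    unfolding euler_mellin_integrand_eq_exp cpair_def by (intro continuous_intros *)
qed

text \<open>
  A ball around \<open>p\<close> lies in the domain of convergence. So for \<open>q\<close> near \<open>p\<close> the exponent \<open>\<sigma> = Re s\<close> can be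
  moved by a vector of length \<open>\<delta>\<close> in the direction of \<open>x\<close> without leaving the polytope, and
  \<open>\<langle>\<sigma>, x\<rangle> + \<delta> |x|\<close> becomes \<open>\<Sum> \<tau>\<^sub>i \<langle>d\<^sub>i, x\<rangle>\<close> with points \<open>d\<^sub>i\<close> of the Newton polytopes. The lower bounds for the
  \<open>|f\<^sub>i|\<close> cancel this sum; all other contributions are bounded.
\<close>

lemma mellin_integrand_bound:
  assumes p: "p \<in> convergence_domain f" and \<theta>0: "\<theta>0 \<in> U"
  obtains \<delta> C \<epsilon> where "\<delta> > 0" "C > 0" "\<epsilon> > 0" "ball \<theta>0 \<delta> \<subseteq> U" "ball p \<delta> \<subseteq> convergence_domain f"
    "\<forall>q\<in>ball p \<delta>. \<forall>\<theta>\<in>ball \<theta>0 \<delta>. \<forall>x.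
       norm (integrand q (cvec x \<theta>)) \<le> C * exp (- \<epsilon> * norm x)"
proof -
  obtain r1 where r1: "r1 > 0" "ball p r1 \<subseteq> convergence_domain f"
    using open_convergence_domain p openE by blast
  obtain r2 where r2: "r2 > 0" "cball \<theta>0 r2 \<subseteq> U" using U \<theta>0 open_contains_cball by blast
  define \<delta> where "\<delta> = min (r1 / 2) r2"
  have \<delta>: "\<delta> > 0" "2 * \<delta> \<le> r1" "\<delta> \<le> r2" using r1 r2 by (auto simp: \<delta>_def)
  have "\<forall>i. \<exists>a B. \<forall>x. \<forall>\<theta>\<in>cball \<theta>0 r2. \<bar>Im (l i (cvec x \<theta>))\<bar> \<le> B \<and>
     (\<forall>\<sigma>\<in>newton_polytope (f i). a + \<sigma> \<bullet> x \<le> Re (l i (cvec x \<theta>)))"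
    using log_branch_bounds[OF branch U _ r2(2)] by simp
  then obtain a B where aB: "\<And>i x \<theta>. \<theta> \<in> cball \<theta>0 r2 \<Longrightarrow> \<bar>Im (l i (cvec x \<theta>))\<bar> \<le> B i"
    "\<And>i x \<theta> \<sigma>. \<theta> \<in> cball \<theta>0 r2 \<Longrightarrow> \<sigma> \<in> newton_polytope (f i) \<Longrightarrow> a i + \<sigma> \<bullet> x \<le> Re (l i (cvec x \<theta>))"
    by metis
  \<comment> \<open>bounds for the coordinates of \<open>q\<close> and for the bounded part of the exponent\<close>
  define N where "N = norm p + \<delta>"
  define L where "L = (\<Sum>j\<in>(UNIV :: 'n set). N * (norm \<theta>0 + \<delta>)) + (\<Sum>i\<in>UNIV. N * \<bar>a i\<bar> + N * B i)"
  have bound: "norm (integrand q (cvec x \<theta>)) \<le> exp L * exp (- \<delta> * norm x)"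
    if q: "q \<in> ball p \<delta>" and \<theta>: "\<theta> \<in> ball \<theta>0 \<delta>" for q \<theta> x
  proof -
    have qN: "norm (q $ k) \<le> N" for k
    proof -
      have "norm (q $ k) \<le> norm q" by (rule Finite_Cartesian_Product.norm_nth_le)
      also have "\<dots> \<le> norm p + norm (p - q)" by norm
      also have "\<dots> \<le> N" using q by (simp add: N_def dist_norm)
      finally show ?thesis .
    qed
    have \<theta>N: "\<bar>\<theta> $ j\<bar> \<le> norm \<theta>0 + \<delta>" for j
    proof -
      have "\<bar>\<theta> $ j\<bar> \<le> norm \<theta>" by (rule component_le_norm_cart)
      also have "\<dots> \<le> norm \<theta>0 + norm (\<theta>0 - \<theta>)" by norm
      also have "\<dots> \<le> norm \<theta>0 + \<delta>" using \<theta> by (simp add: dist_norm)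
      finally show ?thesis .
    qed
    have \<theta>r: "\<theta> \<in> cball \<theta>0 r2" using \<theta> \<delta> by simp
    define u where "u = (if x = 0 then 0 else (\<delta> / norm x) *\<^sub>R x)"
    have u: "norm u \<le> \<delta>" "u \<bullet> x = \<delta> * norm x"
      using \<delta> by (auto simp: u_def dot_square_norm power2_eq_square)
    define u' :: "complex ^ ('n + 'm)" where "u' = (\<chi> k. case k of Inl j \<Rightarrow> of_real (u $ j) | Inr i \<Rightarrow> 0)"
    have "norm u' = norm u"
      by (simp add: u'_def norm_vec_def L2_set_def sum_UNIV_Plus)
    then have "dist p (q + u') < 2 * \<delta>"
      using q u dist_triangle[of p "q + u'" q] by (simp add: dist_norm)
    then have q': "q + u' \<in> convergence_domain f" using r1(2) \<delta>(2) by auto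
    define \<tau> where "\<tau> i = Re (tpart q $ i)" for i
    have \<tau>': "(\<lambda>i. Re (tpart (q + u') $ i)) = \<tau>" by (simp add: fun_eq_iff \<tau>_def tpart_def u'_def)
    have \<tau>: "\<tau> i > 0" for i
    proof -
      have "Re (tpart (q + u') $ i) > 0" using q' by (simp add: convergence_domain_def)
      then show ?thesis by (simp add: \<tau>_def tpart_def u'_def)
    qed
    have "(\<chi> j. Re (spart (q + u') $ j)) = (\<chi> j. Re (spart q $ j)) + u"
      by (simp add: spart_def u'_def vec_eq_iff)
    moreover have "(\<chi> j. Re (spart (q + u') $ j)) \<in>
        interior (wsum (\<lambda>i. newton_polytope (f i)) (\<lambda>i. Re (tpart (q + u') $ i)))"
      using q' unfolding convergence_domain_def weighted_newton_sum_eq vec_lambda_beta by blast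
    ultimately have "(\<chi> j. Re (spart q $ j)) + u \<in> interior (wsum (\<lambda>i. newton_polytope (f i)) \<tau>)"
      by (simp only: \<tau>')
    then have "(\<chi> j. Re (spart q $ j)) + u \<in> wsum (\<lambda>i. newton_polytope (f i)) \<tau>"
      using interior_subset by blast
    then obtain d where d: "\<And>i. d i \<in> newton_polytope (f i)" "(\<chi> j. Re (spart q $ j)) + u = (\<Sum>i\<in>UNIV. \<tau> i *\<^sub>R d i)"
      unfolding wsum_def by blast
    have "(\<Sum>j\<in>UNIV. Re (spart q $ j) * x $ j) + \<delta> * norm x = ((\<chi> j. Re (spart q $ j)) + u) \<bullet> x"
      by (simp add: inner_add_left u(2)) (simp add: inner_vec_def)
    also have "\<dots> = (\<Sum>i\<in>UNIV. \<tau> i * (d i \<bullet> x))" unfolding d(2) by (simp add: inner_sum_left)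
    finally have sx: "(\<Sum>j\<in>UNIV. Re (spart q $ j) * x $ j) = (\<Sum>i\<in>UNIV. \<tau> i * (d i \<bullet> x)) - \<delta> * norm x" by simp
    have "Re (cpair (mellin_exponent l (cvec x \<theta>)) q) =
        (\<Sum>j\<in>UNIV. Re (spart q $ j) * x $ j) + (\<Sum>j\<in>UNIV. - Im (spart q $ j) * \<theta> $ j)
        + (\<Sum>i\<in>UNIV. - \<tau> i * Re (l i (cvec x \<theta>)) + Im (tpart q $ i) * Im (l i (cvec x \<theta>)))"
      by (simp add: cpair_def mellin_exponent_def sum_UNIV_Plus spart_def tpart_def \<tau>_def cvec_def
          sum_subtractf sum.distrib sum_negf algebra_simps)
    also have "(\<Sum>j\<in>UNIV. - Im (spart q $ j) * \<theta> $ j) \<le> (\<Sum>j\<in>(UNIV :: 'n set). N * (norm \<theta>0 + \<delta>))"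
    proof (rule sum_mono)
      fix j
      have "- Im (spart q $ j) * \<theta> $ j \<le> \<bar>Im (spart q $ j)\<bar> * \<bar>\<theta> $ j\<bar>"
        by (metis abs_ge_self abs_minus_cancel abs_mult)
      also have "\<dots> \<le> N * (norm \<theta>0 + \<delta>)"
        using qN[of "Inl j"] \<theta>N[of j] abs_Im_le_cmod[of "q $ Inl j"]
        by (intro mult_mono) (auto simp: spart_def)
      finally show "- Im (spart q $ j) * \<theta> $ j \<le> N * (norm \<theta>0 + \<delta>)" .
    qed
    also have "(\<Sum>i\<in>UNIV. - \<tau> i * Re (l i (cvec x \<theta>)) + Im (tpart q $ i) * Im (l i (cvec x \<theta>)))
       \<le> (\<Sum>i\<in>UNIV. - (\<tau> i * (d i \<bullet> x)) + (N * \<bar>a i\<bar> + N * B i))"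
    proof (rule sum_mono)
      fix i
      have "\<tau> i * (a i + d i \<bullet> x) \<le> \<tau> i * Re (l i (cvec x \<theta>))"
        using \<tau>[of i] aB(2)[OF \<theta>r d(1)[of i]] by (intro mult_left_mono) auto
      moreover have "- (\<tau> i * a i) \<le> N * \<bar>a i\<bar>"
      proof -
        have "- (\<tau> i * a i) \<le> \<bar>\<tau> i\<bar> * \<bar>a i\<bar>" by (metis abs_ge_self abs_minus_cancel abs_mult)
        also have "\<dots> \<le> N * \<bar>a i\<bar>"
          using qN[of "Inr i"] abs_Re_le_cmod[of "q $ Inr i"]
          by (intro mult_right_mono) (auto simp: \<tau>_def tpart_def)
        finally show ?thesis .
      qed
      moreover have "Im (tpart q $ i) * Im (l i (cvec x \<theta>)) \<le> N * B i"
      proof -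
        have "Im (tpart q $ i) * Im (l i (cvec x \<theta>)) \<le> \<bar>Im (tpart q $ i)\<bar> * \<bar>Im (l i (cvec x \<theta>))\<bar>"
          by (metis abs_ge_self abs_mult)
        also have "\<dots> \<le> N * B i"
          using qN[of "Inr i"] abs_Im_le_cmod[of "q $ Inr i"] aB(1)[OF \<theta>r, of i x]
          by (intro mult_mono) (auto simp: tpart_def)
        finally show ?thesis .
      qed
      ultimately show "- \<tau> i * Re (l i (cvec x \<theta>)) + Im (tpart q $ i) * Im (l i (cvec x \<theta>))
          \<le> - (\<tau> i * (d i \<bullet> x)) + (N * \<bar>a i\<bar> + N * B i)"
        by (simp add: distrib_left)
    qed
    finally have "Re (cpair (mellin_exponent l (cvec x \<theta>)) q) \<le> L - \<delta> * norm x"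
      unfolding sx L_def by (simp add: sum.distrib sum_negf sum_subtractf)
    then show ?thesis
      by (simp add: euler_mellin_integrand_eq_exp norm_exp_eq_Re flip: exp_add)
  qed
  show ?thesis
  proof (rule that[of \<delta> "exp L" \<delta>])
    show "ball \<theta>0 \<delta> \<subseteq> U" using r2(2) \<delta>(3) by (auto simp: subset_iff)
    show "ball p \<delta> \<subseteq> convergence_domain f" using r1(2) \<delta> by (auto simp: subset_iff)
  qed (use \<delta>(1) bound in auto)
qed

lemma integrable_mellin_integrand:
  assumes "p \<in> convergence_domain f" "\<theta> \<in> U"
  shows "integrable lborel (\<lambda>x. integrand p (cvec x \<theta>))"
proof -
  obtain \<delta> C \<epsilon> where b: "\<delta> > 0" "C > 0" "\<epsilon> > 0" "ball \<theta> \<delta> \<subseteq> U" "ball p \<delta> \<subseteq> convergence_domain f"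
    "\<forall>q\<in>ball p \<delta>. \<forall>\<theta>'\<in>ball \<theta> \<delta>. \<forall>x.
       norm (integrand q (cvec x \<theta>')) \<le> C * exp (- \<epsilon> * norm x)"
    by (rule mellin_integrand_bound[OF assms])
  show ?thesis
  proof (rule Bochner_Integration.integrable_bound)
    show "integrable lborel (\<lambda>x::real ^ 'n. C * exp (- \<epsilon> * norm x))"
      by (intro integrable_mult_right integrable_exp_neg_norm b)
    show "(\<lambda>x. integrand p (cvec x \<theta>)) \<in> borel_measurable lborel"
      using borel_measurable_continuous_onI[OF continuous_on_mellin_integrand(1)[OF assms(2)]] by simp
    show "AE x in lborel. norm (integrand p (cvec x \<theta>)) \<le> norm (C * exp (- \<epsilon> * norm x))"
      using b(6) b(1,2) by (intro AE_I2) simp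
  qed
qed

lemma holomorphic_euler_mellin:
  assumes "\<theta> \<in> U"
  shows "holomorphic_vec_on (euler_mellin l \<theta>) (convergence_domain f)"
  unfolding holomorphic_vec_on_def
proof
  fix p assume "p \<in> convergence_domain f"
  then obtain \<delta> C \<epsilon> where b: "\<delta> > 0" "C > 0" "\<epsilon> > 0" "ball \<theta> \<delta> \<subseteq> U" "ball p \<delta> \<subseteq> convergence_domain f"
    "\<forall>q\<in>ball p \<delta>. \<forall>\<theta>'\<in>ball \<theta> \<delta>. \<forall>x.
       norm (integrand q (cvec x \<theta>')) \<le> C * exp (- \<epsilon> * norm x)"
    by (rule mellin_integrand_bound[OF _ assms])
  have "\<exists>D. ((\<lambda>q. \<integral>x. exp (cpair (mellin_exponent l (cvec x \<theta>)) q) \<partial>lborel) has_derivative D) (at p) \<and>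
      (\<forall>c v. D (c *s v) = c * D v)"
  proof (rule has_derivative_integral_exp_cpair[OF b(1)])
    show "integrable lborel (\<lambda>x::real ^ 'n. C * exp (- \<epsilon> * norm x))"
      by (intro integrable_mult_right integrable_exp_neg_norm b)
    show "norm (exp (cpair (mellin_exponent l (cvec x \<theta>)) q)) \<le> C * exp (- \<epsilon> * norm x)"
      if "q \<in> ball p \<delta>" for x q
      using b(6) that b(1) by (simp add: euler_mellin_integrand_eq_exp)
    show "(\<lambda>x. mellin_exponent l (cvec x \<theta>) $ k) \<in> borel_measurable lborel" for k
      using borel_measurable_continuous_onI[OF continuous_on_mellin_integrand(2)[OF assms]] by simp
  qed
  then show "\<exists>D. (euler_mellin l \<theta> has_derivative D) (at p) \<and> (\<forall>c v. D (c *s v) = c * D v)"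
    by (simp add: euler_mellin_def[abs_def] euler_mellin_integrand_eq_exp)
qed

end

section \<open>Complex translations of the contour\<close>

context log_branches
begin

lemma shift_mem_convergence_domain:
  assumes p: "p \<in> convergence_domain f" and \<alpha>: "\<alpha> \<in> support (f i)"
  shows "p + mellin_shift i \<alpha> \<in> convergence_domain f"
  unfolding convergence_domain_iff
proof (intro conjI allI ballI)
  show "Re (tpart (p + mellin_shift i \<alpha>) $ i') > 0" for i'
    using p by (auto simp: convergence_domain_iff tpart_def mellin_shift_def add_pos_nonneg)
  show "Re (gamma_arg f \<mu> (p + mellin_shift i \<alpha>)) > 0" if "\<mu> \<in> normals" for \<mu>
    using p that by (simp add: convergence_domain_iff gamma_arg_add gamma_arg_shift[OF \<alpha>] add_pos_nonneg)
qed

lemma exp_log_branch: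
  assumes "w \<in> tube U"
  shows "exp (l i w) = expsum (support (f i)) (coeff_of (f i)) real_exponent w"
  using branch[of i] assms by (simp add: log_branch_on_def peval_exp)

text \<open>
  This is the identity \<open>1 = f\<^sub>i / f\<^sub>i\<close>, expanded in the numerator.
\<close>

lemma mellin_integrand_expand:
  assumes "w \<in> tube U"
  shows "integrand p w =
     (\<Sum>\<alpha>\<in>support (f i). coeff_of (f i) \<alpha> * integrand (p + mellin_shift i \<alpha>) w)"
proof -
  have "(\<Sum>\<alpha>\<in>support (f i). coeff_of (f i) \<alpha> * integrand (p + mellin_shift i \<alpha>) w)
     = expsum (support (f i)) (coeff_of (f i)) real_exponent w / exp (l i w) * integrand p w"
    by (simp add: euler_mellin_integrand_shift expsum_def sum_distrib_right sum_divide_distrib mult.assoc)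
  then show ?thesis by (simp flip: exp_log_branch[OF assms])
qed

lemma euler_mellin_expand:
  assumes p: "p \<in> convergence_domain f" and \<theta>: "\<theta> \<in> U"
  shows "euler_mellin l \<theta> p =
     (\<Sum>\<alpha>\<in>support (f i). coeff_of (f i) \<alpha> * euler_mellin l \<theta> (p + mellin_shift i \<alpha>))"
proof -
  have "euler_mellin l \<theta> p = (\<integral>x. (\<Sum>\<alpha>\<in>support (f i). coeff_of (f i) \<alpha> *
      integrand (p + mellin_shift i \<alpha>) (cvec x \<theta>)) \<partial>lborel)"
    unfolding euler_mellin_def using \<theta>
    by (intro Bochner_Integration.integral_cong refl mellin_integrand_expand) simp
  also have "\<dots> = (\<Sum>\<alpha>\<in>support (f i). coeff_of (f i) \<alpha> * euler_mellin l \<theta> (p + mellin_shift i \<alpha>))"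
    unfolding euler_mellin_def using \<theta> p
    by (subst Bochner_Integration.integral_sum)
      (auto intro!: integrable_mult_right integrable_mellin_integrand shift_mem_convergence_domain)
  finally show ?thesis .
qed

text \<open>
  The derivative of the integrand along \<open>v\<close>, in which \<open>\<partial>\<^sub>v f\<^sub>i / f\<^sub>i\<close> has been expanded so that every
  term is an integrand at a shifted parameter.
\<close>

definition log_derivative_integrand :: "complex ^ ('n + 'm) \<Rightarrow> real ^ 'n \<Rightarrow> complex ^ 'n \<Rightarrow> complex" where
  "log_derivative_integrand p v w = cpair (spart p) (cplx v) * integrand p w -
     (\<Sum>i\<in>UNIV. \<Sum>\<alpha>\<in>support (f i). tpart p $ i * coeff_of (f i) \<alpha> *
        of_real (real_exponent \<alpha> \<bullet> v) * integrand (p + mellin_shift i \<alpha>) w)"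

lemma tube_line:
  assumes "\<delta> > 0" "ball \<theta> \<delta> \<subseteq> U" "norm \<zeta> < \<delta> / (norm v + 1)"
  shows "cvec x \<theta> + \<zeta> *s cplx v = cvec (x + Re \<zeta> *\<^sub>R v) (\<theta> + Im \<zeta> *\<^sub>R v)"
    "norm (Re \<zeta> *\<^sub>R v) < \<delta>" "norm (Im \<zeta> *\<^sub>R v) < \<delta>" "\<theta> + Im \<zeta> *\<^sub>R v \<in> ball \<theta> \<delta>"
    "cvec x \<theta> + \<zeta> *s cplx v \<in> tube U"
proof -
  show eq: "cvec x \<theta> + \<zeta> *s cplx v = cvec (x + Re \<zeta> *\<^sub>R v) (\<theta> + Im \<zeta> *\<^sub>R v)"
    by (simp add: cvec_def cplx_def vec_eq_iff complex_eq_iff)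
  have *: "norm (c *\<^sub>R v) < \<delta>" if "\<bar>c\<bar> \<le> norm \<zeta>" for c
  proof -
    have "norm (c *\<^sub>R v) \<le> norm \<zeta> * norm v" using that by (simp add: mult_right_mono)
    also have "\<dots> \<le> norm \<zeta> * (norm v + 1)" by (intro mult_left_mono) auto
    also have "\<dots> < \<delta>" using assms(3) by (simp add: pos_less_divide_eq add_nonneg_pos)
    finally show ?thesis .
  qed
  show r: "norm (Re \<zeta> *\<^sub>R v) < \<delta>" "norm (Im \<zeta> *\<^sub>R v) < \<delta>"
    by (intro * abs_Re_le_cmod abs_Im_le_cmod)+
  then show "\<theta> + Im \<zeta> *\<^sub>R v \<in> ball \<theta> \<delta>" by (simp add: dist_norm)
  then show "cvec x \<theta> + \<zeta> *s cplx v \<in> tube U" unfolding eq using assms(2) by auto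
qed

lemma mellin_integrand_line_derivative:
  assumes \<theta>: "\<theta> \<in> U"
  shows "((\<lambda>\<zeta>. integrand p (cvec x \<theta> + \<zeta> *s cplx v)) has_field_derivative
      log_derivative_integrand p v (cvec x \<theta>)) (at 0)"
proof -
  let ?w = "cvec x \<theta>"
  obtain \<delta> where \<delta>: "\<delta> > 0" "ball \<theta> \<delta> \<subseteq> U" using U \<theta> openE by blast
  define \<delta>' where "\<delta>' = \<delta> / (norm v + 1)"
  have \<delta>': "\<delta>' > 0" using \<delta> by (simp add: \<delta>'_def add_nonneg_pos)
  have tube: "?w + \<zeta> *s cplx v \<in> tube U" if "\<zeta> \<in> ball 0 \<delta>'" for \<zeta>
    using that by (intro tube_line[OF \<delta>]) (simp add: \<delta>'_def)
  define dl where "dl i = deriv (\<lambda>\<zeta>. l i (?w + \<zeta> *s cplx v)) 0" for i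
  have dl: "((\<lambda>\<zeta>. l i (?w + \<zeta> *s cplx v)) has_field_derivative dl i) (at 0)" for i
    unfolding dl_def
  proof (rule holomorphic_derivI)
    show "(\<lambda>\<zeta>. l i (?w + \<zeta> *s cplx v)) holomorphic_on ball 0 \<delta>'"
      using branch[of i] tube by (intro holomorphic_vec_on_line[of "l i" "tube U"]) (auto simp: log_branch_on_def)
  qed (use \<delta>' in auto)
  have dl_eq: "exp (l i ?w) * dl i = (\<Sum>\<alpha>\<in>support (f i). coeff_of (f i) \<alpha> *
      of_real (real_exponent \<alpha> \<bullet> v) * exp (cpair (cplx (real_exponent \<alpha>)) ?w))" for i
  proof -
    have "((\<lambda>\<zeta>. exp (l i (?w + \<zeta> *s cplx v))) has_field_derivative exp (l i (?w + 0 *s cplx v)) * dl i) (at 0)"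
      by (rule DERIV_fun_exp[OF dl])
    then have 1: "((\<lambda>\<zeta>. exp (l i (?w + \<zeta> *s cplx v))) has_field_derivative exp (l i ?w) * dl i) (at 0)" by simp
    have 2: "((\<lambda>\<zeta>. expsum (support (f i)) (coeff_of (f i)) real_exponent (?w + \<zeta> *s cplx v))
        has_field_derivative (\<Sum>\<alpha>\<in>support (f i). coeff_of (f i) \<alpha> *
        of_real (real_exponent \<alpha> \<bullet> v) * exp (cpair (cplx (real_exponent \<alpha>)) ?w))) (at 0)"
      unfolding expsum_cvec_add cpair_cplx
      by (auto intro!: derivative_eq_intros sum.cong)
    have 3: "((\<lambda>\<zeta>. expsum (support (f i)) (coeff_of (f i)) real_exponent (?w + \<zeta> *s cplx v))
        has_field_derivative exp (l i ?w) * dl i) (at 0)"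
    proof (rule has_field_derivative_transform_within_open[OF 1, of "ball 0 \<delta>'"])
      show "exp (l i (?w + \<zeta> *s cplx v)) = expsum (support (f i)) (coeff_of (f i)) real_exponent (?w + \<zeta> *s cplx v)"
        if "\<zeta> \<in> ball 0 \<delta>'" for \<zeta> using tube[OF that] by (rule exp_log_branch)
    qed (use \<delta>' in auto)
    show ?thesis by (rule DERIV_unique[OF 3 2])
  qed
  have rate: "((\<lambda>\<zeta>. cpair (mellin_exponent l (?w + \<zeta> *s cplx v)) p) has_field_derivative
     (cpair (spart p) (cplx v) - (\<Sum>i\<in>UNIV. tpart p $ i * dl i))) (at 0)"
  proof -
    have eq: "cpair (mellin_exponent l (?w + \<zeta> *s cplx v)) p = cpair (spart p) ?w + \<zeta> * cpair (spart p) (cplx v)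
        - (\<Sum>i\<in>UNIV. tpart p $ i * l i (?w + \<zeta> *s cplx v))" for \<zeta>
      unfolding cpair_scale_right[symmetric] cpair_add_right[symmetric]
      by (simp add: cpair_def mellin_exponent_def sum_UNIV_Plus spart_def tpart_def sum_negf mult.commute)
    show ?thesis unfolding eq
      by (rule derivative_eq_intros dl refl | simp add: mult.commute)+
  qed
  have "((\<lambda>\<zeta>. exp (cpair (mellin_exponent l (?w + \<zeta> *s cplx v)) p)) has_field_derivative
     exp (cpair (mellin_exponent l (?w + 0 *s cplx v)) p) * (cpair (spart p) (cplx v) - (\<Sum>i\<in>UNIV. tpart p $ i * dl i))) (at 0)"
    by (rule DERIV_fun_exp[OF rate])
  moreover have "exp (cpair (mellin_exponent l (?w + 0 *s cplx v)) p) * (cpair (spart p) (cplx v) - (\<Sum>i\<in>UNIV. tpart p $ i * dl i))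
     = log_derivative_integrand p v ?w"
  proof -
    have "tpart p $ i * dl i * integrand p ?w = (\<Sum>\<alpha>\<in>support (f i). tpart p $ i * coeff_of (f i) \<alpha> *
        of_real (real_exponent \<alpha> \<bullet> v) * integrand (p + mellin_shift i \<alpha>) ?w)" for i
    proof -
      have "dl i = (\<Sum>\<alpha>\<in>support (f i). coeff_of (f i) \<alpha> *
        of_real (real_exponent \<alpha> \<bullet> v) * exp (cpair (cplx (real_exponent \<alpha>)) ?w)) / exp (l i ?w)"
        using dl_eq[of i] by (simp add: field_simps)
      then show ?thesis
        by (simp add: euler_mellin_integrand_shift sum_distrib_left sum_distrib_right sum_divide_distrib mult_ac)
    qed
    then show ?thesis
      by (simp add: log_derivative_integrand_def euler_mellin_integrand_eq_exp[symmetric] right_diff_distrib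
          sum_distrib_left mult_ac)
  qed
  ultimately show ?thesis by (simp add: euler_mellin_integrand_eq_exp)
qed

text \<open>
  For real \<open>\<zeta>\<close> the integral does not depend on \<open>\<zeta>\<close>, by the translation invariance of Lebesgue measure.
  A complex derivative is determined by real increments, so it is zero.
\<close>

lemma euler_mellin_line:
  assumes p: "p \<in> convergence_domain f" and \<theta>: "\<theta> \<in> U"
  shows "((\<lambda>\<zeta>. \<integral>x. integrand p (cvec x \<theta> + \<zeta> *s cplx v) \<partial>lborel) has_field_derivative 0) (at 0)"
    and "(\<integral>x. log_derivative_integrand p v (cvec x \<theta>) \<partial>lborel) = 0"
proof -
  let ?H = "\<lambda>\<zeta>. \<integral>x. integrand p (cvec x \<theta> + \<zeta> *s cplx v) \<partial>lborel"
  obtain \<delta> C \<epsilon> where b: "\<delta> > 0" "C > 0" "\<epsilon> > 0" "ball \<theta> \<delta> \<subseteq> U" "ball p \<delta> \<subseteq> convergence_domain f"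
    "\<forall>q\<in>ball p \<delta>. \<forall>\<theta>'\<in>ball \<theta> \<delta>. \<forall>x.
       norm (integrand q (cvec x \<theta>')) \<le> C * exp (- \<epsilon> * norm x)"
    by (rule mellin_integrand_bound[OF assms])
  \<comment> \<open>translations by \<open>\<zeta> v\<close> with \<open>|\<zeta>| < \<delta>'\<close> have length less than \<open>\<delta>\<close>; adding \<open>1\<close> allows for \<open>v = 0\<close>\<close>
  define \<delta>' where "\<delta>' = \<delta> / (norm v + 1)"
  have \<delta>': "\<delta>' > 0" using b by (simp add: \<delta>'_def add_nonneg_pos)
  note line = tube_line[OF b(1) b(4), where v = v, folded \<delta>'_def]
  have cont: "continuous_on UNIV (\<lambda>x. integrand q (cvec x \<theta>'))" if "\<theta>' \<in> U" for q \<theta>'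
    by (rule continuous_on_mellin_integrand(1)[OF that])
  have H: "(?H has_field_derivative (\<integral>x. log_derivative_integrand p v (cvec x \<theta>) \<partial>lborel)) (at 0)"
  proof (rule has_field_derivative_integral_holomorphic_family[OF _ \<delta>'])
    show "(\<lambda>\<zeta>. integrand p (cvec x \<theta> + \<zeta> *s cplx v)) holomorphic_on ball 0 \<delta>'" for x
      unfolding euler_mellin_integrand_eq_exp cpair_def
    proof (intro holomorphic_intros)
      fix k :: "'n + 'm"
      show "(\<lambda>\<zeta>. mellin_exponent l (cvec x \<theta> + \<zeta> *s cplx v) $ k) holomorphic_on ball 0 \<delta>'"
      proof (cases k)
        case (Inl j)
        then show ?thesis by (auto simp: mellin_exponent_def intro!: holomorphic_intros)
      next
        case (Inr i)
        have "(\<lambda>\<zeta>. l i (cvec x \<theta> + \<zeta> *s cplx v)) holomorphic_on ball 0 \<delta>'"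
          using branch[of i] line(5) by (intro holomorphic_vec_on_line[of "l i" "tube U"]) (auto simp: log_branch_on_def)
        then show ?thesis using Inr by (auto simp: mellin_exponent_def intro!: holomorphic_intros)
      qed
    qed
    show "norm (integrand p (cvec x \<theta> + \<zeta> *s cplx v)) \<le> C * exp (\<epsilon> * \<delta>) * exp (- \<epsilon> * norm x)"
      if "\<zeta> \<in> ball 0 \<delta>'" for x \<zeta>
    proof -
      have z: "norm \<zeta> < \<delta>'" using that by simp
      have "norm (integrand p (cvec x \<theta> + \<zeta> *s cplx v)) \<le> C * exp (- \<epsilon> * norm (x + Re \<zeta> *\<^sub>R v))"
        unfolding line(1)[OF z] using b(6) line(4)[OF z] b(1) by auto
      also have "\<dots> \<le> C * exp (\<epsilon> * \<delta> + - \<epsilon> * norm x)"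
      proof -
        have "norm x \<le> norm (x + Re \<zeta> *\<^sub>R v) + norm (Re \<zeta> *\<^sub>R v)"
          using norm_triangle_sub[of x "x + Re \<zeta> *\<^sub>R v"] by simp
        then have "norm x \<le> norm (x + Re \<zeta> *\<^sub>R v) + \<delta>" using line(2)[OF z] by linarith
        then have "\<epsilon> * norm x \<le> \<epsilon> * (norm (x + Re \<zeta> *\<^sub>R v) + \<delta>)" using b(3) by (intro mult_left_mono) auto
        then show ?thesis using b(2) by (simp add: distrib_left)
      qed
      finally show ?thesis by (simp only: exp_add mult.assoc)
    qed
    show "integrable lborel (\<lambda>x::real ^ 'n. C * exp (\<epsilon> * \<delta>) * exp (- \<epsilon> * norm x))"
      by (intro integrable_mult_right integrable_exp_neg_norm b)
    show "(\<lambda>x. integrand p (cvec x \<theta> + \<zeta> *s cplx v)) \<in> borel_measurable lborel"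
      if "\<zeta> \<in> ball 0 \<delta>'" for \<zeta>
    proof -
      have z: "norm \<zeta> < \<delta>'" using that by simp
      have "\<theta> + Im \<zeta> *\<^sub>R v \<in> U" using line(4)[OF z] b(4) by blast
      then have "continuous_on UNIV (\<lambda>x. integrand p (cvec (x + Re \<zeta> *\<^sub>R v) (\<theta> + Im \<zeta> *\<^sub>R v)))"
        by (intro continuous_on_compose2[OF cont]) (auto intro!: continuous_intros)
      then show ?thesis unfolding line(1)[OF z] using borel_measurable_continuous_onI by simp
    qed
    have "continuous_on UNIV (\<lambda>x. log_derivative_integrand p v (cvec x \<theta>))"
      unfolding log_derivative_integrand_def by (intro continuous_intros cont \<theta>)
    then show "(\<lambda>x. log_derivative_integrand p v (cvec x \<theta>)) \<in> borel_measurable lborel"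
      using borel_measurable_continuous_onI by simp
    show "((\<lambda>\<zeta>. integrand p (cvec x \<theta> + \<zeta> *s cplx v)) has_field_derivative
        log_derivative_integrand p v (cvec x \<theta>)) (at 0)" for x
      by (rule mellin_integrand_line_derivative[OF \<theta>])
  qed
  have "?H (of_real r) = ?H 0" for r
  proof -
    have "cvec x \<theta> + of_real r *s cplx v = cvec (x + r *\<^sub>R v) \<theta>" for x
      by (simp add: cvec_def cplx_def vec_eq_iff complex_eq_iff)
    then show ?thesis
      using integral_lborel_translation[OF borel_measurable_continuous_onI[OF cont[OF \<theta>, of p]], of "r *\<^sub>R v"] by simp
  qed
  then show "(\<integral>x. log_derivative_integrand p v (cvec x \<theta>) \<partial>lborel) = 0"
    by (rule field_derivative_eq_0[OF H])
  with H show "(?H has_field_derivative 0) (at 0)" by simp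
qed

lemma euler_mellin_recursion:
  assumes p: "p \<in> convergence_domain f" and \<theta>: "\<theta> \<in> U"
  shows "cpair (spart p) (cplx v) * euler_mellin l \<theta> p =
    (\<Sum>i\<in>UNIV. \<Sum>\<alpha>\<in>support (f i). tpart p $ i * coeff_of (f i) \<alpha> *
        of_real (real_exponent \<alpha> \<bullet> v) * euler_mellin l \<theta> (p + mellin_shift i \<alpha>))"
proof -
  have "0 = (\<integral>x. log_derivative_integrand p v (cvec x \<theta>) \<partial>lborel)"
    using euler_mellin_line(2)[OF assms] by simp
  also have "\<dots> = cpair (spart p) (cplx v) * euler_mellin l \<theta> p -
    (\<Sum>i\<in>UNIV. \<Sum>\<alpha>\<in>support (f i). tpart p $ i * coeff_of (f i) \<alpha> *
        of_real (real_exponent \<alpha> \<bullet> v) * euler_mellin l \<theta> (p + mellin_shift i \<alpha>))"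
    unfolding log_derivative_integrand_def euler_mellin_def using p \<theta>
    by (subst Bochner_Integration.integral_diff Bochner_Integration.integral_sum,
        auto intro!: integrable_mult_right integrable_mellin_integrand shift_mem_convergence_domain
          Bochner_Integration.integrable_sum)+
  finally show ?thesis by simp
qed

text \<open>
  Moving \<open>\<theta>\<close> along the segment from \<open>\<theta>\<^sub>0\<close> is an imaginary translation of the contour, so the derivative
  along the segment is zero by \<open>euler_mellin_line\<close>.
\<close>

lemma euler_mellin_locally_constant:
  assumes ball: "ball \<theta>0 r \<subseteq> U" and \<theta>: "\<theta> \<in> ball \<theta>0 r" and p: "p \<in> convergence_domain f"
  shows "euler_mellin l \<theta> p = euler_mellin l \<theta>0 p"
proof -
  define v where "v = \<theta> - \<theta>0"
  define K where "K b = euler_mellin l (\<theta>0 + b *\<^sub>R v) p" for b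
  have "(K has_derivative (\<lambda>h. 0)) (at b within {0..1})" if b: "b \<in> {0..1}" for b
  proof -
    have "norm (b *\<^sub>R v) \<le> norm v" using b by (simp add: mult_left_le_one_le)
    also have "norm v < r" using \<theta> by (simp add: v_def dist_norm norm_minus_commute)
    finally have "\<theta>0 + b *\<^sub>R v \<in> U" using ball by (auto simp: dist_norm)
    from euler_mellin_line(1)[OF p this, of v]
    have "((\<lambda>\<zeta>. \<integral>x. integrand p (cvec x (\<theta>0 + b *\<^sub>R v) + \<zeta> *s cplx v) \<partial>lborel) has_derivative (\<lambda>h. 0)) (at (\<i> * of_real (b - b)))"
      by (simp add: has_field_derivative_def lambda_zero)
    moreover have "((\<lambda>c. \<i> * of_real (c - b)) has_derivative (\<lambda>h. \<i> * of_real h)) (at b)"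
      by (auto intro!: derivative_eq_intros)
    ultimately have "((\<lambda>c. \<integral>x. integrand p (cvec x (\<theta>0 + b *\<^sub>R v) + (\<i> * of_real (c - b)) *s cplx v) \<partial>lborel)
        has_derivative (\<lambda>h. 0)) (at b)"
      by (rule has_derivative_compose[rotated])
    moreover have "cvec x (\<theta>0 + b *\<^sub>R v) + (\<i> * of_real (c - b)) *s cplx v = cvec x (\<theta>0 + c *\<^sub>R v)" for x c
      by (simp add: cvec_def cplx_def vec_eq_iff complex_eq_iff algebra_simps)
    ultimately have "(K has_derivative (\<lambda>h. 0)) (at b)" by (simp add: K_def[abs_def] euler_mellin_def)
    then show ?thesis by (rule has_derivative_at_withinI)
  qed
  then obtain c where "\<And>b. b \<in> {0..1} \<Longrightarrow> K b = c"
    using has_derivative_zero_constant[of "{0..1::real}" K] by auto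
  then have "K 1 = K 0" by simp
  then show ?thesis by (simp add: K_def v_def)
qed

end

section \<open>Entire continuation by recurrences\<close>

lemma holomorphic_vec_on_subset: "holomorphic_vec_on F V \<Longrightarrow> U \<subseteq> V \<Longrightarrow> holomorphic_vec_on F U"
  by (auto simp: holomorphic_vec_on_def)

lemma holomorphic_vec_on_const: "holomorphic_vec_on (\<lambda>_. c) U"
  unfolding holomorphic_vec_on_def by (auto intro!: exI[of _ "\<lambda>_. 0"])

lemma holomorphic_vec_on_add:
  assumes "holomorphic_vec_on F U" "holomorphic_vec_on G U"
  shows "holomorphic_vec_on (\<lambda>p. F p + G p) U"
  unfolding holomorphic_vec_on_def
proof
  fix p assume "p \<in> U"
  then obtain D E where D: "(F has_derivative D) (at p)" "\<forall>c v. D (c *s v) = c * D v"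
    and E: "(G has_derivative E) (at p)" "\<forall>c v. E (c *s v) = c * E v"
    using assms unfolding holomorphic_vec_on_def by meson
  show "\<exists>D. ((\<lambda>p. F p + G p) has_derivative D) (at p) \<and> (\<forall>c v. D (c *s v) = c * D v)"
    using has_derivative_add[OF D(1) E(1)] D(2) E(2)
    by (intro exI[of _ "\<lambda>v. D v + E v"]) (simp add: distrib_left)
qed

lemma holomorphic_vec_on_sum:
  assumes "\<And>i. i \<in> I \<Longrightarrow> holomorphic_vec_on (F i) U"
  shows "holomorphic_vec_on (\<lambda>p. \<Sum>i\<in>I. F i p) U"
  using assms
  by (induction I rule: infinite_finite_induct) (simp_all add: holomorphic_vec_on_const holomorphic_vec_on_add)

lemma holomorphic_vec_on_mult:
  assumes "holomorphic_vec_on F U" "holomorphic_vec_on G U"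
  shows "holomorphic_vec_on (\<lambda>p. F p * G p) U"
  unfolding holomorphic_vec_on_def
proof
  fix p assume "p \<in> U"
  then obtain D E where D: "(F has_derivative D) (at p)" "\<forall>c v. D (c *s v) = c * D v"
    and E: "(G has_derivative E) (at p)" "\<forall>c v. E (c *s v) = c * E v"
    using assms unfolding holomorphic_vec_on_def by meson
  show "\<exists>D. ((\<lambda>p. F p * G p) has_derivative D) (at p) \<and> (\<forall>c v. D (c *s v) = c * D v)"
    using has_derivative_mult[OF D(1) E(1)] D(2) E(2)
    by (intro exI[of _ "\<lambda>v. F p * E v + D v * G p"]) (simp add: algebra_simps)
qed

lemma holomorphic_vec_on_prod:
  assumes "\<And>i. i \<in> I \<Longrightarrow> holomorphic_vec_on (F i) U"
  shows "holomorphic_vec_on (\<lambda>p. \<Prod>i\<in>I. F i p) U"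
  using assms
  by (induction I rule: infinite_finite_induct) (simp_all add: holomorphic_vec_on_const holomorphic_vec_on_mult)

lemma holomorphic_vec_on_compose:
  assumes F: "holomorphic_vec_on F U" and g: "g holomorphic_on UNIV"
  shows "holomorphic_vec_on (\<lambda>p. g (F p)) U"
  unfolding holomorphic_vec_on_def
proof
  fix p assume "p \<in> U"
  then obtain D where D: "(F has_derivative D) (at p)" "\<forall>c v. D (c *s v) = c * D v"
    using F unfolding holomorphic_vec_on_def by meson
  have "(g has_derivative (*) (deriv g (F p))) (at (F p))"
    using holomorphic_derivI[OF g] by (simp add: has_field_derivative_def)
  then have "((\<lambda>p. g (F p)) has_derivative (\<lambda>v. deriv g (F p) * D v)) (at p)"
    by (rule has_derivative_compose[OF D(1)])
  then show "\<exists>D. ((\<lambda>p. g (F p)) has_derivative D) (at p) \<and> (\<forall>c v. D (c *s v) = c * D v)"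
    using D(2) by (intro exI[of _ "\<lambda>v. deriv g (F p) * D v"]) (simp add: mult_ac)
qed

lemma holomorphic_vec_on_translate:
  assumes F: "holomorphic_vec_on F V" and "\<And>p. p \<in> U \<Longrightarrow> p + v \<in> V"
  shows "holomorphic_vec_on (\<lambda>p. F (p + v)) U"
  unfolding holomorphic_vec_on_def
proof
  fix p assume "p \<in> U"
  then obtain D where D: "(F has_derivative D) (at (p + v))" "\<forall>c u. D (c *s u) = c * D u"
    using assms unfolding holomorphic_vec_on_def by meson
  have "((\<lambda>p. p + v) has_derivative (\<lambda>h. h)) (at p)" by (auto intro!: derivative_eq_intros)
  then have "((\<lambda>p. F (p + v)) has_derivative (\<lambda>h. D h)) (at p)"
    by (rule has_derivative_compose[of _ _ _ _ F D]) (rule D(1))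
  then show "\<exists>D. ((\<lambda>p. F (p + v)) has_derivative D) (at p) \<and> (\<forall>c u. D (c *s u) = c * D u)"
    using D(2) by blast
qed

lemma holomorphic_vec_on_linear:
  assumes "\<And>u v. L (u + v) = L u + L v" "\<And>c v. L (c *s v) = c * L v"
  shows "holomorphic_vec_on L U"
proof -
  have "linear L"
  proof (rule linearI)
    show "L (r *\<^sub>R v) = r *\<^sub>R L v" for r v
      unfolding scaleR_eq_scalar_mult[of r v] assms(2) by (simp add: scaleR_conv_of_real)
  qed (rule assms)
  then have "(L has_derivative L) (at p)" for p
    by (intro bounded_linear_imp_has_derivative) (simp add: linear_conv_bounded_linear)
  then show ?thesis unfolding holomorphic_vec_on_def using assms(2) by blast
qed

text \<open>
  The functions are compared on the complex line through a point of \<open>S\<close> and the given point. It meets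
  \<open>U\<close> in a convex set.
\<close>

lemma holomorphic_vec_identity:
  assumes U: "open U" "convex U" and F: "holomorphic_vec_on F U" and G: "holomorphic_vec_on G U"
    and S: "open S" "S \<noteq> {}" "S \<subseteq> U" and eq: "\<And>p. p \<in> S \<Longrightarrow> F p = G p" and p: "p \<in> U"
  shows "F p = G p"
proof -
  obtain p0 where p0: "p0 \<in> S" using S(2) by blast
  define m where "m = (\<lambda>\<zeta>. p0 + \<zeta> *s (p - p0))"
  have lin: "linear (\<lambda>\<zeta>. \<zeta> *s (p - p0))"
    by (rule linearI) (simp_all add: vec_eq_iff algebra_simps)
  have cont: "continuous_on UNIV m"
    unfolding m_def using lin by (intro continuous_intros linear_continuous_on) (simp add: linear_conv_bounded_linear)
  have op: "open (m -` V)" if "open V" for V using open_vimage[OF that cont] .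
  have "convex (m -` U)"
  proof -
    have "m -` U = (\<lambda>\<zeta>. \<zeta> *s (p - p0)) -` ((+) (- p0) ` U)"
    proof (intro set_eqI iffI)
      fix \<zeta> assume "\<zeta> \<in> m -` U"
      then show "\<zeta> \<in> (\<lambda>\<zeta>. \<zeta> *s (p - p0)) -` ((+) (- p0) ` U)"
        by (auto simp: m_def intro!: image_eqI[of _ _ "p0 + \<zeta> *s (p - p0)"])
    qed (auto simp: m_def)
    then show ?thesis using U(2) by (simp only: convex_linear_vimage[OF lin] convex_translation)
  qed
  then have conn: "connected (m -` U)" by (rule convex_connected)
  have hol: "(\<lambda>\<zeta>. H (m \<zeta>)) holomorphic_on m -` U" if H: "holomorphic_vec_on H U" for H
    unfolding m_def
  proof (rule holomorphic_vec_on_line[OF H])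
    show "open ((\<lambda>\<zeta>. p0 + \<zeta> *s (p - p0)) -` U)" using op[OF U(1)] unfolding m_def .
  qed simp
  have "F (m 1) = G (m 1)"
  proof (rule analytic_continuation_open[of "m -` S" "m -` U" "\<lambda>\<zeta>. F (m \<zeta>)" "\<lambda>\<zeta>. G (m \<zeta>)"])
    have "0 \<in> m -` S" using p0 by (simp add: m_def)
    then show "m -` S \<noteq> {}" by blast
    show "1 \<in> m -` U" using p by (simp add: m_def)
  qed (use op S U conn hol[OF F] hol[OF G] eq in auto)
  then show ?thesis by (simp add: m_def)
qed

text \<open>
  The right-hand side of a recurrence for \<open>c\<close> is defined on a domain on which the bound for \<open>L c\<close> is
  lower by \<open>1\<close>, and agrees with \<open>\<Phi>\<close> on \<open>D\<close>. Starting from \<open>D\<close>, all bounds can be lowered in this way. The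
  resulting functions fit together by the identity theorem, since the domains are convex and contain the
  nonempty open set \<open>D\<close>.
\<close>

lemma entire_continuation_by_recurrences:
  fixes L :: "'c \<Rightarrow> complex ^ 'k::finite \<Rightarrow> real" and \<Phi> :: "complex ^ 'k \<Rightarrow> complex"
    and C :: "'c set" and J :: "'c \<Rightarrow> 'j set"
  defines "D \<equiv> {p. \<forall>c\<in>C. L c p > 0}"
  assumes C: "finite C" and L: "\<And>c. c \<in> C \<Longrightarrow> linear (L c)" and ne: "D \<noteq> {}"
    and \<Phi>: "holomorphic_vec_on \<Phi> D"
    and P: "\<And>c j. c \<in> C \<Longrightarrow> j \<in> J c \<Longrightarrow> holomorphic_vec_on (P c j) UNIV"
    and up: "\<And>c j. c \<in> C \<Longrightarrow> j \<in> J c \<Longrightarrow> L c (v c j) \<ge> 1"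
    and nonneg: "\<And>c j c'. c \<in> C \<Longrightarrow> j \<in> J c \<Longrightarrow> c' \<in> C \<Longrightarrow> L c' (v c j) \<ge> 0"
    and rec: "\<And>c p. c \<in> C \<Longrightarrow> p \<in> D \<Longrightarrow> \<Phi> p = (\<Sum>j\<in>J c. P c j p * \<Phi> (p + v c j))"
  shows "\<exists>\<Psi>. holomorphic_vec_on \<Psi> UNIV \<and> (\<forall>p\<in>D. \<Psi> p = \<Phi> p)"
proof -
  define \<Omega> where "\<Omega> a = {p. \<forall>c\<in>C. L c p > - real (a c)}" for a :: "'c \<Rightarrow> nat"
  have \<Omega>: "open (\<Omega> a)" "convex (\<Omega> a)" "D \<subseteq> \<Omega> a" for a
  proof -
    have eq: "\<Omega> a = (\<Inter>c\<in>C. L c -` {- real (a c)<..})" by (auto simp: \<Omega>_def)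
    have "open (L c -` {- real (a c)<..})" if "c \<in> C" for c
      by (rule open_vimage) (use L[OF that] in \<open>simp_all add: linear_continuous_on linear_conv_bounded_linear\<close>)
    then show "open (\<Omega> a)" unfolding eq using C by (intro open_INT) auto
    show "convex (\<Omega> a)" unfolding eq by (intro convex_INT convex_linear_vimage L) auto
    show "D \<subseteq> \<Omega> a" unfolding \<Omega>_def D_def
      by (auto intro: le_less_trans[of _ 0])
  qed
  have D: "D = \<Omega> (\<lambda>_. 0)" by (simp add: \<Omega>_def D_def)
  have ext: "\<exists>\<Psi>. holomorphic_vec_on \<Psi> (\<Omega> a) \<and> (\<forall>p\<in>D. \<Psi> p = \<Phi> p)" for a
  proof (induction "\<Sum>c\<in>C. a c" arbitrary: a)
    case 0
    then have "\<Omega> a = D" using C by (simp add: \<Omega>_def D_def)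
    then show ?case using \<Phi> by auto
  next
    case (Suc n)
    then have "\<exists>c\<in>C. a c > 0" by (metis bot_nat_0.not_eq_extremum nat.distinct(1) sum.neutral)
    then obtain c where c: "c \<in> C" "a c > 0" by blast
    define b where "b = a(c := a c - 1)"
    have "(\<Sum>c\<in>C. a c) = Suc (\<Sum>c\<in>C. b c)"
    proof -
      have "(\<Sum>c\<in>C. a c) = a c + (\<Sum>c\<in>C - {c}. a c)" "(\<Sum>c\<in>C. b c) = b c + (\<Sum>c\<in>C - {c}. b c)"
        using C c by (simp_all add: sum.remove)
      moreover have "(\<Sum>c\<in>C - {c}. b c) = (\<Sum>c\<in>C - {c}. a c)" by (intro sum.cong) (auto simp: b_def)
      ultimately show ?thesis using c by (simp add: b_def)
    qed
    then have "n = (\<Sum>c\<in>C. b c)" using Suc.hyps(2) by simp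
    then obtain \<Psi> where \<Psi>: "holomorphic_vec_on \<Psi> (\<Omega> b)" "\<And>p. p \<in> D \<Longrightarrow> \<Psi> p = \<Phi> p"
      using Suc.hyps(1) by blast
    define \<Psi>' where "\<Psi>' p = (\<Sum>j\<in>J c. P c j p * \<Psi> (p + v c j))" for p
    have "p + v c j \<in> \<Omega> b" if p: "p \<in> \<Omega> a" and j: "j \<in> J c" for p j
      unfolding \<Omega>_def
    proof (intro CollectI ballI)
      fix c' assume c': "c' \<in> C"
      have pc: "L c' p > - real (a c')" using p c' by (simp add: \<Omega>_def)
      have lin: "L c' (p + v c j) = L c' p + L c' (v c j)" using linear_add[OF L[OF c']] .
      show "L c' (p + v c j) > - real (b c')"
      proof (cases "c' = c")
        case True
        then show ?thesis using pc lin up[OF c(1) j] c(2) by (simp add: b_def of_nat_diff)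
      next
        case False
        then show ?thesis using pc nonneg[OF c(1) j c'] by (simp add: lin b_def)
      qed
    qed
    then have "holomorphic_vec_on \<Psi>' (\<Omega> a)"
      unfolding \<Psi>'_def[abs_def]
      by (intro holomorphic_vec_on_sum holomorphic_vec_on_mult holomorphic_vec_on_translate[OF \<Psi>(1)]
          holomorphic_vec_on_subset[OF P[OF c(1)]]) auto
    moreover have "\<Psi>' p = \<Phi> p" if p: "p \<in> D" for p
    proof -
      have "p + v c j \<in> D" if "j \<in> J c" for j
        using p nonneg[OF c(1) that] by (auto simp: D_def linear_add[OF L] intro!: add_pos_nonneg)
      then show ?thesis unfolding \<Psi>'_def rec[OF c(1) p] by (intro sum.cong) (auto simp: \<Psi>(2))
    qed
    ultimately show ?case by blast
  qed
  then have "\<forall>N. \<exists>\<Psi>. holomorphic_vec_on \<Psi> (\<Omega> (\<lambda>_. N)) \<and> (\<forall>p\<in>D. \<Psi> p = \<Phi> p)" by blast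
  then obtain \<Psi> where \<Psi>: "\<And>N. holomorphic_vec_on (\<Psi> N) (\<Omega> (\<lambda>_. N))" "\<And>N p. p \<in> D \<Longrightarrow> \<Psi> N p = \<Phi> p"
    by metis
  have mono: "\<Omega> (\<lambda>_. N) \<subseteq> \<Omega> (\<lambda>_. N')" if "N \<le> N'" for N N'
    using that unfolding \<Omega>_def by (auto intro: le_less_trans[of _ "- real N"])
  have cons: "\<Psi> N p = \<Psi> N' p" if "N \<le> N'" "p \<in> \<Omega> (\<lambda>_. N)" for N N' p
  proof (rule holomorphic_vec_identity[OF \<Omega>(1,2) \<Psi>(1) _ _ ne \<Omega>(3) _ that(2)])
    show "holomorphic_vec_on (\<Psi> N') (\<Omega> (\<lambda>_. N))"
      by (rule holomorphic_vec_on_subset[OF \<Psi>(1) mono[OF that(1)]])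
    show "open D" unfolding D by (rule \<Omega>(1))
  qed (simp add: \<Psi>(2))
  have cover: "\<exists>N. p \<in> \<Omega> (\<lambda>_. N)" for p
  proof -
    obtain N :: nat where N: "(\<Sum>c\<in>C. \<bar>L c p\<bar>) < real N" using reals_Archimedean2 by blast
    have "L c p > - real N" if "c \<in> C" for c
    proof -
      have "\<bar>L c p\<bar> \<le> (\<Sum>c\<in>C. \<bar>L c p\<bar>)" using C that by (intro member_le_sum) auto
      then show ?thesis using N by linarith
    qed
    then show ?thesis by (auto simp: \<Omega>_def)
  qed
  define N where "N p = (LEAST N. p \<in> \<Omega> (\<lambda>_. N))" for p
  have N: "p \<in> \<Omega> (\<lambda>_. N p)" for p unfolding N_def using cover by (rule LeastI_ex)
  define X where "X p = \<Psi> (N p) p" for p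
  have X: "X q = \<Psi> M q" if "q \<in> \<Omega> (\<lambda>_. M)" for q M
  proof -
    have "N q \<le> M" unfolding N_def using that by (rule Least_le)
    then show ?thesis unfolding X_def using cons N by blast
  qed
  have "holomorphic_vec_on X UNIV"
    unfolding holomorphic_vec_on_def
  proof
    fix p
    obtain D' where D': "(\<Psi> (N p) has_derivative D') (at p)" "\<forall>c v. D' (c *s v) = c * D' v"
      using \<Psi>(1)[of "N p"] N[of p] unfolding holomorphic_vec_on_def by meson
    have "(X has_derivative D') (at p)"
      by (rule has_derivative_transform_within_open[OF D'(1) \<Omega>(1) N]) (simp add: X)
    then show "\<exists>D. (X has_derivative D) (at p) \<and> (\<forall>c v. D (c *s v) = c * D v)" using D'(2) by blast
  qed
  moreover have "X p = \<Phi> p" if "p \<in> D" for p unfolding X_def by (rule \<Psi>(2)[OF that])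
  ultimately show ?thesis by blast
qed

section \<open>The entire factor\<close>

lemma holomorphic_gamma_arg: "holomorphic_vec_on (gamma_arg f \<mu>) U"
  by (intro holomorphic_vec_on_linear gamma_arg_add gamma_arg_scale)

context log_branches
begin

abbreviation recip_gamma :: "complex ^ ('n + 'm) \<Rightarrow> complex" where
  "recip_gamma p \<equiv> \<Prod>\<mu>\<in>normals. rGamma (gamma_arg f \<mu> p)"

abbreviation shift_factor :: "'m \<Rightarrow> nat ^ 'n \<Rightarrow> complex ^ ('n + 'm) \<Rightarrow> complex" where
  "shift_factor i \<alpha> p \<equiv> \<Prod>\<mu>\<in>normals. pochhammer (gamma_arg f \<mu> p) (facet_height f \<mu> i \<alpha>)"

lemma convergence_domain_nonempty: "convergence_domain f \<noteq> {}"
proof -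
  obtain \<sigma> where \<sigma>: "\<sigma> \<in> interior (wsum (\<lambda>i. newton_polytope (f i)) (\<lambda>_. 1))"
    using interior_weighted_newton_sum_nonempty(1)[OF full_dim, of "\<lambda>_. 1"] by auto
  define p :: "complex ^ ('n + 'm)" where "p = (\<chi> k. case k of Inl j \<Rightarrow> of_real (\<sigma> $ j) | Inr i \<Rightarrow> 1)"
  have "p \<in> convergence_domain f"
    using \<sigma> unfolding convergence_domain_def weighted_newton_sum_eq vec_lambda_beta
    by (simp add: p_def spart_def tpart_def)
  then show ?thesis by blast
qed

definition regularized_mellin :: "real ^ 'n \<Rightarrow> complex ^ ('n + 'm) \<Rightarrow> complex" where
  "regularized_mellin \<theta> p = euler_mellin l \<theta> p * recip_gamma p"

lemma holomorphic_prod_rGamma: "holomorphic_vec_on recip_gamma V"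
  by (intro holomorphic_vec_on_prod holomorphic_vec_on_compose[OF holomorphic_gamma_arg] holomorphic_rGamma)

text \<open>
  A shift raises every gamma argument by a natural number, so that the reciprocal gamma functions change by
  polynomial factors.
\<close>

lemma prod_rGamma_shift:
  assumes "\<alpha> \<in> support (f i)" "M \<subseteq> normals"
  shows "(\<Prod>\<mu>\<in>M. rGamma (gamma_arg f \<mu> p)) = (\<Prod>\<mu>\<in>M. pochhammer (gamma_arg f \<mu> p) (facet_height f \<mu> i \<alpha>)) *
    (\<Prod>\<mu>\<in>M. rGamma (gamma_arg f \<mu> (p + mellin_shift i \<alpha>)))"
  unfolding prod.distrib[symmetric]
  by (intro prod.cong refl) (simp only: gamma_arg_add gamma_arg_shift[OF assms(1)] pochhammer_rGamma[symmetric])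

lemma holomorphic_pochhammer: "(\<lambda>z. pochhammer (z + c) n) holomorphic_on (A :: complex set)"
  unfolding pochhammer_prod by (intro holomorphic_intros)

lemma regularized_mellin_expand:
  assumes p: "p \<in> convergence_domain f" and \<theta>: "\<theta> \<in> U"
  shows "regularized_mellin \<theta> p = (\<Sum>\<alpha>\<in>support (f i). (coeff_of (f i) \<alpha> *
     shift_factor i \<alpha> p) * regularized_mellin \<theta> (p + mellin_shift i \<alpha>))"
proof -
  have "regularized_mellin \<theta> p = (\<Sum>\<alpha>\<in>support (f i). coeff_of (f i) \<alpha> * euler_mellin l \<theta> (p + mellin_shift i \<alpha>)
     * recip_gamma p)"
    unfolding regularized_mellin_def by (subst euler_mellin_expand[OF assms, of i]) (rule sum_distrib_right)
  also have "\<dots> = (\<Sum>\<alpha>\<in>support (f i). (coeff_of (f i) \<alpha> *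
     shift_factor i \<alpha> p) * regularized_mellin \<theta> (p + mellin_shift i \<alpha>))"
  proof (intro sum.cong refl)
    fix \<alpha> assume \<alpha>: "\<alpha> \<in> support (f i)"
    show "coeff_of (f i) \<alpha> * euler_mellin l \<theta> (p + mellin_shift i \<alpha>) * recip_gamma p
      = (coeff_of (f i) \<alpha> * shift_factor i \<alpha> p) *
        regularized_mellin \<theta> (p + mellin_shift i \<alpha>)"
      unfolding prod_rGamma_shift[OF \<alpha> subset_refl, of p] regularized_mellin_def by (simp only: mult_ac)
  qed
  finally show ?thesis .
qed

text \<open>
  The recursion for the direction \<open>\<mu>\<close>, from which the expansion of \<open>1 = f\<^sub>i / f\<^sub>i\<close>, multiplied by
  \<open>\<nu>\<^sup>i t\<^sub>i\<close>, has been subtracted for every \<open>i\<close>. The monomials on the facet have coefficient zero.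
\<close>

lemma euler_mellin_facet_recursion:
  assumes p: "p \<in> convergence_domain f" and \<theta>: "\<theta> \<in> U"
  shows "gamma_arg f \<mu> p * euler_mellin l \<theta> p = (\<Sum>i\<in>UNIV. \<Sum>\<alpha>\<in>support (f i).
     tpart p $ i * coeff_of (f i) \<alpha> * of_nat (facet_height f \<mu> i \<alpha>) * euler_mellin l \<theta> (p + mellin_shift i \<alpha>))"
proof -
  have ip: "ipair \<mu> (spart p) = cpair (spart p) (cplx (real_int \<mu>))"
    by (simp add: ipair_def cpair_def cplx_def real_int_def mult.commute)
  have support_term: "of_real (support_min (f i) \<mu>) * tpart p $ i * euler_mellin l \<theta> p = (\<Sum>\<alpha>\<in>support (f i).
     tpart p $ i * coeff_of (f i) \<alpha> * of_real (support_min (f i) \<mu>) * euler_mellin l \<theta> (p + mellin_shift i \<alpha>))" for i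
    by (subst euler_mellin_expand[OF assms, of i]) (simp add: sum_distrib_left mult_ac)
  have "gamma_arg f \<mu> p * euler_mellin l \<theta> p = cpair (spart p) (cplx (real_int \<mu>)) * euler_mellin l \<theta> p
      - (\<Sum>i\<in>UNIV. of_real (support_min (f i) \<mu>) * tpart p $ i * euler_mellin l \<theta> p)"
    by (simp add: gamma_arg_def ip left_diff_distrib sum_distrib_right)
  also have "\<dots> = (\<Sum>i\<in>UNIV. \<Sum>\<alpha>\<in>support (f i). tpart p $ i * coeff_of (f i) \<alpha> *
        of_real (real_exponent \<alpha> \<bullet> real_int \<mu>) * euler_mellin l \<theta> (p + mellin_shift i \<alpha>)
      - tpart p $ i * coeff_of (f i) \<alpha> * of_real (support_min (f i) \<mu>) * euler_mellin l \<theta> (p + mellin_shift i \<alpha>))"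
    unfolding euler_mellin_recursion[OF assms] support_term by (simp only: sum_subtractf)
  also have "\<dots> = (\<Sum>i\<in>UNIV. \<Sum>\<alpha>\<in>support (f i).
     tpart p $ i * coeff_of (f i) \<alpha> * of_nat (facet_height f \<mu> i \<alpha>) * euler_mellin l \<theta> (p + mellin_shift i \<alpha>))"
  proof (intro sum.cong refl)
    fix i \<alpha> assume "\<alpha> \<in> support (f i)"
    then have "complex_of_real (real_exponent \<alpha> \<bullet> real_int \<mu>) =
        of_nat (facet_height f \<mu> i \<alpha>) + of_real (support_min (f i) \<mu>)"
      using facet_height[of \<alpha> i \<mu>] by (metis (no_types) diff_add_cancel inner_commute of_real_add of_real_of_nat_eq)
    then show "tpart p $ i * coeff_of (f i) \<alpha> * of_real (real_exponent \<alpha> \<bullet> real_int \<mu>) * euler_mellin l \<theta> (p + mellin_shift i \<alpha>)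
      - tpart p $ i * coeff_of (f i) \<alpha> * of_real (support_min (f i) \<mu>) * euler_mellin l \<theta> (p + mellin_shift i \<alpha>)
      = tpart p $ i * coeff_of (f i) \<alpha> * of_nat (facet_height f \<mu> i \<alpha>) * euler_mellin l \<theta> (p + mellin_shift i \<alpha>)"
      by (simp only: distrib_left distrib_right add_diff_cancel_right')
  qed
  finally show ?thesis .
qed

text \<open>
  The factor from \<open>prod_rGamma_shift\<close>, divided by the gamma argument of \<open>\<mu>\<close>. For exponents off the facet
  this argument is a factor of its Pochhammer symbol, hence the quotient is a polynomial. On the facet
  the coefficient is zero in any case.
\<close>

definition facet_coefficient :: "int ^ 'n \<Rightarrow> 'm \<Rightarrow> nat ^ 'n \<Rightarrow> complex ^ ('n + 'm) \<Rightarrow> complex" where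
  "facet_coefficient \<mu> i \<alpha> p = tpart p $ i * coeff_of (f i) \<alpha> * of_nat (facet_height f \<mu> i \<alpha>) *
     (pochhammer (gamma_arg f \<mu> p + 1) (facet_height f \<mu> i \<alpha> - 1) *
      (\<Prod>\<mu>'\<in>normals - {\<mu>}. pochhammer (gamma_arg f \<mu>' p) (facet_height f \<mu>' i \<alpha>)))"

definition facet_terms :: "int ^ 'n \<Rightarrow> ('m \<times> (nat ^ 'n)) set" where
  "facet_terms \<mu> = {(i, \<alpha>). \<alpha> \<in> support (f i) \<and> facet_height f \<mu> i \<alpha> \<ge> 1}"

lemma regularized_mellin_facet:
  assumes \<mu>: "\<mu> \<in> normals" and p: "p \<in> convergence_domain f" and \<theta>: "\<theta> \<in> U"
  shows "regularized_mellin \<theta> p = (\<Sum>(i, \<alpha>)\<in>facet_terms \<mu>. facet_coefficient \<mu> i \<alpha> p * regularized_mellin \<theta> (p + mellin_shift i \<alpha>))"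
proof -
  let ?g = "gamma_arg f \<mu> p" and ?h = "\<lambda>\<mu> i \<alpha>. facet_height f \<mu> i \<alpha>"
  have g: "?g \<noteq> 0" using p \<mu> by (auto simp: convergence_domain_iff)
  have "?g * regularized_mellin \<theta> p = (\<Sum>i\<in>UNIV. \<Sum>\<alpha>\<in>support (f i).
     tpart p $ i * coeff_of (f i) \<alpha> * of_nat (?h \<mu> i \<alpha>) * euler_mellin l \<theta> (p + mellin_shift i \<alpha>) * recip_gamma p)"
    unfolding regularized_mellin_def mult.assoc[symmetric] euler_mellin_facet_recursion[OF p \<theta>]
    by (simp add: sum_distrib_right)
  also have "\<dots> = (\<Sum>i\<in>UNIV. \<Sum>\<alpha>\<in>support (f i). ?g * (facet_coefficient \<mu> i \<alpha> p * regularized_mellin \<theta> (p + mellin_shift i \<alpha>)))"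
  proof (intro sum.cong refl)
    fix i \<alpha> assume \<alpha>: "\<alpha> \<in> support (f i)"
    show "tpart p $ i * coeff_of (f i) \<alpha> * of_nat (?h \<mu> i \<alpha>) * euler_mellin l \<theta> (p + mellin_shift i \<alpha>) * recip_gamma p
       = ?g * (facet_coefficient \<mu> i \<alpha> p * regularized_mellin \<theta> (p + mellin_shift i \<alpha>))"
    proof (cases "?h \<mu> i \<alpha>")
      case 0
      then show ?thesis by (simp add: facet_coefficient_def)
    next
      case (Suc k)
      have "shift_factor i \<alpha> p =
          pochhammer ?g (?h \<mu> i \<alpha>) * (\<Prod>\<mu>'\<in>normals - {\<mu>}. pochhammer (gamma_arg f \<mu>' p) (?h \<mu>' i \<alpha>))"
        by (rule prod.remove[OF finite_normals \<mu>])
      also have "pochhammer ?g (?h \<mu> i \<alpha>) = ?g * pochhammer (?g + 1) (?h \<mu> i \<alpha> - 1)"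
        by (simp add: Suc pochhammer_rec)
      finally have R: "recip_gamma p = ?g * pochhammer (?g + 1) (?h \<mu> i \<alpha> - 1) *
          (\<Prod>\<mu>'\<in>normals - {\<mu>}. pochhammer (gamma_arg f \<mu>' p) (?h \<mu>' i \<alpha>)) * recip_gamma (p + mellin_shift i \<alpha>)"
        by (simp only: prod_rGamma_shift[OF \<alpha> subset_refl, of p])
      show ?thesis unfolding R facet_coefficient_def regularized_mellin_def by (simp only: mult_ac)
    qed
  qed
  also have "\<dots> = ?g * (\<Sum>i\<in>UNIV. \<Sum>\<alpha>\<in>support (f i). facet_coefficient \<mu> i \<alpha> p * regularized_mellin \<theta> (p + mellin_shift i \<alpha>))"
    by (simp add: sum_distrib_left)
  finally have "regularized_mellin \<theta> p = (\<Sum>i\<in>UNIV. \<Sum>\<alpha>\<in>support (f i). facet_coefficient \<mu> i \<alpha> p * regularized_mellin \<theta> (p + mellin_shift i \<alpha>))"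
    using g by simp
  also have "\<dots> = (\<Sum>(i, \<alpha>)\<in>(SIGMA i:UNIV. support (f i)). facet_coefficient \<mu> i \<alpha> p * regularized_mellin \<theta> (p + mellin_shift i \<alpha>))"
    by (rule sum.Sigma) auto
  also have "\<dots> = (\<Sum>(i, \<alpha>)\<in>facet_terms \<mu>. facet_coefficient \<mu> i \<alpha> p * regularized_mellin \<theta> (p + mellin_shift i \<alpha>))"
    by (rule sum.mono_neutral_right) (auto simp: facet_terms_def facet_coefficient_def)
  finally show ?thesis .
qed

text \<open>
  The facets are handled by \<open>regularized_mellin_facet\<close>, the parameters \<open>t\<^sub>i\<close> by \<open>regularized_mellin_expand\<close>.
\<close>

lemma entire_regularized_mellin:
  assumes \<theta>: "\<theta> \<in> U"
  shows "\<exists>\<Phi>. holomorphic_vec_on \<Phi> UNIV \<and> (\<forall>p\<in>convergence_domain f. \<Phi> p = regularized_mellin \<theta> p)"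
proof -
  define C :: "(int ^ 'n + 'm) set" where "C = Inl ` normals \<union> range Inr"
  define L where "L c p = (case c of Inl \<mu> \<Rightarrow> Re (gamma_arg f \<mu> p) | Inr i \<Rightarrow> Re (tpart p $ i))" for c and p :: "complex ^ ('n + 'm)"
  define J where "J c = (case c of Inl \<mu> \<Rightarrow> facet_terms \<mu> | Inr i \<Rightarrow> {i} \<times> support (f i))" for c
  define P where "P c j p = (case c of Inl \<mu> \<Rightarrow> facet_coefficient \<mu> (fst j) (snd j) p
     | Inr i \<Rightarrow> coeff_of (f i) (snd j) * shift_factor i (snd j) p)" for c and j :: "'m \<times> (nat ^ 'n)" and p
  define v where "v c j = (mellin_shift (fst j) (snd j) :: complex ^ ('n + 'm))" for c :: "int ^ 'n + 'm" and j :: "'m \<times> (nat ^ 'n)"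
  have D: "{p. \<forall>c\<in>C. L c p > 0} = convergence_domain f"
    by (simp add: C_def L_def convergence_domain_iff ball_Un set_eq_iff conj_commute)
  have keys: "snd j \<in> support (f (fst j))" if "c \<in> C" "j \<in> J c" for c j
    using that by (auto simp: C_def J_def facet_terms_def)
  have linT: "holomorphic_vec_on (\<lambda>p. tpart p $ i) UNIV" for i :: 'm
    by (rule holomorphic_vec_on_linear) (simp_all add: tpart_def)
  have poch: "holomorphic_vec_on (\<lambda>p. pochhammer (gamma_arg f \<mu> p + c) n) UNIV" for \<mu> c n
    by (rule holomorphic_vec_on_compose[OF holomorphic_gamma_arg holomorphic_pochhammer])
  have "\<exists>\<Phi>. holomorphic_vec_on \<Phi> UNIV \<and> (\<forall>p\<in>{p. \<forall>c\<in>C. L c p > 0}. \<Phi> p = regularized_mellin \<theta> p)"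
  proof (rule entire_continuation_by_recurrences[where J = J and P = P and v = v])
    show "finite C" by (simp add: C_def finite_normals)
    show "linear (L c)" for c
    proof (cases c)
      case (Inl \<mu>)
      then show ?thesis using linear_Re_gamma_arg[of f \<mu>] by (simp add: L_def[abs_def])
    next
      case (Inr i)
      have "linear (\<lambda>p :: complex ^ ('n + 'm). Re (tpart p $ i))" by (rule linearI) (simp_all add: tpart_def)
      then show ?thesis using Inr by (simp add: L_def[abs_def])
    qed
    show "{p. \<forall>c\<in>C. L c p > 0} \<noteq> {}" unfolding D by (rule convergence_domain_nonempty)
    show "holomorphic_vec_on (regularized_mellin \<theta>) {p. \<forall>c\<in>C. L c p > 0}"
      unfolding D regularized_mellin_def[abs_def]
      by (intro holomorphic_vec_on_mult holomorphic_euler_mellin holomorphic_prod_rGamma \<theta>)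
    fix c j assume c: "c \<in> C" and j: "j \<in> J c"
    show "holomorphic_vec_on (P c j) UNIV"
    proof (cases c)
      case (Inl \<mu>)
      have "holomorphic_vec_on (facet_coefficient \<mu> (fst j) (snd j)) UNIV"
        unfolding facet_coefficient_def[abs_def]
        using poch[of _ 0] by (intro holomorphic_vec_on_mult linT holomorphic_vec_on_const poch holomorphic_vec_on_prod) simp
      then show ?thesis using Inl by (simp add: P_def[abs_def])
    next
      case (Inr i)
      have "holomorphic_vec_on (\<lambda>p. coeff_of (f i) (snd j) * shift_factor i (snd j) p) UNIV"
        using poch[of _ 0] by (intro holomorphic_vec_on_mult holomorphic_vec_on_const holomorphic_vec_on_prod) simp
      then show ?thesis using Inr by (simp add: P_def[abs_def])
    qed
    show "L c (v c j) \<ge> 1"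
    proof (cases c)
      case (Inl \<mu>)
      then show ?thesis using j by (auto simp: L_def v_def J_def facet_terms_def gamma_arg_shift)
    next
      case (Inr i)
      then show ?thesis using j by (auto simp: L_def v_def J_def tpart_def mellin_shift_def)
    qed
    show "L c' (v c j) \<ge> 0" for c'
    proof (cases c')
      case (Inl \<mu>)
      then show ?thesis using keys[OF c j] by (simp add: L_def v_def gamma_arg_shift)
    next
      case (Inr i)
      then show ?thesis by (simp add: L_def v_def tpart_def mellin_shift_def)
    qed
  next
    fix c p assume c: "c \<in> C" and "p \<in> {p. \<forall>c\<in>C. L c p > 0}"
    then have p: "p \<in> convergence_domain f" by (simp only: D)
    show "regularized_mellin \<theta> p = (\<Sum>j\<in>J c. P c j p * regularized_mellin \<theta> (p + v c j))"
    proof (cases c)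
      case (Inl \<mu>)
      then have "\<mu> \<in> normals" using c by (auto simp: C_def)
      from regularized_mellin_facet[OF this p \<theta>] show ?thesis using Inl
        by (simp add: J_def P_def v_def case_prod_unfold)
    next
      case (Inr i)
      have "(\<Sum>j\<in>{i} \<times> support (f i). P c j p * regularized_mellin \<theta> (p + v c j)) =
          (\<Sum>\<alpha>\<in>support (f i). P c (i, \<alpha>) p * regularized_mellin \<theta> (p + v c (i, \<alpha>)))"
        by (rule sum.reindex_bij_witness[of _ "\<lambda>\<alpha>. (i, \<alpha>)" snd]) auto
      then show ?thesis using regularized_mellin_expand[OF p \<theta>, of i] Inr
        by (simp add: J_def P_def v_def)
    qed
  qed
  then show ?thesis unfolding D .
qed

lemma gamma_factor_eq: "gamma_factor f p = inverse (recip_gamma p)"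
proof -
  have "gamma_factor f p = (\<Prod>\<mu>\<in>normals. inverse (rGamma (gamma_arg f \<mu> p)))"
    unfolding gamma_factor_def gamma_arg_def by (simp only: rGamma_inverse_Gamma inverse_inverse_eq)
  then show ?thesis using prod_inversef[of "\<lambda>\<mu>. rGamma (gamma_arg f \<mu> p)" normals] by (simp only: o_def)
qed

lemma prod_rGamma_nonzero:
  assumes "p \<in> convergence_domain f"
  shows "recip_gamma p \<noteq> 0"
proof -
  have "rGamma (gamma_arg f \<mu> p) \<noteq> 0" if "\<mu> \<in> normals" for \<mu>
  proof
    assume "rGamma (gamma_arg f \<mu> p) = 0"
    then have "gamma_arg f \<mu> p \<in> \<int>\<^sub>\<le>\<^sub>0" by (simp add: rGamma_eq_zero_iff)
    then have "Re (gamma_arg f \<mu> p) \<le> 0" by (auto elim!: nonpos_Ints_cases)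
    moreover have "Re (gamma_arg f \<mu> p) > 0" using assms that by (simp add: convergence_domain_iff)
    ultimately show False by simp
  qed
  then show ?thesis by (simp add: prod_zero_iff[OF finite_normals])
qed

text \<open>
  The gamma factor is the reciprocal of an entire function that has no zeros on the domain of convergence,
  so an entire factor is an entire continuation of the integral times this function.
\<close>

lemma entire_factor_iff:
  "entire_factor f l \<theta> \<Phi> \<longleftrightarrow> holomorphic_vec_on \<Phi> UNIV \<and> (\<forall>p\<in>convergence_domain f. \<Phi> p = regularized_mellin \<theta> p)"
proof -
  have mero: "meromorphic_vec_on (\<lambda>p. \<Phi> p * gamma_factor f p) UNIV" if \<Phi>: "holomorphic_vec_on \<Phi> UNIV"
    unfolding meromorphic_vec_on_def
  proof (rule ballI, rule exI[of _ UNIV], rule exI[of _ \<Phi>], rule exI[of _ recip_gamma], intro conjI ballI impI)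
    show "\<exists>w\<in>UNIV. recip_gamma w \<noteq> 0"
      using convergence_domain_nonempty prod_rGamma_nonzero by (meson UNIV_I ex_in_conv)
    show "holomorphic_vec_on recip_gamma UNIV" by (rule holomorphic_prod_rGamma)
    show "\<Phi> w * gamma_factor f w = \<Phi> w / recip_gamma w" for w
      by (simp only: gamma_factor_eq divide_inverse)
  qed (simp_all add: \<Phi> convex_connected)
  have "\<Phi> p * gamma_factor f p = euler_mellin l \<theta> p \<longleftrightarrow> \<Phi> p = regularized_mellin \<theta> p"
    if "p \<in> convergence_domain f" for p
    using prod_rGamma_nonzero[OF that]
    by (simp only: gamma_factor_eq regularized_mellin_def divide_inverse[symmetric] divide_eq_eq simp_thms if_True)
  then show ?thesis
    unfolding entire_factor_def meromorphic_continuation_def using mero by (metis (no_types))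
qed

lemma entire_factor_unique:
  assumes "entire_factor f l \<theta> \<Phi>" "entire_factor f l \<theta> \<Psi>"
  shows "\<Psi> = \<Phi>"
proof
  fix p
  show "\<Psi> p = \<Phi> p"
  proof (rule holomorphic_vec_identity[of UNIV \<Psi> \<Phi> "convergence_domain f"])
    show "\<Psi> q = \<Phi> q" if "q \<in> convergence_domain f" for q
      using assms that unfolding entire_factor_iff by metis
    show "holomorphic_vec_on \<Psi> UNIV" "holomorphic_vec_on \<Phi> UNIV"
      using assms unfolding entire_factor_iff by blast+
  qed (simp_all add: convergence_domain_nonempty open_convergence_domain)
qed

lemma euler_mellin_constant_on_component:
  assumes \<Theta>: "\<Theta> \<in> components U" and p: "p \<in> convergence_domain f"
  shows "(\<lambda>\<theta>. euler_mellin l \<theta> p) constant_on \<Theta>"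
proof (rule locally_constant_imp_constant)
  show "connected \<Theta>" using \<Theta> by (rule in_components_connected)
  fix \<theta>0 assume "\<theta>0 \<in> \<Theta>"
  then have "\<theta>0 \<in> U" using \<Theta> in_components_subset by blast
  then obtain r where r: "r > 0" "ball \<theta>0 r \<subseteq> U" using U openE by blast
  show "\<exists>S. openin (top_of_set \<Theta>) S \<and> \<theta>0 \<in> S \<and> (\<forall>\<theta>\<in>S. euler_mellin l \<theta> p = euler_mellin l \<theta>0 p)"
  proof (intro exI[of _ "\<Theta> \<inter> ball \<theta>0 r"] conjI ballI)
    show "openin (top_of_set \<Theta>) (\<Theta> \<inter> ball \<theta>0 r)" by (intro openin_open_Int) simp
    show "\<theta>0 \<in> \<Theta> \<inter> ball \<theta>0 r" using r \<open>\<theta>0 \<in> \<Theta>\<close> by simp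
    show "euler_mellin l \<theta> p = euler_mellin l \<theta>0 p" if "\<theta> \<in> \<Theta> \<inter> ball \<theta>0 r" for \<theta>
      using that by (intro euler_mellin_locally_constant[OF r(2) _ p]) simp
  qed
qed

end

theorem theorem3p2:
  fixes f :: "'m::finite \<Rightarrow> ('n::finite) cpoly"
    and l :: "'m \<Rightarrow> complex ^ 'n \<Rightarrow> complex"
  defines "R \<equiv> - closure (coamoeba (\<Prod>i\<in>UNIV. f i))"
  assumes full_dim: "aff_dim (newton_polytope (\<Prod>i\<in>UNIV. f i)) = int CARD('n)"
    and branch: "\<And>i. log_branch_on (f i) R (l i)"
  shows "(\<forall>\<theta>\<in>R. \<forall>p\<in>convergence_domain f.
            integrable lborel (\<lambda>x. euler_mellin_integrand l p (cvec x \<theta>))) \<and>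
         (\<forall>\<theta>\<^sub>0\<in>R. \<forall>\<^sub>F \<theta> in nhds \<theta>\<^sub>0. \<forall>p\<in>convergence_domain f.
            euler_mellin l \<theta> p = euler_mellin l \<theta>\<^sub>0 p) \<and>
         (\<forall>\<Theta>\<in>components R.
            (\<forall>p\<in>convergence_domain f. (\<lambda>\<theta>. euler_mellin l \<theta> p) constant_on \<Theta>) \<and>
            (\<exists>\<Phi>. \<forall>\<theta>\<in>\<Theta>. entire_factor f l \<theta> \<Phi> \<and> (\<forall>\<Psi>. entire_factor f l \<theta> \<Psi> \<longrightarrow> \<Psi> = \<Phi>)))"
proof -
  interpret log_branches f l R
  proof
    show "open R" unfolding R_def by (intro open_Compl closed_closure)
  qed (rule full_dim, rule branch)
  show ?thesis
  proof (intro conjI ballI)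
    fix \<theta> p assume "\<theta> \<in> R" "p \<in> convergence_domain f"
    then show "integrable lborel (\<lambda>x. euler_mellin_integrand l p (cvec x \<theta>))"
      by (intro integrable_mellin_integrand)
  next
    fix \<theta>0 assume "\<theta>0 \<in> R"
    then obtain r where r: "r > 0" "ball \<theta>0 r \<subseteq> R" using U openE by blast
    have "\<forall>\<^sub>F \<theta> in nhds \<theta>0. \<theta> \<in> ball \<theta>0 r" using r(1) by (intro eventually_nhds_in_open) auto
    then show "\<forall>\<^sub>F \<theta> in nhds \<theta>0. \<forall>p\<in>convergence_domain f. euler_mellin l \<theta> p = euler_mellin l \<theta>0 p"
      by eventually_elim (use euler_mellin_locally_constant[OF r(2)] in blast)
  next
    fix \<Theta> p assume "\<Theta> \<in> components R" "p \<in> convergence_domain f"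
    then show "(\<lambda>\<theta>. euler_mellin l \<theta> p) constant_on \<Theta>" by (rule euler_mellin_constant_on_component)
  next
    fix \<Theta> assume \<Theta>: "\<Theta> \<in> components R"
    then obtain \<theta>1 where \<theta>1: "\<theta>1 \<in> \<Theta>" using in_components_nonempty by blast
    then have "\<theta>1 \<in> R" using \<Theta> in_components_subset by blast
    then obtain \<Phi> where \<Phi>: "holomorphic_vec_on \<Phi> UNIV" "\<And>p. p \<in> convergence_domain f \<Longrightarrow> \<Phi> p = regularized_mellin \<theta>1 p"
      using entire_regularized_mellin by blast
    have "entire_factor f l \<theta> \<Phi>" if \<theta>: "\<theta> \<in> \<Theta>" for \<theta>
      unfolding entire_factor_iff
    proof (intro conjI ballI \<Phi>(1))
      fix p assume p: "p \<in> convergence_domain f"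
      have "euler_mellin l \<theta> p = euler_mellin l \<theta>1 p"
        using euler_mellin_constant_on_component[OF \<Theta> p] \<theta> \<theta>1 unfolding constant_on_def by metis
      then show "\<Phi> p = regularized_mellin \<theta> p" by (simp add: \<Phi>(2)[OF p] regularized_mellin_def)
    qed
    then show "\<exists>\<Phi>. \<forall>\<theta>\<in>\<Theta>. entire_factor f l \<theta> \<Phi> \<and> (\<forall>\<Psi>. entire_factor f l \<theta> \<Psi> \<longrightarrow> \<Psi> = \<Phi>)"
      using entire_factor_unique by blast
  qed
qed

end
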